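(* Let $\{p:(L,h)\to(M,g_M),\ I\}$ be horizontal data, with $\dim_{\mathbf C}M=m$. For each $\tau\in I$ let $\sigma_M(\tau)$ denote the scalar curvature of the Kähler metric $g_M(\tau)$ with Kähler form $\omega_M(\tau)=\omega_M-\tau\gamma$, and define $Q:I\times M\to\mathbf R$ by $Q(\tau)=\omega_M(\tau)^m/\omega_M^m$. Then for every momentum profile $\varphi$ on $I$, the scalar curvature of the associated bundle-adapted metric $g_\varphi$ is $$\sigma_\varphi=\sigma_M(\tau)-\frac{1}{2Q}\,\frac{\partial^2}{\partial\tau^2}(Q\varphi)(\tau),$$ where the circle-invariant function $\sigma_\varphi$ is regarded as a function on $I\times M$ via the map $(\tau,p)$ from the domain of $g_\varphi$ to $I\times M$, whose fibres are the orbits of the circle action.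
   Context: Conventions: a Kähler metric with local components $g_{i\bar\jmath}$ has Kähler form $\omega=\frac{\sqrt{-1}}2\sum g_{i\bar\jmath}\,dz^i\wedge d\bar z^j$ and Ricci form $\rho=-\sqrt{-1}\,\partial\bar\partial\log\det(g_{i\bar\jmath})$. Its scalar curvature is the trace of the endomorphism $\omega^{-1}\rho$ of $T^{1,0}$ (so $\rho=\lambda\omega$ in dimension $N$ gives scalar curvature $N\lambda$). $p:(L,h)\to(M,g_M)$ is an Hermitian holomorphic line bundle over a Kähler manifold with Kähler form $\omega_M$. Its curvature form is $\gamma=-\sqrt{-1}\,\partial\bar\partial\log h$, where $h$ also denotes the local function such that the squared norm on $L$ is $r=|z^0|^2h(z)$, $z^0$ being a linear fibre coordinate. Horizontal data $\{p:(L,h)\to(M,g_M),I\}$ consist of such a bundle together with an interval $I\subset\mathbf R$ such that $\omega_M(\tau):=\omega_M-\tau\gamma$ is positive for every $\tau\in I$. A momentum profile is a function $\varphi$ that is smooth on the closure of $I$ and positive on the interior of $I$. Momentum construction: let $(a,b)$ be the interior of $I$, fix $\tau_0\in(a,b)$, and set $t_1=\lim_{\tau\to a^+}\int_{\tau_0}^\tau dx/\varphi(x)$ and $t_2=\lim_{\tau\to b^-}\int_{\tau_0}^\tau dx/\varphi(x)$. For $t\in(t_1,t_2)$ define $\mu(t)$ and $f(t)$ by $t=\int_{\tau_0}^{\mu(t)}\frac{dx}{\varphi(x)}$ and $f(t)=\int_{\tau_0}^{\mu(t)}\frac{x\,dx}{\varphi(x)}$. Let $t=\frac12\log r$ be the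 logarithm of the norm function on $L$ minus its zero section. The bundle-adapted metric $g_\varphi$ is the Kähler metric on $\{t_1<t<t_2\}$ with Kähler form $\omega_\varphi=p^*\omega_M+2\sqrt{-1}\,\partial\bar\partial f(t)$. The function $\tau=\mu(t)$ is a moment map of the circle action rotating the fibres, and $g_\varphi(X,X)=\varphi(\tau)$, where $X$ is the generator of the action normalized by $\exp(2\pi X)=1$. *)

theory Defs
  imports "HOL-Analysis.Analysis"
begin

text \<open>Differentiability of class k, meant for open sets only.\<close>

primrec Ck_on :: "nat \<Rightarrow> ('v::real_normed_vector \<Rightarrow> 'w::real_normed_vector) \<Rightarrow> 'v set \<Rightarrow> bool" where
  "Ck_on 0 f S \<longleftrightarrow> continuous_on S f"
| "Ck_on (Suc k) f S \<longleftrightarrow> (\<forall>x\<in>S. f differentiable (at x)) \<and>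
     (\<forall>v. Ck_on k (\<lambda>x. frechet_derivative f (at x) v) S)"

definition smooth_on :: "('v::real_normed_vector \<Rightarrow> 'w::real_normed_vector) \<Rightarrow> 'v set \<Rightarrow> bool" where
  "smooth_on f S \<longleftrightarrow> (\<forall>k. Ck_on k f S)"

text \<open>A chart is a pair of a domain and a coordinate map; only the values of the coordinate map
  on the domain matter.\<close>

type_synonym ('a, 'n) chart = "'a set \<times> ('a \<Rightarrow> complex ^ 'n)"

definition chart_inv :: "('a, 'n::finite) chart \<Rightarrow> complex ^ 'n \<Rightarrow> 'a" where
  "chart_inv c = inv_into (fst c) (snd c)"

text \<open>The operators \<open>\<partial>/\<partial>z\<^sup>j = 1/2 (\<partial>/\<partial>x\<^sup>j - i \<partial>/\<partial>y\<^sup>j)\<close> and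
  \<open>1/2 (\<partial>/\<partial>x\<^sup>j + i \<partial>/\<partial>y\<^sup>j)\<close> of a chart, acting on functions on the manifold.\<close>

definition chart_deriv ::
  "('a, 'n::finite) chart \<Rightarrow> complex ^ 'n \<Rightarrow> ('a \<Rightarrow> complex) \<Rightarrow> 'a \<Rightarrow> complex" where
  "chart_deriv c v u x = frechet_derivative (u \<circ> chart_inv c) (at (snd c x)) v"

definition dz :: "('a, 'n::finite) chart \<Rightarrow> 'n \<Rightarrow> ('a \<Rightarrow> complex) \<Rightarrow> 'a \<Rightarrow> complex" where
  "dz c j u x = (chart_deriv c (axis j 1) u x - \<i> * chart_deriv c (axis j \<i>) u x) / 2"

definition dzbar :: "('a, 'n::finite) chart \<Rightarrow> 'n \<Rightarrow> ('a \<Rightarrow> complex) \<Rightarrow> 'a \<Rightarrow> complex" where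
  "dzbar c j u x = (chart_deriv c (axis j 1) u x + \<i> * chart_deriv c (axis j \<i>) u x) / 2"

definition smooth_in :: "('a, 'n::finite) chart \<Rightarrow> 'a set \<Rightarrow> ('a \<Rightarrow> complex) \<Rightarrow> bool" where
  "smooth_in c W u \<longleftrightarrow> smooth_on (u \<circ> chart_inv c) (snd c ` (fst c \<inter> W))"

text \<open>Smooth solutions of the Cauchy-Riemann equations.\<close>

definition holomorphic_in :: "('a, 'n::finite) chart \<Rightarrow> 'a set \<Rightarrow> ('a \<Rightarrow> complex) \<Rightarrow> bool" where
  "holomorphic_in c W u \<longleftrightarrow> smooth_in c W u \<and> (\<forall>x\<in>fst c \<inter> W. \<forall>j. dzbar c j u x = 0)"

definition complex_manifold :: "'a topology \<Rightarrow> ('a, 'n::finite) chart set \<Rightarrow> bool" where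
  "complex_manifold M A \<longleftrightarrow>
     Hausdorff_space M \<and> second_countable M \<and>
     (\<Union>c\<in>A. fst c) = topspace M \<and>
     (\<forall>c\<in>A. openin M (fst c) \<and> open (snd c ` fst c) \<and>
        homeomorphic_map (subtopology M (fst c)) (top_of_set (snd c ` fst c)) (snd c)) \<and>
     (\<forall>c\<in>A. \<forall>c'\<in>A. \<forall>k. holomorphic_in c (fst c') (\<lambda>x. snd c' x $ k))"

text \<open>Some chart (or, below, some local trivialization) around a given point. All notions defined
  with its help are independent of the choice.\<close>

definition around :: "('a set \<times> 'f) set \<Rightarrow> 'a \<Rightarrow> 'a set \<times> 'f" where
  "around A x = (SOME c. c \<in> A \<and> x \<in> fst c)"

text \<open>A field \<open>a\<close> of matrices, depending on a chart and a point of its domain, consists of the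
  components \<open>a c x $ i $ j\<close> of the form \<open>\<i> \<Sum>\<^sub>i\<^sub>j a\<^sub>i\<^sub>j dz\<^sup>i \<and> d\<bar>z\<^sup>j\<close>;
  the second index is the barred one. The metric \<open>g\<close> has Kaehler form with components \<open>g/2\<close>.\<close>

type_synonym ('a, 'n) form11 = "('a, 'n) chart \<Rightarrow> 'a \<Rightarrow> complex ^ 'n ^ 'n"

definition ddbar :: "('a \<Rightarrow> real) \<Rightarrow> ('a, 'n::finite) form11" where
  "ddbar u c x = (\<chi> i j. dz c i (dzbar c j (\<lambda>y. complex_of_real (u y))) x)"

text \<open>Components in the chart \<open>c\<close> of the pull-back by \<open>F\<close> of the form \<open>a\<close>, computed
  from the components of \<open>a\<close> in the chart \<open>c'\<close> of the target.\<close>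

definition pullback_via ::
  "('b, 'n::finite) chart \<Rightarrow> ('a \<Rightarrow> 'b) \<Rightarrow> ('b, 'n) form11 \<Rightarrow> ('a, 'k::finite) form11" where
  "pullback_via c' F a c x = (\<chi> i j. \<Sum>k\<in>UNIV. \<Sum>l\<in>UNIV. a c' (F x) $ k $ l *
     dz c i (\<lambda>y. snd c' (F y) $ k) x * cnj (dz c j (\<lambda>y. snd c' (F y) $ l) x))"

definition pullback ::
  "('b, 'n::finite) chart set \<Rightarrow> ('a \<Rightarrow> 'b) \<Rightarrow> ('b, 'n) form11 \<Rightarrow> ('a, 'k::finite) form11" where
  "pullback A F a c x = pullback_via (around A (F x)) F a c x"

definition kahler_form :: "('a, 'n::finite) form11 \<Rightarrow> ('a, 'n) form11" where
  "kahler_form g c x = (\<chi> i j. g c x $ i $ j / 2)"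

definition metric_of_form :: "('a, 'n::finite) form11 \<Rightarrow> ('a, 'n) form11" where
  "metric_of_form w c x = (\<chi> i j. 2 * w c x $ i $ j)"

definition positive_form :: "('a, 'n::finite) chart set \<Rightarrow> ('a, 'n) form11 \<Rightarrow> bool" where
  "positive_form A a \<longleftrightarrow> (\<forall>c\<in>A. \<forall>x\<in>fst c.
     (\<forall>i j. a c x $ j $ i = cnj (a c x $ i $ j)) \<and>
     (\<forall>v. v \<noteq> 0 \<longrightarrow> 0 < Re (\<Sum>i\<in>UNIV. \<Sum>j\<in>UNIV. a c x $ i $ j * v $ i * cnj (v $ j))))"

text \<open>For a Hermitian \<open>g\<close>, the last condition says that the Kaehler form is closed.\<close>

definition kahler_metric :: "('a, 'n::finite) chart set \<Rightarrow> ('a, 'n) form11 \<Rightarrow> bool" where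
  "kahler_metric A g \<longleftrightarrow>
     positive_form A g \<and>
     (\<forall>c\<in>A. \<forall>i j. smooth_in c (fst c) (\<lambda>x. g c x $ i $ j)) \<and>
     (\<forall>c\<in>A. \<forall>c'\<in>A. \<forall>x\<in>fst c \<inter> fst c'. g c x = pullback_via c' id g c x) \<and>
     (\<forall>c\<in>A. \<forall>x\<in>fst c. \<forall>i j k.
        dz c k (\<lambda>y. g c y $ i $ j) x = dz c i (\<lambda>y. g c y $ k $ j) x)"

definition ricci_form :: "('a, 'n::finite) form11 \<Rightarrow> ('a, 'n) form11" where
  "ricci_form g c x = - ddbar (\<lambda>y. ln (Re (det (g c y)))) c x"

text \<open>Determinants and traces of this kind are real for Hermitian matrices.\<close>

definition scalar_curvature ::
  "('a, 'n::finite) chart set \<Rightarrow> ('a, 'n) form11 \<Rightarrow> 'a \<Rightarrow> real" where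
  "scalar_curvature A g x = (let c = around A x in
     Re (trace (matrix_inv (kahler_form g c x) ** ricci_form g c x)))"

text \<open>For \<open>a = \<i> \<Sum>\<^sub>i\<^sub>j a\<^sub>i\<^sub>j dz\<^sup>i \<and> d\<bar>z\<^sup>j\<close> in dimension \<open>m\<close>, the coefficient of
  \<open>\<Prod>\<^sub>k (\<i> dz\<^sup>k \<and> d\<bar>z\<^sup>k)\<close> in the \<open>m\<close>-th exterior power of \<open>a\<close>.\<close>

definition top_power :: "complex ^ 'n ^ 'n::finite \<Rightarrow> complex" where
  "top_power a = (\<Sum>s | s permutes UNIV. \<Sum>t | t permutes UNIV.
     of_int (sign s) * of_int (sign t) * (\<Prod>k\<in>UNIV. a $ s k $ t k))"

definition volume_ratio ::
  "('a, 'n::finite) chart set \<Rightarrow> ('a, 'n) form11 \<Rightarrow> ('a, 'n) form11 \<Rightarrow> 'a \<Rightarrow> real" where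
  "volume_ratio A a b x = (let c = around A x in Re (top_power (a c x) / top_power (b c x)))"

text \<open>A local trivialization is a pair of an open subset of the base and a linear fibre coordinate
  on the part of the total space above it. The vector space structure of the fibres and the complex
  structure of the total space are those given by the trivializations.\<close>

type_synonym ('a, 'b) triv = "'a set \<times> ('b \<Rightarrow> complex)"

definition over :: "'b topology \<Rightarrow> ('b \<Rightarrow> 'a) \<Rightarrow> 'a set \<Rightarrow> 'b set" where
  "over L p U = {x \<in> topspace L. p x \<in> U}"

definition line_bundle ::
  "'a topology \<Rightarrow> ('a, 'm::finite) chart set \<Rightarrow> 'b topology \<Rightarrow> ('b \<Rightarrow> 'a) \<Rightarrow> ('a, 'b) triv set \<Rightarrow> bool"
where
  "line_bundle M A L p T \<longleftrightarrow>
     continuous_map L M p \<and>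
     (\<Union>t\<in>T. fst t) = topspace M \<and>
     (\<forall>t\<in>T. openin M (fst t) \<and>
        homeomorphic_map (subtopology L (over L p (fst t)))
          (prod_topology (subtopology M (fst t)) euclidean) (\<lambda>x. (p x, snd t x))) \<and>
     (\<forall>t\<in>T. \<forall>t'\<in>T. \<exists>k. (\<forall>c\<in>A. holomorphic_in c (fst t \<inter> fst t') k) \<and>
        (\<forall>q\<in>fst t \<inter> fst t'. k q \<noteq> 0) \<and>
        (\<forall>x\<in>over L p (fst t \<inter> fst t'). snd t' x = k (p x) * snd t x))"

definition total_atlas ::
  "('a, 'm::finite) chart set \<Rightarrow> 'b topology \<Rightarrow> ('b \<Rightarrow> 'a) \<Rightarrow> ('a, 'b) triv set
     \<Rightarrow> ('b, 'm option) chart set" where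
  "total_atlas A L p T = {(over L p (fst c \<inter> fst t),
       \<lambda>x. \<chi> i. case i of None \<Rightarrow> snd t x | Some k \<Rightarrow> snd c (p x) $ k) | c t. c \<in> A \<and> t \<in> T}"

text \<open>The local function \<open>h\<close> belonging to the squared norm \<open>r\<close> and a trivialization \<open>t\<close>,
  i.e. the squared norm of the local section on which the fibre coordinate is 1.\<close>

definition local_h ::
  "'b topology \<Rightarrow> ('b \<Rightarrow> 'a) \<Rightarrow> ('b \<Rightarrow> real) \<Rightarrow> ('a, 'b) triv \<Rightarrow> 'a \<Rightarrow> real" where
  "local_h L p r t q = r (THE s. s \<in> topspace L \<and> p s = q \<and> snd t s = 1)"

definition hermitian_structure ::
  "('a, 'm::finite) chart set \<Rightarrow> 'b topology \<Rightarrow> ('b \<Rightarrow> 'a) \<Rightarrow> ('a, 'b) triv set \<Rightarrow> ('b \<Rightarrow> real) \<Rightarrow> bool"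
where
  "hermitian_structure A L p T r \<longleftrightarrow> (\<forall>t\<in>T.
     (\<forall>q\<in>fst t. 0 < local_h L p r t q) \<and>
     (\<forall>c\<in>A. smooth_in c (fst t) (\<lambda>q. complex_of_real (local_h L p r t q))) \<and>
     (\<forall>x\<in>over L p (fst t). r x = (cmod (snd t x))\<^sup>2 * local_h L p r t (p x)))"

definition curvature_form ::
  "'b topology \<Rightarrow> ('b \<Rightarrow> 'a) \<Rightarrow> ('a, 'b) triv set \<Rightarrow> ('b \<Rightarrow> real) \<Rightarrow> ('a, 'm::finite) form11" where
  "curvature_form L p T r c q = - ddbar (\<lambda>y. ln (local_h L p r (around T q) y)) c q"

definition fibre_scale ::
  "'b topology \<Rightarrow> ('b \<Rightarrow> 'a) \<Rightarrow> ('a, 'b) triv set \<Rightarrow> complex \<Rightarrow> 'b \<Rightarrow> 'b" where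
  "fibre_scale L p T z x = (THE y. y \<in> topspace L \<and> p y = p x \<and>
     (\<forall>t\<in>T. p x \<in> fst t \<longrightarrow> snd t y = z * snd t x))"

text \<open>The form \<open>\<omega>\<^sub>M - \<tau> \<gamma>\<close> on the base.\<close>

definition base_form ::
  "('a, 'm::finite) form11 \<Rightarrow> 'b topology \<Rightarrow> ('b \<Rightarrow> 'a) \<Rightarrow> ('a, 'b) triv set \<Rightarrow> ('b \<Rightarrow> real)
     \<Rightarrow> real \<Rightarrow> ('a, 'm) form11" where
  "base_form g L p T r \<tau> c q = kahler_form g c q - \<tau> *\<^sub>R curvature_form L p T r c q"

definition horizontal_data ::
  "'a topology \<Rightarrow> ('a, 'm::finite) chart set \<Rightarrow> ('a, 'm) form11 \<Rightarrow>
   'b topology \<Rightarrow> ('b \<Rightarrow> 'a) \<Rightarrow> ('a, 'b) triv set \<Rightarrow> ('b \<Rightarrow> real) \<Rightarrow> real set \<Rightarrow> bool" where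
  "horizontal_data M A g L p T r I \<longleftrightarrow>
     complex_manifold M A \<and> kahler_metric A g \<and> line_bundle M A L p T \<and>
     hermitian_structure A L p T r \<and> is_interval I \<and>
     (\<forall>\<tau>\<in>I. positive_form A (base_form g L p T r \<tau>))"

text \<open>Smoothness on the closed set means existence of a smooth extension to a neighbourhood; the values
  of \<open>\<phi>\<close> outside the closure of \<open>I\<close> play no role.\<close>

definition momentum_profile :: "real set \<Rightarrow> (real \<Rightarrow> real) \<Rightarrow> bool" where
  "momentum_profile I \<phi> \<longleftrightarrow>
     (\<exists>V \<psi>. open V \<and> closure I \<subseteq> V \<and> smooth_on \<psi> V \<and> (\<forall>x\<in>closure I. \<psi> x = \<phi> x)) \<and>
     (\<forall>x\<in>interior I. 0 < \<phi> x)"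

definition lower_time :: "real set \<Rightarrow> (real \<Rightarrow> real) \<Rightarrow> real \<Rightarrow> ereal" where
  "lower_time I \<phi> \<tau>0 = Lim (at_right (Inf (ereal ` interior I)))
     (\<lambda>\<tau>. ereal (LBINT x=ereal \<tau>0..\<tau>. 1 / \<phi> x))"

definition upper_time :: "real set \<Rightarrow> (real \<Rightarrow> real) \<Rightarrow> real \<Rightarrow> ereal" where
  "upper_time I \<phi> \<tau>0 = Lim (at_left (Sup (ereal ` interior I)))
     (\<lambda>\<tau>. ereal (LBINT x=ereal \<tau>0..\<tau>. 1 / \<phi> x))"

definition moment :: "real set \<Rightarrow> (real \<Rightarrow> real) \<Rightarrow> real \<Rightarrow> real \<Rightarrow> real" where
  "moment I \<phi> \<tau>0 t =
     (THE \<tau>. \<tau> \<in> interior I \<and> t = (LBINT x=ereal \<tau>0..ereal \<tau>. 1 / \<phi> x))"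

definition potential :: "real set \<Rightarrow> (real \<Rightarrow> real) \<Rightarrow> real \<Rightarrow> real \<Rightarrow> real" where
  "potential I \<phi> \<tau>0 t = (LBINT x=ereal \<tau>0..ereal (moment I \<phi> \<tau>0 t). x / \<phi> x)"

text \<open>The function \<open>r\<close> is the squared norm.\<close>

definition log_norm :: "('b \<Rightarrow> real) \<Rightarrow> 'b \<Rightarrow> real" where
  "log_norm r x = ln (r x) / 2"

definition adapted_domain ::
  "'b topology \<Rightarrow> ('b \<Rightarrow> real) \<Rightarrow> real set \<Rightarrow> (real \<Rightarrow> real) \<Rightarrow> real \<Rightarrow> 'b set" where
  "adapted_domain L r I \<phi> \<tau>0 = {x \<in> topspace L. 0 < r x \<and>
     lower_time I \<phi> \<tau>0 < ereal (log_norm r x) \<and> ereal (log_norm r x) < upper_time I \<phi> \<tau>0}"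

definition adapted_metric ::
  "('a, 'm::finite) chart set \<Rightarrow> ('a, 'm) form11 \<Rightarrow> ('b \<Rightarrow> 'a) \<Rightarrow> ('b \<Rightarrow> real) \<Rightarrow>
   real set \<Rightarrow> (real \<Rightarrow> real) \<Rightarrow> real \<Rightarrow> ('b, 'm option) form11" where
  "adapted_metric A g p r I \<phi> \<tau>0 = metric_of_form (\<lambda>c x.
     pullback A p (kahler_form g) c x +
     2 *\<^sub>R ddbar (\<lambda>y. potential I \<phi> \<tau>0 (log_norm r y)) c x)"

end

theory Submission
  imports Defs
begin

text \<open>
  In coordinates \<open>(w, z)\<close> given by a chart and a trivialization, \<open>2 \<partial>t = dw/w + \<partial> log h\<close> and
  \<open>2 ddbar t = ddbar log h\<close>. Since \<open>f' = \<mu>\<close> and \<open>\<mu>' = \<phi>(\<mu>)\<close>, the form \<open>\<omega>\<^sub>\<phi>\<close> is block diagonal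
  with blocks \<open>\<phi>/2\<close> and \<open>\<omega>\<^sub>M(\<tau>)\<close> with respect to the coframe \<open>2 \<partial>t, dz\<^sup>a\<close>. Hence
  \<open>log det g\<^sub>\<phi> = G(t, z) - log |w|\<^sup>2 + const\<close> with \<open>G(t, z) = log (\<phi> det \<omega>\<^sub>M(\<tau>))\<close> at \<open>\<tau> = \<mu>(t)\<close>, and the
  diagonal blocks of the Ricci form in the same coframe are \<open>- G\<^sub>t\<^sub>t / 4\<close> and \<open>\<rho>\<^sub>M(\<tau>) + G\<^sub>t \<gamma> / 2\<close>.
  With \<open>E(\<tau>) = det \<omega>\<^sub>M(\<tau>)\<close> and \<open>e = \<phi> E\<close> one has \<open>G\<^sub>t = e'/E\<close>, and Jacobi's formula
  \<open>tr (\<omega>\<^sub>M(\<tau>)\<^sup>-\<^sup>1 \<gamma>) = - E'/E\<close> collapses the trace to \<open>\<sigma>\<^sub>M(\<tau>) - e''/(2E)\<close>; \<open>E\<close> is a multiple of \<open>Q\<close>.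
  Since the base chart chosen at a point need not be the one underlying the chart of the total space,
  chart independence of \<open>\<sigma>\<^sub>M\<close> and \<open>Q\<close> is needed as well.
\<close>

section \<open>Calculus of smooth functions\<close>

text \<open>The main obstacle is that the notions involve choices: a chart or a trivialization
  picked anew at each point, points given by \<open>THE\<close>, endpoints given by
  \<open>Lim\<close>, and a \<open>frechet_derivative\<close> that is meaningful only where a
  derivative exists. Each choice is first replaced by a fixed one on an open set, since two
  derivatives are to be taken. One principle does most of this: \<open>ddbar\<close> annihilates
  \<open>log |k|^2\<close> for holomorphic \<open>k\<close> without zeros. With \<open>k\<close> a
  transition function it frees the curvature from the trivialization, with \<open>k\<close> a
  Jacobian determinant it frees the Ricci form from the chart, with \<open>k = const / w\<close> it
  removes the fibre coordinate, and positive constants enter as squares of their roots. Logarithms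
  of determinants need positivity, hence the facts on positive Hermitian matrices. The metric being
  block diagonal, the mixed blocks of the Ricci form never reach the trace and stay unspecified. The
  \<open>1/2\<close> before the second derivative is \<open>(1/4) / (1/2)\<close>: a
  \<open>1/4\<close> from the two factors \<open>2 \<partial>t\<close>, divided by the
  \<open>1/2\<close> in the fibre component \<open>\<phi>/2\<close>.\<close>

lemma Ck_on_cong:
  assumes "open S" "\<And>x. x \<in> S \<Longrightarrow> f x = g x" "Ck_on k f S"
  shows "Ck_on k g S"
  using assms(2,3)
proof (induction k arbitrary: f g)
  case 0
  then show ?case using continuous_on_eq[of S f g] by simp
next
  case (Suc k)
  have d: "(g has_derivative frechet_derivative f (at x)) (at x)" if "x \<in> S" for x
  proof (rule has_derivative_transform_within_open[OF _ assms(1) that])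
    show "(f has_derivative frechet_derivative f (at x)) (at x)"
      using Suc.prems(2) that by (simp add: frechet_derivative_works[symmetric])
  qed (rule Suc.prems(1))
  have eq: "frechet_derivative f (at x) v = frechet_derivative g (at x) v" if "x \<in> S" for x v
    by (rule fun_cong[OF frechet_derivative_at[OF d[OF that]]])
  have "Ck_on k (\<lambda>x. frechet_derivative g (at x) v) S" for v
  proof (rule Suc.IH[OF eq])
    show "Ck_on k (\<lambda>x. frechet_derivative f (at x) v) S" using Suc.prems(2) by simp
  qed
  moreover have "\<forall>x\<in>S. g differentiable (at x)"
    using d differentiableI by blast
  ultimately show ?case unfolding Ck_on.simps by blast
qed

text \<open>A derivative found by the usual rules may replace \<open>frechet_derivative\<close>, by
  uniqueness of derivatives on an open set. Most closure properties below go through this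
  rule.\<close>

lemma Ck_on_SucI:
  assumes "open S" "\<And>x. x \<in> S \<Longrightarrow> (f has_derivative f' x) (at x)" "\<And>v. Ck_on k (\<lambda>x. f' x v) S"
  shows "Ck_on (Suc k) f S"
proof -
  have "Ck_on k (\<lambda>x. frechet_derivative f (at x) v) S" for v
    by (rule Ck_on_cong[OF assms(1) fun_cong[OF frechet_derivative_at[OF assms(2)]] assms(3)])
  moreover have "\<forall>x\<in>S. f differentiable (at x)"
    using assms(2) differentiableI by blast
  ultimately show ?thesis unfolding Ck_on.simps by blast
qed

lemma Ck_on_SucD: "Ck_on (Suc k) f S \<Longrightarrow> Ck_on k f S"
proof (induction k arbitrary: f)
  case 0
  then have "f differentiable_on S"
    unfolding differentiable_on_def using differentiable_at_withinI by auto
  then show ?case by (simp add: differentiable_imp_continuous_on)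
qed simp

lemma Ck_on_mono:
  assumes "Ck_on k f S" "j \<le> k"
  shows "Ck_on j f S"
  using assms(2,1)
proof (induction rule: dec_induct)
  case (step n)
  then show ?case using Ck_on_SucD[OF step.prems] by (rule_tac step.IH)
qed

lemma Ck_on_subset: "Ck_on k f S \<Longrightarrow> U \<subseteq> S \<Longrightarrow> Ck_on k f U"
proof (induction k arbitrary: f)
  case 0
  then show ?case using continuous_on_subset by auto
next
  case (Suc k)
  have "Ck_on k (\<lambda>x. frechet_derivative f (at x) v) U" for v
    using Suc.prems by (intro Suc.IH) simp_all
  then show ?case using Suc.prems by auto
qed

lemma Ck_on_imp_continuous_on: "Ck_on k f S \<Longrightarrow> continuous_on S f"
  using Ck_on_mono[of k f S 0] by simp

lemma Ck_on_const:
  assumes "open S"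
  shows "Ck_on k (\<lambda>x. c) S"
proof (induction k arbitrary: c)
  case (Suc k)
  show ?case by (rule Ck_on_SucI[OF assms has_derivative_const Suc.IH])
qed simp

lemma Ck_on_bounded_linear_compose:
  assumes "bounded_linear h" "open S" "Ck_on k f S"
  shows "Ck_on k (\<lambda>x. h (f x)) S"
  using assms(3)
proof (induction k arbitrary: f)
  case 0
  then show ?case using bounded_linear.continuous_on[OF assms(1)] by simp
next
  case (Suc k)
  have "((\<lambda>x. h (f x)) has_derivative (\<lambda>v. h (frechet_derivative f (at x) v))) (at x)" if "x \<in> S" for x
    using Suc.prems that
    by (intro bounded_linear.has_derivative[OF assms(1)]) (simp add: frechet_derivative_works[symmetric])
  moreover have "Ck_on k (\<lambda>x. h (frechet_derivative f (at x) v)) S" for v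
    by (rule Suc.IH) (use Suc.prems in simp)
  ultimately show ?case by (rule Ck_on_SucI[OF assms(2)])
qed

lemma Ck_on_bounded_linear:
  assumes "bounded_linear h" "open S"
  shows "Ck_on k h S"
proof (cases k)
  case 0
  then show ?thesis using linear_continuous_on[OF assms(1)] by simp
next
  case (Suc j)
  show ?thesis unfolding Suc
    by (rule Ck_on_SucI[OF assms(2) bounded_linear_imp_has_derivative[OF assms(1)] Ck_on_const[OF assms(2)]])
qed

lemma Ck_on_add:
  assumes "open S" "Ck_on k f S" "Ck_on k g S"
  shows "Ck_on k (\<lambda>x. f x + g x) S"
  using assms(2,3)
proof (induction k arbitrary: f g)
  case 0
  then show ?case by (auto intro!: continuous_intros)
next
  case (Suc k)
  let ?f' = "\<lambda>x. frechet_derivative f (at x)" and ?g' = "\<lambda>x. frechet_derivative g (at x)"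
  have "((\<lambda>x. f x + g x) has_derivative (\<lambda>v. ?f' x v + ?g' x v)) (at x)" if "x \<in> S" for x
    using Suc.prems that by (intro has_derivative_add) (auto simp: frechet_derivative_works[symmetric])
  moreover have "Ck_on k (\<lambda>x. ?f' x v + ?g' x v) S" for v
    by (rule Suc.IH) (use Suc.prems in simp_all)
  ultimately show ?case by (rule Ck_on_SucI[OF assms(1)])
qed

lemma Ck_on_bounded_bilinear:
  assumes B: "bounded_bilinear B" and S: "open S" and "Ck_on k f S" "Ck_on k g S"
  shows "Ck_on k (\<lambda>x. B (f x) (g x)) S"
  using assms(3,4)
proof (induction k arbitrary: f g)
  case 0
  then show ?case by (auto intro!: bounded_bilinear.continuous_on[OF B])
next
  case (Suc k)
  let ?f' = "\<lambda>x. frechet_derivative f (at x)" and ?g' = "\<lambda>x. frechet_derivative g (at x)"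
  note fg = Suc.prems[THEN Ck_on_SucD]
  have "((\<lambda>x. B (f x) (g x)) has_derivative (\<lambda>v. B (f x) (?g' x v) + B (?f' x v) (g x))) (at x)"
    if "x \<in> S" for x
    using Suc.prems that
    by (intro bounded_bilinear.FDERIV[OF B]) (auto simp: frechet_derivative_works[symmetric])
  moreover have "Ck_on k (\<lambda>x. B (f x) (?g' x v) + B (?f' x v) (g x)) S" for v
    by (intro Ck_on_add[OF S]; rule Suc.IH) (use Suc.prems fg in simp_all)
  ultimately show ?case by (rule Ck_on_SucI[OF S])
qed

lemma Ck_on_sum:
  assumes "open S" "\<And>i. i \<in> A \<Longrightarrow> Ck_on k (f i) S"
  shows "Ck_on k (\<lambda>x. \<Sum>i\<in>A. f i x) S"
  using assms(2)
  by (induction A rule: infinite_finite_induct) (simp_all add: Ck_on_const Ck_on_add assms(1))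

text \<open>The derivative of the composition applies a varying linear map to a varying vector,
  whereas \<open>Ck_on\<close> speaks of fixed directions only. Expanding the inner derivative in a
  basis of the middle space turns it into a finite sum of products, each covered by the induction
  hypothesis; hence the Euclidean middle space.\<close>

lemma Ck_on_compose:
  fixes f :: "'v::real_normed_vector \<Rightarrow> 'e::euclidean_space" and g :: "'e \<Rightarrow> 'w::real_normed_vector"
  assumes S: "open S" and U: "open U" "f ` S \<subseteq> U" and "Ck_on k f S" "Ck_on k g U"
  shows "Ck_on k (\<lambda>x. g (f x)) S"
  using assms(4,5)
proof (induction k arbitrary: g)
  case 0
  then show ?case using U by (auto intro: continuous_on_compose2)
next
  case (Suc k)
  let ?f' = "\<lambda>x. frechet_derivative f (at x)" and ?g' = "\<lambda>x. frechet_derivative g (at x)"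
  have d: "((\<lambda>x. g (f x)) has_derivative (\<lambda>v. \<Sum>b\<in>Basis. (?f' x v \<bullet> b) *\<^sub>R ?g' (f x) b)) (at x)"
    if x: "x \<in> S" for x
  proof -
    have f: "(f has_derivative ?f' x) (at x)" and g: "(g has_derivative ?g' (f x)) (at (f x))"
      using Suc.prems x U by (auto simp: frechet_derivative_works[symmetric])
    interpret g: linear "?g' (f x)" using g by (rule has_derivative_linear)
    have "((\<lambda>x. g (f x)) has_derivative (\<lambda>v. ?g' (f x) (?f' x v))) (at x)"
      using has_derivative_compose[OF f g] .
    moreover have "?g' (f x) (?f' x v) = (\<Sum>b\<in>Basis. (?f' x v \<bullet> b) *\<^sub>R ?g' (f x) b)" for v
      by (subst euclidean_representation[of "?f' x v", symmetric]) (simp only: g.sum g.scaleR)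
    ultimately show ?thesis by simp
  qed
  show ?case
  proof (rule Ck_on_SucI[OF S d])
    fix v
    show "Ck_on k (\<lambda>x. \<Sum>b\<in>Basis. (?f' x v \<bullet> b) *\<^sub>R ?g' (f x) b) S"
    proof (intro Ck_on_sum Ck_on_bounded_bilinear[OF bounded_bilinear_scaleR] S)
      show "Ck_on k (\<lambda>x. ?f' x v \<bullet> b) S" for b
        using Suc.prems(1) by (intro Ck_on_bounded_linear_compose[OF bounded_linear_inner_left] S) simp
      show "Ck_on k (\<lambda>x. ?g' (f x) b) S" for b
        using Suc.prems(2) by (intro Suc.IH[OF Suc.prems(1)[THEN Ck_on_SucD]]) simp
    qed
  qed
qed

text \<open>The derivative of \<open>inverse\<close> is a product of copies of
  \<open>inverse\<close>, so the induction feeds on itself.\<close>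

lemma Ck_on_inverse:
  assumes "open S" "\<And>x. x \<in> S \<Longrightarrow> x \<noteq> 0"
  shows "Ck_on k (inverse :: 'f::real_normed_field \<Rightarrow> 'f) S"
proof (induction k)
  case 0
  then show ?case using assms by (auto intro!: continuous_intros)
next
  case (Suc k)
  show ?case
  proof (rule Ck_on_SucI[where f' = "\<lambda>x v. - (inverse x * v * inverse x)"])
    fix v :: 'f
    have "Ck_on k (\<lambda>x. - (inverse x * inverse x * v)) S"
      by (intro Ck_on_bounded_linear_compose[OF bounded_linear_minus[OF bounded_linear_mult_left]]
          Ck_on_bounded_bilinear[OF bounded_bilinear_mult] assms Suc)
    then show "Ck_on k (\<lambda>x. - (inverse x * v * inverse x)) S"
      by (simp add: mult.commute mult.left_commute)
  qed (use assms in \<open>auto intro!: has_derivative_inverse'\<close>)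
qed

lemma Ck_on_ln: "Ck_on k ln {0::real<..}"
proof (cases k)
  case 0
  then show ?thesis by (auto intro!: continuous_intros)
next
  case (Suc j)
  have "Ck_on j (\<lambda>x::real. v * inverse x) {0<..}" for v
    by (intro Ck_on_bounded_linear_compose[OF bounded_linear_mult_right] Ck_on_inverse) auto
  then have "Ck_on (Suc j) ln {0::real<..}"
    by (intro Ck_on_SucI[where f' = "\<lambda>x v. v * inverse x"])
       (use DERIV_ln in \<open>auto simp: has_field_derivative_def mult_commute_abs\<close>)
  then show ?thesis by (simp only: Suc)
qed

section \<open>Smooth functions\<close>

lemma smooth_on_cong:
  "open S \<Longrightarrow> (\<And>x. x \<in> S \<Longrightarrow> f x = g x) \<Longrightarrow> smooth_on f S \<Longrightarrow> smooth_on g S"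
  using Ck_on_cong unfolding smooth_on_def by blast

lemma smooth_on_subset: "smooth_on f S \<Longrightarrow> U \<subseteq> S \<Longrightarrow> smooth_on f U"
  using Ck_on_subset unfolding smooth_on_def by blast

lemma smooth_on_const: "open S \<Longrightarrow> smooth_on (\<lambda>x. c) S"
  by (simp add: smooth_on_def Ck_on_const)

lemma smooth_on_bounded_linear_compose:
  "bounded_linear h \<Longrightarrow> open S \<Longrightarrow> smooth_on f S \<Longrightarrow> smooth_on (\<lambda>x. h (f x)) S"
  by (simp add: smooth_on_def Ck_on_bounded_linear_compose)

lemma smooth_on_bounded_linear: "bounded_linear h \<Longrightarrow> open S \<Longrightarrow> smooth_on h S"
  by (simp add: smooth_on_def Ck_on_bounded_linear)

lemma smooth_on_add:
  "open S \<Longrightarrow> smooth_on f S \<Longrightarrow> smooth_on g S \<Longrightarrow> smooth_on (\<lambda>x. f x + g x) S"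
  by (simp add: smooth_on_def Ck_on_add)

lemma smooth_on_diff:
  "open S \<Longrightarrow> smooth_on f S \<Longrightarrow> smooth_on g S \<Longrightarrow> smooth_on (\<lambda>x. f x - g x) S"
  using smooth_on_add[of S f "\<lambda>x. - g x"]
    smooth_on_bounded_linear_compose[OF bounded_linear_minus[OF bounded_linear_ident], of S g] by simp

lemma smooth_on_bounded_bilinear:
  "bounded_bilinear B \<Longrightarrow> open S \<Longrightarrow> smooth_on f S \<Longrightarrow> smooth_on g S \<Longrightarrow>
    smooth_on (\<lambda>x. B (f x) (g x)) S"
  by (simp add: smooth_on_def Ck_on_bounded_bilinear)

lemmas smooth_on_mult = smooth_on_bounded_bilinear[OF bounded_bilinear_mult]


lemma smooth_on_sum:
  "open S \<Longrightarrow> (\<And>i. i \<in> A \<Longrightarrow> smooth_on (f i) S) \<Longrightarrow> smooth_on (\<lambda>x. \<Sum>i\<in>A. f i x) S"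
  by (simp add: smooth_on_def Ck_on_sum)

lemma smooth_on_prod:
  fixes f :: "'i \<Rightarrow> 'v::real_normed_vector \<Rightarrow> 'f::real_normed_field"
  assumes "open S" "\<And>i. i \<in> A \<Longrightarrow> smooth_on (f i) S"
  shows "smooth_on (\<lambda>x. \<Prod>i\<in>A. f i x) S"
  using assms(2)
  by (induction A rule: infinite_finite_induct) (simp_all add: smooth_on_const smooth_on_mult assms(1))

lemma smooth_on_compose:
  fixes f :: "'v::real_normed_vector \<Rightarrow> 'e::euclidean_space"
  shows "open S \<Longrightarrow> open U \<Longrightarrow> f ` S \<subseteq> U \<Longrightarrow> smooth_on f S \<Longrightarrow> smooth_on g U \<Longrightarrow>
    smooth_on (\<lambda>x. g (f x)) S"
  by (simp add: smooth_on_def Ck_on_compose)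

lemma smooth_on_ln:
  fixes f :: "'v::real_normed_vector \<Rightarrow> real"
  shows "open S \<Longrightarrow> smooth_on f S \<Longrightarrow> (\<And>x. x \<in> S \<Longrightarrow> 0 < f x) \<Longrightarrow> smooth_on (\<lambda>x. ln (f x)) S"
  using smooth_on_compose[of S "{0::real<..}" f ln] by (auto simp: smooth_on_def Ck_on_ln)

lemma smooth_on_inverse:
  fixes f :: "'v::real_normed_vector \<Rightarrow> 'f::{real_normed_field, euclidean_space}"
  assumes "open S" "smooth_on f S" "\<And>x. x \<in> S \<Longrightarrow> f x \<noteq> 0"
  shows "smooth_on (\<lambda>x. inverse (f x)) S"
proof (rule smooth_on_compose[OF assms(1) _ _ assms(2)])
  show "smooth_on (inverse :: 'f \<Rightarrow> 'f) (-{0})"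
    by (auto simp: smooth_on_def intro!: Ck_on_inverse)
qed (use assms(3) in auto)

lemma smooth_on_differentiable: "smooth_on f S \<Longrightarrow> x \<in> S \<Longrightarrow> f differentiable (at x)"
  unfolding smooth_on_def using Ck_on.simps(2) by blast

lemma smooth_on_frechet_derivative:
  "smooth_on f S \<Longrightarrow> smooth_on (\<lambda>x. frechet_derivative f (at x) v) S"
  unfolding smooth_on_def using Ck_on.simps(2) by blast

lemma smooth_on_deriv:
  fixes f :: "real \<Rightarrow> real"
  assumes "open S" "smooth_on f S"
  shows "x \<in> S \<Longrightarrow> (f has_real_derivative deriv f x) (at x)" and "smooth_on (deriv f) S"
proof -
  show d: "(f has_real_derivative deriv f x) (at x)" if "x \<in> S" for x
    using smooth_on_differentiable[OF assms(2) that] by (simp add: DERIV_deriv_iff_real_differentiable)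
  have "frechet_derivative f (at x) 1 = deriv f x" if "x \<in> S" for x
    using frechet_derivative_at[OF d[OF that, unfolded has_field_derivative_def]] by (metis mult_1_right)
  then show "smooth_on (deriv f) S"
    using smooth_on_cong[OF assms(1) _ smooth_on_frechet_derivative[OF assms(2), of 1]] by blast
qed

lemma smooth_on_imp_continuous_on: "smooth_on f S \<Longrightarrow> continuous_on S f"
  unfolding smooth_on_def using Ck_on_imp_continuous_on by blast

lemma smooth_on_vec:
  fixes f :: "'v::real_normed_vector \<Rightarrow> complex^'n::finite"
  assumes "open S" "\<And>i. smooth_on (\<lambda>x. f x $ i) S"
  shows "smooth_on f S"
proof -
  have b: "bounded_linear (axis i :: complex \<Rightarrow> complex^'n)" for i
    by (auto intro!: linear_conv_bounded_linear[THEN iffD1] linearI simp: axis_def vec_eq_iff)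
  have "f = (\<lambda>x. \<Sum>i\<in>UNIV. axis i (f x $ i))"
    by (auto simp: vec_eq_iff axis_def if_distrib cong: if_cong)
  moreover have "smooth_on (\<lambda>x. \<Sum>i\<in>UNIV. axis i (f x $ i)) S"
    using assms by (intro smooth_on_sum smooth_on_bounded_linear_compose[OF b])
  ultimately show ?thesis by simp
qed

lemma smooth_on_Pair:
  assumes "open S" "smooth_on f S" "smooth_on g S"
  shows "smooth_on (\<lambda>x. (f x, g x)) S"
proof -
  have "smooth_on (\<lambda>x. (f x, 0) + (0, g x)) S"
    by (intro smooth_on_add assms
        smooth_on_bounded_linear_compose[OF bounded_linear_Pair[OF bounded_linear_ident bounded_linear_zero]]
        smooth_on_bounded_linear_compose[OF bounded_linear_Pair[OF bounded_linear_zero bounded_linear_ident]])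
  then show ?thesis by simp
qed

text \<open>Applying the mean value theorem first in direction \<open>u\<close> and then in
  direction \<open>v\<close> makes the second difference equal to \<open>h^2\<close> times the mixed
  derivative at an intermediate point; continuity of the mixed derivative does the rest.\<close>

lemma second_difference_limit:
  fixes f :: "'v::real_normed_vector \<Rightarrow> real"
  assumes S: "open S" "x \<in> S" and f: "smooth_on f S" and e: "0 < e"
  shows "\<exists>d>0. \<forall>h. 0 < h \<and> h < d \<longrightarrow>
    \<bar>f (x + h *\<^sub>R u + h *\<^sub>R v) - f (x + h *\<^sub>R u) - f (x + h *\<^sub>R v) + f x
      - h^2 * frechet_derivative (\<lambda>y. frechet_derivative f (at y) u) (at x) v\<bar> \<le> h^2 * e"
proof -
  define fu where "fu = (\<lambda>y. frechet_derivative f (at y) u)"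
  define fuv where "fuv = (\<lambda>y. frechet_derivative fu (at y) v)"
  have fu: "smooth_on fu S" using f smooth_on_frechet_derivative unfolding fu_def by blast
  have fuv: "smooth_on fuv S" using fu smooth_on_frechet_derivative unfolding fuv_def by blast
  have "isCont fuv x" using smooth_on_imp_continuous_on[OF fuv] S by (simp add: continuous_on_eq_continuous_at)
  then obtain d1 where d1: "0 < d1" "\<And>y. dist y x < d1 \<Longrightarrow> dist (fuv y) (fuv x) < e"
    using e unfolding continuous_at_eps_delta by blast
  obtain d2 where d2: "0 < d2" "ball x d2 \<subseteq> S" using S open_contains_ball by blast
  \<comment> \<open>The summand \<open>1\<close> keeps \<open>n\<close> positive when both
    directions vanish and makes the estimate below strict.\<close>
  define n where "n = norm u + norm v + 1"
  have n: "0 < n" by (simp add: n_def add_nonneg_pos)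
  define d where "d = min d1 d2 / n"
  have d: "0 < d" using d1 d2 n by (simp add: d_def)
  have close: "dist (x + a *\<^sub>R u + b *\<^sub>R v) x < min d1 d2" if "0 \<le> a" "0 \<le> b" "a \<le> h" "b \<le> h" "0 < h" "h < d" for a b h
  proof -
    have "dist (x + a *\<^sub>R u + b *\<^sub>R v) x \<le> a * norm u + b * norm v"
      using norm_triangle_ineq[of "a *\<^sub>R u" "b *\<^sub>R v"] that by (simp add: dist_norm add.assoc)
    also have "\<dots> \<le> h * norm u + h * norm v" using that by (intro add_mono mult_right_mono) auto
    also have "\<dots> < h * n" using that by (simp add: n_def algebra_simps)
    also have "\<dots> < d * n" using that n by simp
    also have "\<dots> = min d1 d2" using n by (simp add: d_def)
    finally show ?thesis .
  qed
  have "\<bar>f (x + h *\<^sub>R u + h *\<^sub>R v) - f (x + h *\<^sub>R u) - f (x + h *\<^sub>R v) + f x - h^2 * fuv x\<bar> \<le> h^2 * e"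
    if h: "0 < h" "h < d" for h
  proof -
    have inS: "x + a *\<^sub>R u + b *\<^sub>R v \<in> S" if "0 \<le> a" "0 \<le> b" "a \<le> h" "b \<le> h" for a b
      using close[OF that h] d2 by (auto simp: dist_commute subset_iff)
    have D1: "((\<lambda>s. f (x + s *\<^sub>R u + b *\<^sub>R v)) has_real_derivative fu (x + a *\<^sub>R u + b *\<^sub>R v)) (at a)"
      if "0 \<le> a" "0 \<le> b" "a \<le> h" "b \<le> h" for a b
    proof -
      have "(f has_derivative frechet_derivative f (at (x + a *\<^sub>R u + b *\<^sub>R v))) (at (x + a *\<^sub>R u + b *\<^sub>R v))"
        using smooth_on_differentiable[OF f inS[OF that]] by (simp add: frechet_derivative_works)
      note has_derivative_compose[where f = "\<lambda>s. x + s *\<^sub>R u + b *\<^sub>R v" and f' = "\<lambda>s. s *\<^sub>R u" and s = UNIV, OF _ this]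
      moreover have "((\<lambda>s. x + s *\<^sub>R u + b *\<^sub>R v) has_derivative (\<lambda>s. s *\<^sub>R u)) (at a)"
        by (auto intro!: derivative_eq_intros)
      moreover have "linear (frechet_derivative f (at (x + a *\<^sub>R u + b *\<^sub>R v)))"
        using smooth_on_differentiable[OF f inS[OF that]] linear_frechet_derivative by blast
      ultimately show ?thesis
        by (simp add: has_field_derivative_def fu_def linear_scale mult_commute_abs)
    qed
    have D2: "((\<lambda>s. fu (x + a *\<^sub>R u + s *\<^sub>R v)) has_real_derivative fuv (x + a *\<^sub>R u + b *\<^sub>R v)) (at b)"
      if "0 \<le> a" "0 \<le> b" "a \<le> h" "b \<le> h" for a b
    proof -
      have "(fu has_derivative frechet_derivative fu (at (x + a *\<^sub>R u + b *\<^sub>R v))) (at (x + a *\<^sub>R u + b *\<^sub>R v))"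
        using smooth_on_differentiable[OF fu inS[OF that]] by (simp add: frechet_derivative_works)
      note has_derivative_compose[where f = "\<lambda>s. x + a *\<^sub>R u + s *\<^sub>R v" and f' = "\<lambda>s. s *\<^sub>R v" and s = UNIV, OF _ this]
      moreover have "((\<lambda>s. x + a *\<^sub>R u + s *\<^sub>R v) has_derivative (\<lambda>s. s *\<^sub>R v)) (at b)"
        by (auto intro!: derivative_eq_intros)
      moreover have "linear (frechet_derivative fu (at (x + a *\<^sub>R u + b *\<^sub>R v)))"
        using smooth_on_differentiable[OF fu inS[OF that]] linear_frechet_derivative by blast
      ultimately show ?thesis
        by (simp add: has_field_derivative_def fuv_def linear_scale mult_commute_abs)
    qed
    \<comment> \<open>Mean value theorem for the increment in direction \<open>v\<close> as a
      function of the position along \<open>u\<close>; the multiples by \<open>0\<close> give all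
      four corners the shape that \<open>D1\<close> expects.\<close>
    have "\<exists>a. 0 < a \<and> a < h \<and> (f (x + h *\<^sub>R u + h *\<^sub>R v) - f (x + h *\<^sub>R u + 0 *\<^sub>R v)) - (f (x + 0 *\<^sub>R u + h *\<^sub>R v) - f (x + 0 *\<^sub>R u + 0 *\<^sub>R v))
        = (h - 0) * (fu (x + a *\<^sub>R u + h *\<^sub>R v) - fu (x + a *\<^sub>R u + 0 *\<^sub>R v))"
      using h by (intro MVT2[of 0 h "\<lambda>s. f (x + s *\<^sub>R u + h *\<^sub>R v) - f (x + s *\<^sub>R u + 0 *\<^sub>R v)"] DERIV_diff D1) auto
    then obtain a where a: "0 < a" "a < h" "f (x + h *\<^sub>R u + h *\<^sub>R v) - f (x + h *\<^sub>R u) - f (x + h *\<^sub>R v) + f x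
        = h * (fu (x + a *\<^sub>R u + h *\<^sub>R v) - fu (x + a *\<^sub>R u + 0 *\<^sub>R v))"
      by auto
    have "\<exists>b. 0 < b \<and> b < h \<and> fu (x + a *\<^sub>R u + h *\<^sub>R v) - fu (x + a *\<^sub>R u + 0 *\<^sub>R v) = (h - 0) * fuv (x + a *\<^sub>R u + b *\<^sub>R v)"
      using h a by (intro MVT2 D2) auto
    then obtain b where b: "0 < b" "b < h" "fu (x + a *\<^sub>R u + h *\<^sub>R v) - fu (x + a *\<^sub>R u + 0 *\<^sub>R v) = h * fuv (x + a *\<^sub>R u + b *\<^sub>R v)"
      by auto
    have "\<bar>fuv (x + a *\<^sub>R u + b *\<^sub>R v) - fuv x\<bar> \<le> e"
      using d1(2)[of "x + a *\<^sub>R u + b *\<^sub>R v"] close[of a b h] a b h by (auto simp: dist_real_def)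
    then have "h^2 * \<bar>fuv (x + a *\<^sub>R u + b *\<^sub>R v) - fuv x\<bar> \<le> h^2 * e"
      by (intro mult_left_mono) auto
    moreover have "f (x + h *\<^sub>R u + h *\<^sub>R v) - f (x + h *\<^sub>R u) - f (x + h *\<^sub>R v) + f x - h^2 * fuv x
      = h^2 * (fuv (x + a *\<^sub>R u + b *\<^sub>R v) - fuv x)"
      using a b by (simp add: power2_eq_square algebra_simps)
    ultimately show ?thesis by (simp add: abs_mult)
  qed
  then show ?thesis using d unfolding fuv_def fu_def by blast
qed

text \<open>The second difference is symmetric in \<open>u\<close> and \<open>v\<close>, yet it
  approximates both mixed derivatives.\<close>

lemma second_derivative_symmetric_real:
  fixes f :: "'v::real_normed_vector \<Rightarrow> real"
  assumes S: "open S" "x \<in> S" and f: "smooth_on f S"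
  shows "frechet_derivative (\<lambda>y. frechet_derivative f (at y) u) (at x) v =
         frechet_derivative (\<lambda>y. frechet_derivative f (at y) v) (at x) u" (is "?a = ?b")
proof (rule ccontr)
  assume "?a \<noteq> ?b"
  \<comment> \<open>Two errors of size \<open>e\<close> cannot bridge a gap of
    \<open>3 * e\<close>.\<close>
  define e where "e = \<bar>?a - ?b\<bar> / 3"
  have e: "0 < e" using \<open>?a \<noteq> ?b\<close> by (simp add: e_def)
  obtain d1 where d1: "0 < d1" "\<And>h. 0 < h \<Longrightarrow> h < d1 \<Longrightarrow>
    \<bar>f (x + h *\<^sub>R u + h *\<^sub>R v) - f (x + h *\<^sub>R u) - f (x + h *\<^sub>R v) + f x - h^2 * ?a\<bar> \<le> h^2 * e"
    using second_difference_limit[OF S f e, of u v] by blast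
  obtain d2 where d2: "0 < d2" "\<And>h. 0 < h \<Longrightarrow> h < d2 \<Longrightarrow>
    \<bar>f (x + h *\<^sub>R v + h *\<^sub>R u) - f (x + h *\<^sub>R v) - f (x + h *\<^sub>R u) + f x - h^2 * ?b\<bar> \<le> h^2 * e"
    using second_difference_limit[OF S f e, of v u] by blast
  define h where "h = min d1 d2 / 2"
  have h: "0 < h" "h < d1" "h < d2" using d1(1) d2(1) by (auto simp: h_def)
  have "x + h *\<^sub>R u + h *\<^sub>R v = x + h *\<^sub>R v + h *\<^sub>R u" by simp
  with d1(2)[OF h(1,2)] d2(2)[OF h(1,3)] have "\<bar>h^2 * ?a - h^2 * ?b\<bar> \<le> 2 * (h^2 * e)"
    by (smt (verit))
  then have "h^2 * \<bar>?a - ?b\<bar> \<le> h^2 * (2 * e)"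
    by (simp add: right_diff_distrib[symmetric] abs_mult)
  then have "\<bar>?a - ?b\<bar> \<le> 2 * e" using h by simp
  then show False using e by (simp add: e_def)
qed

lemma frechet_derivative_bounded_linear:
  assumes "bounded_linear h" "f differentiable (at x)"
  shows "frechet_derivative (\<lambda>y. h (f y)) (at x) v = h (frechet_derivative f (at x) v)"
  using frechet_derivative_at[OF bounded_linear.has_derivative[OF assms(1)
        frechet_derivative_works[THEN iffD1, OF assms(2)]]] by metis

text \<open>The mean value theorem being real, the claim is reduced to real and imaginary parts;
  \<open>h\<close> stands for either of these projections.\<close>

lemma second_derivative_symmetric:
  fixes f :: "'v::real_normed_vector \<Rightarrow> complex"
  assumes S: "open S" "x \<in> S" and f: "smooth_on f S"
  shows "frechet_derivative (\<lambda>y. frechet_derivative f (at y) u) (at x) v =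
         frechet_derivative (\<lambda>y. frechet_derivative f (at y) v) (at x) u"
proof -
  have *: "h (frechet_derivative (\<lambda>y. frechet_derivative f (at y) u) (at x) v) =
      frechet_derivative (\<lambda>y. frechet_derivative (\<lambda>z. h (f z)) (at y) u) (at x) v"
    if "bounded_linear h" for h :: "complex \<Rightarrow> real" and u v
  proof -
    have "h (frechet_derivative (\<lambda>y. frechet_derivative f (at y) u) (at x) v) =
       frechet_derivative (\<lambda>y. h (frechet_derivative f (at y) u)) (at x) v"
      using frechet_derivative_bounded_linear[OF that]
        smooth_on_differentiable[OF smooth_on_frechet_derivative[OF f] S(2)] by metis
    also have "\<dots> = frechet_derivative (\<lambda>y. frechet_derivative (\<lambda>z. h (f z)) (at y) u) (at x) v"
    proof (rule fun_cong[OF frechet_derivative_transform_within_open[OF _ S]])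
      show "(\<lambda>y. h (frechet_derivative f (at y) u)) differentiable (at x)"
        by (rule smooth_on_differentiable[OF smooth_on_bounded_linear_compose[OF that S(1)
            smooth_on_frechet_derivative[OF f]] S(2)])
    qed (simp add: frechet_derivative_bounded_linear[OF that smooth_on_differentiable[OF f]])
    finally show ?thesis .
  qed
  have "h (frechet_derivative (\<lambda>y. frechet_derivative f (at y) u) (at x) v) =
      h (frechet_derivative (\<lambda>y. frechet_derivative f (at y) v) (at x) u)"
    if "bounded_linear h" for h :: "complex \<Rightarrow> real"
    unfolding *[OF that]
    by (rule second_derivative_symmetric_real[OF S smooth_on_bounded_linear_compose[OF that S(1) f]])
  from this[OF bounded_linear_Re] this[OF bounded_linear_Im] show ?thesis by (simp add: complex_eq_iff)
qed

section \<open>Hermitian forms, determinants and traces\<close>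

definition cnj_matrix :: "complex ^ 'n ^ 'm \<Rightarrow> complex ^ 'n ^ 'm" where
  "cnj_matrix A = (\<chi> i j. cnj (A $ i $ j))"

text \<open>Effect on the components of a (1,1)-form of substituting a coframe whose
  \<open>k\<close>-th member has the coefficients \<open>N $ k\<close>. The conjugate falls on the
  second, barred index.\<close>

definition form_pullback :: "complex ^ 'k ^ 'n \<Rightarrow> complex ^ 'n ^ 'n \<Rightarrow> complex ^ 'k::finite ^ 'k" where
  "form_pullback N A = (\<chi> i j. \<Sum>k\<in>UNIV. \<Sum>l\<in>UNIV. A $ k $ l * N $ k $ i * cnj (N $ l $ j))"

lemma form_pullback_eq: "form_pullback N A = transpose N ** A ** cnj_matrix N"
  unfolding form_pullback_def cnj_matrix_def transpose_def matrix_matrix_mult_def vec_eq_iff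
  by (simp add: sum_distrib_right, subst sum.swap, simp add: mult_ac)

lemma form_pullback_uminus: "form_pullback N (- B) = - form_pullback N B"
  by (simp add: form_pullback_def vec_eq_iff sum_negf)

lemma det_cmult: "det (\<chi> i j. c * A $ i $ j) = c ^ CARD('n) * det A" for A :: "'a::comm_ring_1 ^ 'n ^ 'n"
  by (simp add: det_def prod.distrib sum_distrib_left mult.left_commute)

lemma det_cnj_matrix: "det (cnj_matrix A) = cnj (det A)"
  by (simp add: det_def cnj_matrix_def)

text \<open>The factors \<open>det N\<close> and its conjugate combine to a squared modulus. For a
  holomorphic change of frame, the logarithm of the determinant therefore changes by a pluriharmonic
  term only.\<close>

lemma det_form_pullback:
  fixes N :: "complex ^ 'n ^ 'n"
  shows "det (form_pullback N A) = of_real ((cmod (det N))\<^sup>2) * det A"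
  by (simp add: form_pullback_eq det_mul det_cnj_matrix complex_norm_square mult_ac del: of_real_power)

lemma matrix_inv_mult:
  fixes A :: "complex ^ 'n ^ 'n"
  assumes "det A \<noteq> 0"
  shows "A ** matrix_inv A = mat 1" "matrix_inv A ** A = mat 1"
proof -
  have "\<exists>B. A ** B = mat 1 \<and> B ** A = mat 1"
    using assms invertible_det_nz[of A] by (simp add: invertible_def)
  from someI_ex[OF this] show "A ** matrix_inv A = mat 1" "matrix_inv A ** A = mat 1"
    by (simp_all add: matrix_inv_def)
qed

lemma matrix_inv_eqI:
  fixes A B :: "complex ^ 'n ^ 'n"
  assumes "B ** A = mat 1"
  shows "matrix_inv A = B"
proof -
  have "det B * det A = 1" using assms by (metis det_mul det_I)
  then have "det A \<noteq> 0" by auto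
  then show ?thesis by (metis assms matrix_inv_mult(1) matrix_mul_assoc matrix_mul_lid matrix_mul_rid)
qed

text \<open>Pulling back both forms conjugates the endomorphism \<open>matrix_inv A ** R\<close> by
  \<open>cnj_matrix N\<close>. This serves changes of chart on the base as well as the passage to
  the coframe on the total space.\<close>

lemma trace_form_pullback:
  fixes N :: "complex ^ 'n ^ 'n"
  assumes "det N \<noteq> 0" "det A \<noteq> 0"
  shows "trace (matrix_inv (form_pullback N A) ** form_pullback N R) = trace (matrix_inv A ** R)"
proof -
  let ?C = "cnj_matrix N" and ?T = "transpose N"
  have C: "det ?C \<noteq> 0" and T: "det ?T \<noteq> 0" using assms by (simp_all add: det_cnj_matrix)
  have "matrix_inv (form_pullback N A) = matrix_inv ?C ** matrix_inv A ** matrix_inv ?T"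
  proof (rule matrix_inv_eqI)
    have "matrix_inv ?C ** matrix_inv A ** matrix_inv ?T ** form_pullback N A
       = matrix_inv ?C ** (matrix_inv A ** (matrix_inv ?T ** ?T) ** A) ** ?C"
      by (simp add: form_pullback_eq matrix_mul_assoc)
    also have "\<dots> = mat 1"
      by (simp add: matrix_inv_mult C T assms)
    finally show "matrix_inv ?C ** matrix_inv A ** matrix_inv ?T ** form_pullback N A = mat 1" .
  qed
  then have "matrix_inv (form_pullback N A) ** form_pullback N R
     = matrix_inv ?C ** (matrix_inv A ** ((matrix_inv ?T ** ?T) ** (R ** ?C)))"
    by (simp add: form_pullback_eq matrix_mul_assoc)
  also have "\<dots> = matrix_inv ?C ** (matrix_inv A ** R ** ?C)"
    by (subst matrix_inv_mult(2)[OF T]) (simp add: matrix_mul_assoc)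
  finally have "trace (matrix_inv (form_pullback N A) ** form_pullback N R)
     = trace ((matrix_inv A ** R ** ?C) ** matrix_inv ?C)"
    by (metis trace_mul_sym)
  also have "(matrix_inv A ** R ** ?C) ** matrix_inv ?C = matrix_inv A ** R ** (?C ** matrix_inv ?C)"
    by (simp add: matrix_mul_assoc)
  finally show ?thesis by (simp add: matrix_inv_mult C)
qed

section \<open>Matrices split into fibre index \<open>None\<close> and base indices
  \<open>Some\<close>\<close>

definition some_block :: "'a ^ 'm option ^ 'm option \<Rightarrow> 'a ^ 'm::finite ^ 'm" where
  "some_block A = (\<chi> a b. A $ Some a $ Some b)"

lemma sum_option_UNIV: "(\<Sum>i\<in>UNIV. f i) = f None + (\<Sum>a\<in>UNIV. f (Some a))" for f :: "'m::finite option \<Rightarrow> 'b::comm_monoid_add"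
  by (simp add: UNIV_option_conv sum.reindex)

lemma prod_option_UNIV: "(\<Prod>i\<in>UNIV. f i) = f None * (\<Prod>a\<in>UNIV. f (Some a))" for f :: "'m::finite option \<Rightarrow> 'b::comm_monoid_mult"
  by (simp add: UNIV_option_conv prod.reindex)

text \<open>Makes \<open>sign_map_permutation\<close> applicable to permutations of the base indices
  extended by fixing \<open>None\<close>.\<close>

lemma map_permutation_Some:
  assumes "q permutes (UNIV :: 'm::finite set)"
  shows "map_permutation UNIV Some q = map_option q"
proof
  fix x
  show "map_permutation UNIV Some q x = map_option q x"
    by (cases x) (auto simp: map_permutation_apply assms map_permutation_def restrict_id_def)
qed

text \<open>A permutation that sends some \<open>Some a\<close> to \<open>None\<close> picks up a
  vanishing entry, so only those fixing \<open>None\<close> survive in the Leibniz sum. Triangular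
  shape is enough, which covers \<open>coframe\<close> too.\<close>

lemma det_block:
  fixes A :: "'a::comm_ring_1 ^ 'm::finite option ^ 'm option"
  assumes "\<And>a. A $ Some a $ None = 0"
  shows "det A = A $ None $ None * det (some_block A)"
proof -
  let ?P = "{p. p permutes (UNIV :: 'm option set)}"
  have fin: "finite ?P" by (simp add: finite_permutations)
  have "det A = (\<Sum>p\<in>?P. of_int (sign p) * (\<Prod>i\<in>UNIV. A $ i $ p i))" by (simp add: det_def)
  also have "\<dots> = (\<Sum>p\<in>{p\<in>?P. p None = None}. of_int (sign p) * (\<Prod>i\<in>UNIV. A $ i $ p i))"
  proof (rule sum.mono_neutral_right[OF fin], safe)
    fix p :: "'m option \<Rightarrow> 'm option"
    assume p: "p permutes UNIV" and nz: "of_int (sign p) * (\<Prod>i\<in>UNIV. A $ i $ p i) \<noteq> 0"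
    obtain x where x: "p x = None" using p by (metis permutes_surj surjD)
    then show "p None = None"
    proof (cases x)
      case (Some a)
      then have "(\<Prod>i\<in>UNIV. A $ i $ p i) = 0" using x assms by (intro prod_zero bexI[of _ "Some a"]) auto
      then show ?thesis using nz by simp
    qed simp
  qed
  \<comment> \<open>Permutations fixing \<open>None\<close> correspond to permutations of the base
    indices through \<open>map_option\<close>, with equal sign.\<close>
  also have "\<dots> = (\<Sum>q\<in>{q. q permutes (UNIV::'m set)}.
      of_int (sign q) * (A $ None $ None * (\<Prod>a\<in>UNIV. A $ Some a $ Some (q a))))"
  proof (rule sum.reindex_bij_witness[where i = map_option and j = "\<lambda>p a. the (p (Some a))"])
    fix p assume "p \<in> {p\<in>?P. p None = None}"
    then have p: "p permutes UNIV" "p None = None" by auto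
    have ps: "p (Some a) \<noteq> None" for a using p by (metis permutes_inj injD option.distinct(1))
    let ?q = "\<lambda>a. the (p (Some a))"
    show "map_option ?q = p"
    proof
      fix x show "map_option ?q x = p x" using p ps by (cases x) auto
    qed
    have "inj ?q"
      using ps permutes_inj[OF p(1)] by (intro injI) (metis injD option.expand option.inject)
    then show q: "?q \<in> {q. q permutes UNIV}"
      by (intro CollectI bij_imp_permutes) (auto simp: bij_betw_def finite_UNIV_inj_surj)
    have "sign p = sign ?q"
      using sign_map_permutation[of Some UNIV ?q] map_permutation_Some[of ?q] q \<open>map_option ?q = p\<close> by simp
    then show "of_int (sign ?q) * (A $ None $ None * (\<Prod>a\<in>UNIV. A $ Some a $ Some (?q a))) =
        of_int (sign p) * (\<Prod>i\<in>UNIV. A $ i $ p i)"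
      using p ps by (simp add: prod_option_UNIV)
  next
    fix q assume "q \<in> {q. q permutes (UNIV::'m set)}"
    then have q: "q permutes UNIV" by simp
    then show "map_option q \<in> {p\<in>?P. p None = None}"
      using map_permutation_permutes[of Some UNIV "range Some" q]
      by (auto simp: map_permutation_Some bij_betw_def intro: permutes_subset)
    show "(\<lambda>a. the (map_option q (Some a))) = q" by simp
  qed
  also have "\<dots> = A $ None $ None * det (some_block A)"
    by (simp add: det_def some_block_def sum_distrib_left mult_ac)
  finally show ?thesis .
qed

text \<open>The inverse of a block diagonal matrix is block diagonal, so the mixed entries of
  \<open>R\<close> never meet a nonzero factor.\<close>

lemma trace_block:
  fixes D :: "complex ^ 'm::finite option ^ 'm option"
  assumes "\<And>a. D $ Some a $ None = 0" "\<And>a. D $ None $ Some a = 0"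
    and d: "D $ None $ None \<noteq> 0" "det (some_block D) \<noteq> 0"
  shows "trace (matrix_inv D ** R) =
    R $ None $ None / D $ None $ None + trace (matrix_inv (some_block D) ** some_block R)"
proof -
  let ?I = "matrix_inv (some_block D)"
  define E :: "complex ^ 'm option ^ 'm option" where
    "E = (\<chi> i j. case i of None \<Rightarrow> (case j of None \<Rightarrow> inverse (D $ None $ None) | Some b \<Rightarrow> 0)
        | Some a \<Rightarrow> (case j of None \<Rightarrow> 0 | Some b \<Rightarrow> ?I $ a $ b))"
  have I: "(\<Sum>c\<in>UNIV. ?I $ a $ c * D $ Some c $ Some b) = (if a = b then 1 else 0)" for a b
    using matrix_inv_mult(2)[OF d(2)]
    by (simp add: matrix_matrix_mult_def vec_eq_iff mat_def some_block_def)
  have "E ** D = mat 1"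
    unfolding vec_eq_iff
  proof (intro allI)
    fix i j show "(E ** D) $ i $ j = mat 1 $ i $ j"
      using assms by (cases i; cases j)
        (auto simp: E_def matrix_matrix_mult_def sum_option_UNIV mat_def I)
  qed
  then have "matrix_inv D = E" by (rule matrix_inv_eqI)
  then show ?thesis
    by (simp add: trace_def matrix_matrix_mult_def sum_option_UNIV E_def some_block_def field_simps)
qed

text \<open>A permutation other than the identity moves at least two indices. After the product rule
  has removed one factor, another off-diagonal factor remains and vanishes at \<open>h = 0\<close>,
  so only the identity contributes.\<close>

lemma has_field_derivative_det_unipotent:
  fixes X :: "complex ^ 'n ^ 'n"
  shows "((\<lambda>h. det (\<chi> i j. (if i = j then 1 else 0) + h * X $ i $ j)) has_field_derivative trace X) (at 0)"
proof -
  let ?P = "{p. p permutes (UNIV :: 'n set)}"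
  let ?d = "\<lambda>i j. if i = (j::'n) then 1 else 0 :: complex"
  let ?S = "\<lambda>p. \<Sum>i\<in>UNIV. X $ i $ p i * (\<Prod>j\<in>UNIV-{i}. ?d j (p j) + 0 * X $ j $ p j)"
  have fin: "finite ?P" by (simp add: finite_permutations)
  have "((\<lambda>h. \<Sum>p\<in>?P. of_int (sign p) * (\<Prod>i\<in>UNIV. ?d i (p i) + h * X $ i $ p i)) has_field_derivative
     (\<Sum>p\<in>?P. of_int (sign p) * ?S p)) (at 0)"
    by (intro DERIV_sum DERIV_cmult has_field_derivative_prod) (auto intro!: derivative_eq_intros)
  also have "(\<Sum>p\<in>?P. of_int (sign p) * ?S p)
     = (\<Sum>p\<in>{id}. of_int (sign p) * ?S p)"
  proof (rule sum.mono_neutral_right[OF fin])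
    show "{id} \<subseteq> ?P" by (simp add: permutes_id)
    show "\<forall>p\<in>?P - {id}. of_int (sign p) * ?S p = 0"
    proof
      fix p :: "'n \<Rightarrow> 'n" assume "p \<in> ?P - {id}"
      then have p: "p permutes UNIV" and ne: "p \<noteq> id" by auto
      have "(\<Prod>j\<in>UNIV-{i}. ?d j (p j) + 0 * X $ j $ p j) = 0" for i
      proof -
        \<comment> \<open>A permutation that fixes everything except possibly \<open>i\<close> also
          fixes \<open>i\<close>, by injectivity.\<close>
        have "\<exists>j. j \<noteq> i \<and> p j \<noteq> j"
        proof (rule ccontr)
          assume "\<not> ?thesis"
          then have "p j = j" if "j \<noteq> i" for j using that by blast
          moreover from this have "p i = i" using permutes_inj[OF p] by (metis injD)
          ultimately have "p = id" by (metis eq_id_iff ext)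
          then show False using ne by simp
        qed
        then obtain j where "j \<noteq> i" "j \<noteq> p j" by metis
        then show ?thesis by (intro prod_zero) auto
      qed
      then show "of_int (sign p) * ?S p = 0"
        by (simp only: mult_zero_right sum.neutral_const)
    qed
  qed
  also have "\<dots> = trace X" by (simp add: trace_def)
  finally show ?thesis by (simp add: det_def)
qed

text \<open>Jacobi's formula for an affine pencil: with \<open>X\<close> the negative of
  \<open>matrix_inv (A s) ** G\<close>, the matrix \<open>A h\<close> is \<open>A s\<close> times
  the identity plus \<open>(h - s) X\<close>, which reduces to the derivative at the
  identity.\<close>

lemma has_field_derivative_det_pencil:
  fixes K G :: "complex ^ 'n ^ 'n"
  defines "A \<equiv> \<lambda>s. \<chi> i j. K $ i $ j - s * G $ i $ j"
  assumes "det (A s) \<noteq> 0"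
  shows "((\<lambda>h. det (A h)) has_field_derivative - (det (A s) * trace (matrix_inv (A s) ** G))) (at s)"
proof -
  define X where "X = - (matrix_inv (A s) ** G)"
  have X: "A s ** X = - G"
  proof -
    have "A s ** X = - ((A s ** matrix_inv (A s)) ** G)"
      by (simp add: X_def matrix_mul_assoc vec_eq_iff)
         (simp add: matrix_mul_assoc[symmetric], simp add: matrix_matrix_mult_def sum_negf)
    then show ?thesis by (simp add: matrix_inv_mult[OF assms(2)])
  qed
  have fac: "A h = A s ** (\<chi> i j. (if i = j then 1 else 0) + (h - s) * X $ i $ j)" for h
  proof -
    have "(A s ** (\<chi> i j. (if i = j then 1 else 0) + (h - s) * X $ i $ j)) $ i $ j
       = A s $ i $ j + (h - s) * (A s ** X) $ i $ j" for i j
      by (simp add: matrix_matrix_mult_def distrib_left sum.distrib sum_distrib_left mult_delta_right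
          mult.left_commute[of "h - s"])
    also have "\<dots> i j = A h $ i $ j" for i j
      by (simp only: X) (simp add: A_def algebra_simps)
    finally show ?thesis by (simp add: vec_eq_iff)
  qed
  have eq: "det (A h) = det (A s) * det (\<chi> i j. (if i = j then 1 else 0) + (h - s) * X $ i $ j)" for h
    by (subst fac) (rule det_mul)
  have "((\<lambda>h. det (\<chi> i j. (if i = j then 1 else 0) + (h - s) * X $ i $ j)) has_field_derivative trace X) (at s)"
    using has_field_derivative_det_unipotent[of X]
      DERIV_shift[of "\<lambda>h. det (\<chi> i j. (if i = j then 1 else 0) + (h - s) * X $ i $ j)" "trace X" 0 s]
    by simp
  from DERIV_cmult[OF this, of "det (A s)"]
  have "((\<lambda>h. det (A h)) has_field_derivative det (A s) * trace X) (at s)"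
    by (simp add: eq[symmetric])
  moreover have "trace X = - trace (matrix_inv (A s) ** G)"
    by (simp add: X_def trace_def sum_negf)
  ultimately show ?thesis by simp
qed

section \<open>Positive Hermitian matrices and top exterior powers\<close>

definition positive_hermitian :: "complex ^ 'n ^ 'n \<Rightarrow> bool" where
  "positive_hermitian A \<longleftrightarrow> (\<forall>i j. A $ j $ i = cnj (A $ i $ j)) \<and>
    (\<forall>v. v \<noteq> 0 \<longrightarrow> 0 < Re (\<Sum>i\<in>UNIV. \<Sum>j\<in>UNIV. A $ i $ j * v $ i * cnj (v $ j)))"

text \<open>A kernel vector would annihilate the quadratic form. The transpose occurs because the
  form contracts \<open>v\<close> with the first index.\<close>

lemma positive_hermitian_det_nz:
  assumes "positive_hermitian A"
  shows "det A \<noteq> 0"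
proof
  assume "det A = 0"
  then have "det (transpose A) = 0" by simp
  then have "\<not> (\<exists>B. B ** transpose A = mat 1)"
    using invertible_det_nz invertible_left_inverse by blast
  then obtain v where v: "transpose A *v v = 0" "v \<noteq> 0"
    using matrix_left_invertible_ker[of "transpose A"] by blast
  have "(\<Sum>i\<in>UNIV. A $ i $ j * v $ i) = 0" for j
    using v(1) by (simp add: vec_eq_iff matrix_vector_mult_def transpose_def)
  then have "(\<Sum>j\<in>UNIV. (\<Sum>i\<in>UNIV. A $ i $ j * v $ i) * cnj (v $ j)) = 0" by simp
  then have "(\<Sum>i\<in>UNIV. \<Sum>j\<in>UNIV. A $ i $ j * v $ i * cnj (v $ j)) = 0"
    by (subst sum.swap) (simp add: sum_distrib_right)
  moreover have "0 < Re (\<Sum>i\<in>UNIV. \<Sum>j\<in>UNIV. A $ i $ j * v $ i * cnj (v $ j))"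
    using assms v(2) unfolding positive_hermitian_def by blast
  ultimately show False by (metis order_less_irrefl zero_complex.sel(1))
qed

lemma hermitian_det_real:
  assumes "\<And>i j. A $ j $ i = cnj (A $ i $ j)"
  shows "Im (det A) = 0"
proof -
  have "transpose A = cnj_matrix A"
    by (simp add: vec_eq_iff transpose_def cnj_matrix_def) (use assms in metis)
  then have "cnj (det A) = det A" by (metis det_cnj_matrix det_transpose)
  then show ?thesis by (simp add: complex_eq_iff)
qed

text \<open>Supplies the path to the identity matrix along which the sign of the determinant is
  followed.\<close>

lemma positive_hermitian_segment:
  fixes A :: "complex ^ 'n ^ 'n"
  assumes "positive_hermitian A" "0 \<le> s" "s \<le> 1"
  shows "positive_hermitian (\<chi> i j. complex_of_real (1 - s) * (if i = j then 1 else 0) + of_real s * A $ i $ j)" (is "positive_hermitian ?B")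
  unfolding positive_hermitian_def
proof (intro conjI allI impI)
  fix v :: "complex ^ 'n" assume v: "v \<noteq> 0"
  let ?q = "\<Sum>i\<in>UNIV. \<Sum>j\<in>UNIV. A $ i $ j * v $ i * cnj (v $ j)"
  have "(\<Sum>i\<in>UNIV. \<Sum>j\<in>UNIV. ?B $ i $ j * v $ i * cnj (v $ j))
    = of_real (1 - s) * (\<Sum>i\<in>UNIV. \<Sum>j\<in>UNIV. (if i = j then 1 else 0) * v $ i * cnj (v $ j)) + of_real s * ?q"
    by (simp add: distrib_right sum.distrib sum_distrib_left mult.assoc)
  also have "(\<Sum>i\<in>UNIV. \<Sum>j\<in>UNIV. (if i = j then 1 else 0) * v $ i * cnj (v $ j)) = (\<Sum>i\<in>UNIV. v $ i * cnj (v $ i))"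
    by (simp add: if_distrib if_distribR cong: if_cong)
  also have "\<dots> = of_real (\<Sum>i\<in>UNIV. (cmod (v $ i))\<^sup>2)"
    by (simp add: complex_norm_square del: of_real_power)
  finally have eq: "Re (\<Sum>i\<in>UNIV. \<Sum>j\<in>UNIV. ?B $ i $ j * v $ i * cnj (v $ j))
    = (1 - s) * (\<Sum>i\<in>UNIV. (cmod (v $ i))\<^sup>2) + s * Re ?q" by simp
  have v_pos: "0 < (\<Sum>i\<in>UNIV. (cmod (v $ i))\<^sup>2)"
  proof -
    obtain i where "v $ i \<noteq> 0" using v by (auto simp: vec_eq_iff)
    then show ?thesis by (intro sum_pos2[of _ i]) simp_all
  qed
  have q_pos: "0 < Re ?q" using assms(1) v unfolding positive_hermitian_def by blast
  have convex: "0 < (1 - s) * a + s * b" if "0 < a" "0 < b" for a b :: real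
    using assms(2,3) that by (cases "s = 0") (simp_all add: add_nonneg_pos)
  show "0 < Re (\<Sum>i\<in>UNIV. \<Sum>j\<in>UNIV. ?B $ i $ j * v $ i * cnj (v $ j))"
    unfolding eq by (rule convex[OF v_pos q_pos])
next
  fix i j
  have "A $ j $ i = cnj (A $ i $ j)" using assms(1) unfolding positive_hermitian_def by blast
  then show "?B $ j $ i
    = cnj (?B $ i $ j)"
    by simp
qed

text \<open>The determinant is real and nonzero along the segment from the identity to
  \<open>A\<close> and equals \<open>1\<close> at its start, so the intermediate value theorem
  excludes a change of sign.\<close>

lemma positive_hermitian_det:
  fixes A :: "complex ^ 'n ^ 'n"
  assumes "positive_hermitian A"
  shows "Im (det A) = 0" "0 < Re (det A)"
proof -
  show im: "Im (det A) = 0"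
    using assms unfolding positive_hermitian_def by (intro hermitian_det_real) blast
  define B where "B = (\<lambda>s. \<chi> i j. complex_of_real (1 - s) * (if i = j then 1 else 0) + of_real s * A $ i $ j)"
  have B: "positive_hermitian (B s)" if "0 \<le> s" "s \<le> 1" for s
    using positive_hermitian_segment[OF assms that] by (simp add: B_def)
  have ne: "Re (det (B s)) \<noteq> 0" if "0 \<le> s" "s \<le> 1" for s
  proof -
    have "Im (det (B s)) = 0"
      using B[OF that] unfolding positive_hermitian_def by (intro hermitian_det_real) blast
    then show ?thesis using positive_hermitian_det_nz[OF B[OF that]] by (simp add: complex_eq_iff)
  qed
  have "B 0 = mat 1" "B 1 = A" by (simp_all add: B_def vec_eq_iff mat_def)
  then have B01: "Re (det (B 0)) = 1" "Re (det (B 1)) = Re (det A)" by simp_all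
  have cont: "continuous_on {0..1} (\<lambda>s. Re (det (B s)))"
    unfolding det_def B_def by (auto intro!: continuous_intros)
  show "0 < Re (det A)"
  proof (rule ccontr)
    assume "\<not> 0 < Re (det A)"
    then obtain s where "0 \<le> s" "s \<le> 1" "Re (det (B s)) = 0"
      using IVT2'[of "\<lambda>s. Re (det (B s))" 1 0 0] cont B01 by auto
    then show False using ne by blast
  qed
qed

text \<open>For a fixed row permutation \<open>s\<close>, substituting
  \<open>u = t \<circ> inv s\<close> turns the inner sum into the determinant. There are as many
  such \<open>s\<close> as the factorial says, and this factor cancels in
  \<open>volume_ratio\<close>.\<close>

lemma top_power_eq: "top_power A = fact CARD('n) * det A" for A :: "complex ^ 'n ^ 'n::finite"
proof -
  let ?P = "{p. p permutes (UNIV :: 'n set)}"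
  have "(\<Sum>t\<in>?P. of_int (sign s) * of_int (sign t) * (\<Prod>k\<in>UNIV. A $ s k $ t k)) = det A" if s: "s permutes UNIV" for s
  proof -
    have "(\<Sum>t\<in>?P. of_int (sign s) * of_int (sign t) * (\<Prod>k\<in>UNIV. A $ s k $ t k)) =
      (\<Sum>u\<in>?P. of_int (sign u) * (\<Prod>k\<in>UNIV. A $ k $ u k))"
    proof (rule sum.reindex_bij_witness[where i = "\<lambda>u. u \<circ> s" and j = "\<lambda>t. t \<circ> inv s"])
      fix t assume "t \<in> ?P"
      then have t: "t permutes UNIV" by simp
      show "t \<circ> inv s \<circ> s = t" using permutes_inv_o(2)[OF s] by (simp add: o_assoc[symmetric])
      show "t \<circ> inv s \<in> ?P" using permutes_compose[OF permutes_inv[OF s] t] by simp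
      have "sign (t \<circ> inv s) = sign s * sign t"
        using s t by (simp add: sign_compose permutes_imp_permutation[of UNIV] permutes_inv sign_inverse)
      moreover have "(\<Prod>k\<in>UNIV. A $ k $ (t \<circ> inv s) k) = (\<Prod>k\<in>UNIV. A $ s k $ t k)"
        by (subst prod.permute[OF s]) (simp add: permutes_inverses(2)[OF s])
      ultimately show "of_int (sign (t \<circ> inv s)) * (\<Prod>k\<in>UNIV. A $ k $ (t \<circ> inv s) k) =
         of_int (sign s) * of_int (sign t) * (\<Prod>k\<in>UNIV. A $ s k $ t k)"
        by simp
    next
      fix u assume "u \<in> ?P"
      then have u: "u permutes UNIV" by simp
      show "u \<circ> s \<circ> inv s = u" using permutes_inv_o(1)[OF s] by (simp add: o_assoc[symmetric])
      show "u \<circ> s \<in> ?P" using permutes_compose[OF s u] by simp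
    qed
    then show ?thesis by (simp add: det_def)
  qed
  then have "top_power A = (\<Sum>s\<in>?P. det A)" unfolding top_power_def by (intro sum.cong) auto
  then show ?thesis by (simp add: card_permutations[OF refl])
qed

section \<open>Wirtinger derivatives\<close>

lemma has_derivative_cong_open:
  assumes "open S" "z \<in> S" "\<And>x. x \<in> S \<Longrightarrow> f x = g x"
  shows "(f has_derivative D) (at z) \<longleftrightarrow> (g has_derivative D) (at z)"
  using assms has_derivative_transform_within_open[of f D z UNIV S g]
    has_derivative_transform_within_open[of g D z UNIV S f] by auto

text \<open>Differentiability is not at issue: \<open>frechet_derivative\<close> is a choice from a
  predicate, and that predicate is the same for functions agreeing near the point.\<close>

lemma frechet_derivative_cong_open:
  assumes "open S" "z \<in> S" "\<And>x. x \<in> S \<Longrightarrow> f x = g x"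
  shows "frechet_derivative f (at z) = frechet_derivative g (at z)"
  by (simp add: frechet_derivative_def has_derivative_cong_open[OF assms])

text \<open>With \<open>wdb\<close> below, the operators of a chart transported to coordinate space,
  where the calculus is carried out; \<open>dz_eq\<close> and \<open>dzbar_eq\<close> lead back to
  the manifold.\<close>

definition wd :: "'n \<Rightarrow> (complex ^ 'n::finite \<Rightarrow> complex) \<Rightarrow> complex ^ 'n \<Rightarrow> complex" where
  "wd j f z = (frechet_derivative f (at z) (axis j 1) - \<i> * frechet_derivative f (at z) (axis j \<i>)) / 2"

definition wdb :: "'n \<Rightarrow> (complex ^ 'n::finite \<Rightarrow> complex) \<Rightarrow> complex ^ 'n \<Rightarrow> complex" where
  "wdb j f z = (frechet_derivative f (at z) (axis j 1) + \<i> * frechet_derivative f (at z) (axis j \<i>)) / 2"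

lemma wd_cong:
  assumes "open S" "z \<in> S" "\<And>x. x \<in> S \<Longrightarrow> f x = g x"
  shows "wd j f z = wd j g z" "wdb j f z = wdb j g z"
  by (simp_all add: wd_def wdb_def frechet_derivative_cong_open[of S z f g, OF assms])

lemma wd_has_derivative:
  assumes "(f has_derivative D) (at z)"
  shows "wd j f z = (D (axis j 1) - \<i> * D (axis j \<i>)) / 2"
    "wdb j f z = (D (axis j 1) + \<i> * D (axis j \<i>)) / 2"
  unfolding wd_def wdb_def frechet_derivative_at[OF assms, symmetric] by (rule refl)+

lemma differentiable_has_derivative:
  "f differentiable (at z) \<Longrightarrow> (f has_derivative frechet_derivative f (at z)) (at z)"
  by (simp add: frechet_derivative_works)

lemma wd_const: "wd j (\<lambda>z. c) z = 0" "wdb j (\<lambda>z. c) z = 0"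
  by (simp_all add: wd_has_derivative[OF has_derivative_const])

lemma wd_add:
  assumes "f differentiable (at z)" "g differentiable (at z)"
  shows "wd j (\<lambda>z. f z + g z) z = wd j f z + wd j g z"
    "wdb j (\<lambda>z. f z + g z) z = wdb j f z + wdb j g z"
  unfolding wd_has_derivative[OF has_derivative_add[OF assms[THEN differentiable_has_derivative]]]
  by (simp_all add: wd_def wdb_def field_simps)

lemma wd_mult:
  assumes "f differentiable (at z)" "g differentiable (at z)"
  shows "wd j (\<lambda>z. f z * g z) z = wd j f z * g z + f z * wd j g z"
    "wdb j (\<lambda>z. f z * g z) z = wdb j f z * g z + f z * wdb j g z"
  unfolding wd_has_derivative[OF has_derivative_mult[OF assms[THEN differentiable_has_derivative]]]
  by (simp_all add: wd_def wdb_def field_simps)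

lemma wd_cmult:
  assumes "f differentiable (at z)"
  shows "wd j (\<lambda>z. c * f z) z = c * wd j f z" "wdb j (\<lambda>z. c * f z) z = c * wdb j f z"
  using wd_mult[OF differentiable_const assms, of j c] by (simp_all add: wd_const)

lemma wd_sum:
  assumes "\<And>k. k \<in> A \<Longrightarrow> f k differentiable (at z)"
  shows "wd j (\<lambda>z. \<Sum>k\<in>A. f k z) z = (\<Sum>k\<in>A. wd j (f k) z)"
    "wdb j (\<lambda>z. \<Sum>k\<in>A. f k z) z = (\<Sum>k\<in>A. wdb j (f k) z)"
proof -
  have d: "((\<lambda>z. \<Sum>k\<in>A. f k z) has_derivative (\<lambda>v. \<Sum>k\<in>A. frechet_derivative (f k) (at z) v)) (at z)"
    by (intro has_derivative_sum differentiable_has_derivative assms)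
  show "wd j (\<lambda>z. \<Sum>k\<in>A. f k z) z = (\<Sum>k\<in>A. wd j (f k) z)"
    "wdb j (\<lambda>z. \<Sum>k\<in>A. f k z) z = (\<Sum>k\<in>A. wdb j (f k) z)"
    unfolding wd_has_derivative[OF d]
    by (simp_all add: wd_def wdb_def sum_divide_distrib[symmetric] sum_subtractf sum.distrib sum_distrib_left)
qed

lemma wd_cnj:
  assumes "f differentiable (at z)"
  shows "wd j (\<lambda>z. cnj (f z)) z = cnj (wdb j f z)" "wdb j (\<lambda>z. cnj (f z)) z = cnj (wd j f z)"
  unfolding wd_has_derivative[OF bounded_linear.has_derivative[OF bounded_linear_cnj
        assms[THEN differentiable_has_derivative]]]
  by (simp_all add: wd_def wdb_def)

lemma wd_of_real:
  assumes "f differentiable (at z)"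
  shows "wdb j (\<lambda>z. complex_of_real (f z)) z = cnj (wd j (\<lambda>z. complex_of_real (f z)) z)"
proof -
  have "(\<lambda>z. complex_of_real (f z)) differentiable (at z)"
    using bounded_linear.has_derivative[OF bounded_linear_of_real assms[THEN differentiable_has_derivative]]
    by (rule differentiableI)
  from wd_cnj(2)[OF this, of j] show ?thesis by simp
qed

lemma wd_inverse:
  assumes "f differentiable (at z)" "f z \<noteq> 0"
  shows "wd j (\<lambda>z. inverse (f z)) z = - wd j f z / (f z)\<^sup>2" "wdb j (\<lambda>z. inverse (f z)) z = - wdb j f z / (f z)\<^sup>2"
proof -
  have "((\<lambda>z. inverse (f z)) has_derivative (\<lambda>h. - (inverse (f z) * frechet_derivative f (at z) h * inverse (f z)))) (at z)"
    by (intro Deriv.has_derivative_inverse assms differentiable_has_derivative)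
  from wd_has_derivative[OF this, of j]
  show "wd j (\<lambda>z. inverse (f z)) z = - wd j f z / (f z)\<^sup>2" "wdb j (\<lambda>z. inverse (f z)) z = - wdb j f z / (f z)\<^sup>2"
    using assms(2) by (simp_all add: wd_def wdb_def field_simps power2_eq_square)
qed

lemma wd_real_compose:
  assumes f: "f differentiable (at z)" and r: "(\<rho> has_real_derivative r) (at (f z))"
  shows "wd j (\<lambda>z. complex_of_real (\<rho> (f z))) z = of_real r * wd j (\<lambda>z. complex_of_real (f z)) z"
    "wdb j (\<lambda>z. complex_of_real (\<rho> (f z))) z = of_real r * wdb j (\<lambda>z. complex_of_real (f z)) z"
proof -
  let ?D = "frechet_derivative f (at z)"
  note D = differentiable_has_derivative[OF f]
  have d1: "((\<lambda>z. complex_of_real (f z)) has_derivative (\<lambda>v. complex_of_real (?D v))) (at z)"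
    by (rule bounded_linear.has_derivative[OF bounded_linear_of_real D])
  have "((\<lambda>z. \<rho> (f z)) has_derivative (\<lambda>v. r * ?D v)) (at z)"
    using has_derivative_compose[OF D r[unfolded has_field_derivative_def]] .
  then have d2: "((\<lambda>z. complex_of_real (\<rho> (f z))) has_derivative (\<lambda>v. complex_of_real (r * ?D v))) (at z)"
    by (rule bounded_linear.has_derivative[OF bounded_linear_of_real])
  show "wd j (\<lambda>z. complex_of_real (\<rho> (f z))) z = of_real r * wd j (\<lambda>z. complex_of_real (f z)) z"
    "wdb j (\<lambda>z. complex_of_real (\<rho> (f z))) z = of_real r * wdb j (\<lambda>z. complex_of_real (f z)) z"
    unfolding wd_has_derivative[OF d1] wd_has_derivative[OF d2] by (simp_all add: field_simps)
qed

text \<open>A real-linear map splits into a complex-linear and an antilinear part, with the two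
  Wirtinger derivatives as coefficients.\<close>

lemma linear_wd_expansion:
  fixes D :: "complex ^ 'n::finite \<Rightarrow> complex"
  assumes "linear D"
  shows "D v = (\<Sum>l\<in>UNIV. (D (axis l 1) - \<i> * D (axis l \<i>)) / 2 * v $ l +
    (D (axis l 1) + \<i> * D (axis l \<i>)) / 2 * cnj (v $ l))"
proof -
  interpret linear D by fact
  have "v = (\<Sum>l\<in>UNIV. Re (v $ l) *\<^sub>R axis l 1 + Im (v $ l) *\<^sub>R axis l \<i>)"
    by (simp add: vec_eq_iff axis_def complex_eq_iff if_distrib sum.distrib cong: if_cong)
  then have "D v = D (\<Sum>l\<in>UNIV. Re (v $ l) *\<^sub>R axis l 1 + Im (v $ l) *\<^sub>R axis l \<i>)"
    by (rule arg_cong)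
  also have "\<dots> = (\<Sum>l\<in>UNIV. Re (v $ l) *\<^sub>R D (axis l 1) + Im (v $ l) *\<^sub>R D (axis l \<i>))"
    by (simp add: sum add scale)
  also have "\<dots> = (\<Sum>l\<in>UNIV. (D (axis l 1) - \<i> * D (axis l \<i>)) / 2 * v $ l +
    (D (axis l 1) + \<i> * D (axis l \<i>)) / 2 * cnj (v $ l))"
  proof (rule sum.cong[OF refl])
    fix l
    show "Re (v $ l) *\<^sub>R D (axis l 1) + Im (v $ l) *\<^sub>R D (axis l \<i>) = (D (axis l 1) - \<i> * D (axis l \<i>)) / 2 * v $ l +
      (D (axis l 1) + \<i> * D (axis l \<i>)) / 2 * cnj (v $ l)"
      by (auto simp: complex_eq_iff field_simps)
  qed
  finally show ?thesis .
qed

lemma frechet_derivative_vec_nth: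
  fixes F :: "'v::real_normed_vector \<Rightarrow> complex ^ 'n::finite"
  assumes "F differentiable (at z)"
  shows "frechet_derivative (\<lambda>z. F z $ l) (at z) v = frechet_derivative F (at z) v $ l"
    and "(\<lambda>z. F z $ l) differentiable (at z)"
proof -
  have "((\<lambda>z. F z $ l) has_derivative (\<lambda>v. frechet_derivative F (at z) v $ l)) (at z)"
    by (rule bounded_linear.has_derivative[OF bounded_linear_vec_nth differentiable_has_derivative[OF assms]])
  then show "frechet_derivative (\<lambda>z. F z $ l) (at z) v = frechet_derivative F (at z) v $ l"
    and "(\<lambda>z. F z $ l) differentiable (at z)"
    using frechet_derivative_at by (metis, metis differentiableI)
qed

text \<open>The antilinear part of the outer derivative meets the conjugate of \<open>F\<close>, and
  the derivative of a conjugate is the conjugate of the opposite Wirtinger derivative. For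
  holomorphic \<open>F\<close> half of the terms vanish.\<close>

lemma wd_compose:
  fixes F :: "complex ^ 'k::finite \<Rightarrow> complex ^ 'n::finite"
  assumes F: "F differentiable (at z)" and v: "v differentiable (at (F z))"
  shows "wd i (\<lambda>z. v (F z)) z = (\<Sum>l\<in>UNIV. wd l v (F z) * wd i (\<lambda>z. F z $ l) z +
      wdb l v (F z) * cnj (wdb i (\<lambda>z. F z $ l) z))"
    "wdb i (\<lambda>z. v (F z)) z = (\<Sum>l\<in>UNIV. wd l v (F z) * wdb i (\<lambda>z. F z $ l) z +
      wdb l v (F z) * cnj (wd i (\<lambda>z. F z $ l) z))"
proof -
  let ?F = "frechet_derivative F (at z)" and ?v = "frechet_derivative v (at (F z))"
  have e: "?v w = (\<Sum>l\<in>UNIV. wd l v (F z) * w $ l + wdb l v (F z) * cnj (w $ l))" for w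
    unfolding wd_def wdb_def by (rule linear_wd_expansion) (rule linear_frechet_derivative[OF v])
  have d: "((\<lambda>z. v (F z)) has_derivative (\<lambda>w. ?v (?F w))) (at z)"
    by (rule has_derivative_compose[OF F[THEN differentiable_has_derivative] v[THEN differentiable_has_derivative]])
  show "wd i (\<lambda>z. v (F z)) z = (\<Sum>l\<in>UNIV. wd l v (F z) * wd i (\<lambda>z. F z $ l) z +
      wdb l v (F z) * cnj (wdb i (\<lambda>z. F z $ l) z))"
    "wdb i (\<lambda>z. v (F z)) z = (\<Sum>l\<in>UNIV. wd l v (F z) * wdb i (\<lambda>z. F z $ l) z +
      wdb l v (F z) * cnj (wd i (\<lambda>z. F z $ l) z))"
    unfolding wd_has_derivative[OF d] e wd_def[of i] wdb_def[of i] frechet_derivative_vec_nth(1)[OF F]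
    by (simp_all add: sum_distrib_left sum_divide_distrib sum.distrib[symmetric] sum_subtractf[symmetric])
       (auto intro!: sum.cong simp: field_simps)
qed

lemma smooth_on_wd:
  assumes "open S" "smooth_on f S"
  shows "smooth_on (wd j f) S" "smooth_on (wdb j f) S"
proof -
  note fd = smooth_on_frechet_derivative[OF assms(2)]
  have "smooth_on (\<lambda>z. (1/2) * (frechet_derivative f (at z) (axis j 1) - \<i> * frechet_derivative f (at z) (axis j \<i>))) S"
    by (intro smooth_on_mult smooth_on_diff smooth_on_const fd assms(1))
  then show "smooth_on (wd j f) S" by (rule smooth_on_cong[rotated 2]) (simp_all add: wd_def assms)
  have "smooth_on (\<lambda>z. (1/2) * (frechet_derivative f (at z) (axis j 1) + \<i> * frechet_derivative f (at z) (axis j \<i>))) S"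
    by (intro smooth_on_mult smooth_on_add smooth_on_const fd assms(1))
  then show "smooth_on (wdb j f) S" by (rule smooth_on_cong[rotated 2]) (simp_all add: wdb_def assms)
qed

text \<open>Both sides combine the same four real second derivatives. The main use is to bring
  \<open>wdb\<close> next to a holomorphic function, which it kills.\<close>

lemma wd_wdb_commute:
  assumes S: "open S" "z \<in> S" and f: "smooth_on f S"
  shows "wd i (wdb j f) z = wdb j (wd i f) z"
proof -
  let ?d = "\<lambda>v w. frechet_derivative (\<lambda>y. frechet_derivative f (at y) v) (at z) w"
  have fd: "((\<lambda>y. frechet_derivative f (at y) v) has_derivative ?d v) (at z)" for v
    by (intro differentiable_has_derivative smooth_on_differentiable[OF smooth_on_frechet_derivative[OF f] S(2)])
  have 1: "(wd i f has_derivative (\<lambda>w. (?d (axis i 1) w - \<i> * ?d (axis i \<i>) w) / 2)) (at z)"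
    unfolding wd_def by (intro bounded_linear.has_derivative[OF bounded_linear_divide] has_derivative_diff has_derivative_mult_right fd)
  have 2: "(wdb j f has_derivative (\<lambda>w. (?d (axis j 1) w + \<i> * ?d (axis j \<i>) w) / 2)) (at z)"
    unfolding wdb_def by (intro bounded_linear.has_derivative[OF bounded_linear_divide] has_derivative_add has_derivative_mult_right fd)
  note sym = second_derivative_symmetric[OF S f]
  show ?thesis
    unfolding wd_has_derivative[OF 1] wd_has_derivative[OF 2]
      sym[of "axis j 1" "axis i 1"] sym[of "axis j 1" "axis i \<i>"]
      sym[of "axis j \<i>" "axis i 1"] sym[of "axis j \<i>" "axis i \<i>"]
    by (simp add: field_simps)
qed

text \<open>The rule \<open>\<partial>\<partial>bar f(t) = f'' \<partial>t \<partial>bar t + f'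
  \<partial>\<partial>bar t\<close>. It is stated through a known \<open>f'\<close> because for the
  potential that derivative is the moment function.\<close>

lemma wd_wdb_real_compose:
  assumes Y: "open Y" "y \<in> Y" and U: "open U" "t ` Y \<subseteq> U" and t: "smooth_on t Y"
    and f: "\<And>s. s \<in> U \<Longrightarrow> (f has_real_derivative f' s) (at s)" "smooth_on f' U" "(f' has_real_derivative f'') (at (t y))"
  shows "wd i (wdb j (\<lambda>x. complex_of_real (f (t x)))) y =
    of_real f'' * wd i (\<lambda>x. complex_of_real (t x)) y * cnj (wd j (\<lambda>x. complex_of_real (t x)) y)
    + of_real (f' (t y)) * wd i (wdb j (\<lambda>x. complex_of_real (t x))) y"
proof -
  let ?ct = "\<lambda>x. complex_of_real (t x)"
  note td = smooth_on_differentiable[OF t]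
  have ct: "smooth_on (wdb j ?ct) Y"
    by (rule smooth_on_wd(2)[OF Y(1) smooth_on_bounded_linear_compose[OF bounded_linear_of_real Y(1) t]])
  have f't: "smooth_on (\<lambda>x. complex_of_real (f' (t x))) Y"
    by (rule smooth_on_bounded_linear_compose[OF bounded_linear_of_real Y(1) smooth_on_compose[OF Y(1) U t f(2)]])
  have "wd i (wdb j (\<lambda>x. complex_of_real (f (t x)))) y = wd i (\<lambda>x. complex_of_real (f' (t x)) * wdb j ?ct x) y"
    by (rule wd_cong(1)[OF Y]) (use U(2) in \<open>auto intro!: wd_real_compose(2) td f(1)\<close>)
  also have "\<dots> = wd i (\<lambda>x. complex_of_real (f' (t x))) y * wdb j ?ct y + complex_of_real (f' (t y)) * wd i (wdb j ?ct) y"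
    by (rule wd_mult(1)[OF smooth_on_differentiable[OF f't Y(2)] smooth_on_differentiable[OF ct Y(2)]])
  also have "wd i (\<lambda>x. complex_of_real (f' (t x))) y = of_real f'' * wd i ?ct y"
    by (rule wd_real_compose(1)[OF td[OF Y(2)] f(3)])
  also have "wdb j ?ct y = cnj (wd j ?ct y)"
    by (rule wd_of_real[OF td[OF Y(2)]])
  finally show ?thesis .
qed

text \<open>The conjugate of a derivative of a holomorphic map is antiholomorphic, so the outer
  \<open>wd\<close> reaches only \<open>v\<close>; no second derivatives of \<open>F\<close>
  remain.\<close>

lemma wd_wdb_compose_holomorphic:
  fixes F :: "complex ^ 'k::finite \<Rightarrow> complex ^ 'n::finite"
  assumes S: "open S" "z \<in> S" and U: "open U" "F ` S \<subseteq> U"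
    and F: "\<And>l. smooth_on (\<lambda>z. F z $ l) S" "\<And>l i z. z \<in> S \<Longrightarrow> wdb i (\<lambda>z. F z $ l) z = 0"
    and v: "smooth_on v U"
  shows "wd i (wdb j (\<lambda>z. v (F z))) z =
    (\<Sum>k\<in>UNIV. \<Sum>l\<in>UNIV. wd k (wdb l v) (F z) * wd i (\<lambda>z. F z $ k) z * cnj (wd j (\<lambda>z. F z $ l) z))"
proof -
  have Fs: "smooth_on F S" by (rule smooth_on_vec[OF S(1) F(1)])
  have 1: "wdb j (\<lambda>z. v (F z)) x = (\<Sum>l\<in>UNIV. wdb l v (F x) * cnj (wd j (\<lambda>z. F z $ l) x))" if "x \<in> S" for x
  proof (subst wd_compose(2))
    show "F differentiable (at x)" using smooth_on_differentiable[OF Fs that] .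
    show "v differentiable (at (F x))" using smooth_on_differentiable[OF v] U that by auto
  qed (simp add: F(2)[OF that])
  have vF: "smooth_on (\<lambda>z. wdb l v (F z)) S" for l
    by (rule smooth_on_compose[OF S(1) U Fs smooth_on_wd(2)[OF U(1) v]])
  have dF: "smooth_on (wd j (\<lambda>z. F z $ l)) S" for l
    by (rule smooth_on_wd(1)[OF S(1) F(1)])
  have cF: "smooth_on (\<lambda>x. cnj (wd j (\<lambda>z. F z $ l) x)) S" for l
    by (rule smooth_on_bounded_linear_compose[OF bounded_linear_cnj S(1) dF])
  have 2: "wd i (\<lambda>x. cnj (wd j (\<lambda>z. F z $ l) x)) z = 0" for l
  proof -
    have "wd i (\<lambda>x. cnj (wd j (\<lambda>z. F z $ l) x)) z = cnj (wdb i (wd j (\<lambda>z. F z $ l)) z)"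
      by (rule wd_cnj(1)[OF smooth_on_differentiable[OF dF S(2)]])
    also have "wdb i (wd j (\<lambda>z. F z $ l)) z = wd j (wdb i (\<lambda>z. F z $ l)) z"
      by (rule wd_wdb_commute[OF S F(1), symmetric])
    also have "\<dots> = wd j (\<lambda>z. 0) z"
      by (rule wd_cong(1)[OF S]) (rule F(2))
    finally show ?thesis by (simp add: wd_const)
  qed
  have 3: "wd i (\<lambda>z. wdb l v (F z)) z = (\<Sum>k\<in>UNIV. wd k (wdb l v) (F z) * wd i (\<lambda>z. F z $ k) z)" for l
  proof (subst wd_compose(1))
    show "F differentiable (at z)" using smooth_on_differentiable[OF Fs S(2)] .
    show "wdb l v differentiable (at (F z))"
      using smooth_on_differentiable[OF smooth_on_wd(2)[OF U(1) v]] U S by auto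
  qed (simp add: F(2)[OF S(2)])
  have "wd i (wdb j (\<lambda>z. v (F z))) z = wd i (\<lambda>x. \<Sum>l\<in>UNIV. wdb l v (F x) * cnj (wd j (\<lambda>z. F z $ l) x)) z"
    by (rule wd_cong(1)[OF S 1])
  also have "\<dots> = (\<Sum>l\<in>UNIV. wd i (\<lambda>x. wdb l v (F x) * cnj (wd j (\<lambda>z. F z $ l) x)) z)"
    by (rule wd_sum(1)) (intro smooth_on_differentiable[OF smooth_on_mult[OF S(1) vF cF] S(2)])
  also have "\<dots> = (\<Sum>l\<in>UNIV. (\<Sum>k\<in>UNIV. wd k (wdb l v) (F z) * wd i (\<lambda>z. F z $ k) z) * cnj (wd j (\<lambda>z. F z $ l) z))"
    by (simp add: wd_mult(1)[OF smooth_on_differentiable[OF vF S(2)] smooth_on_differentiable[OF cF S(2)]] 2 3)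
  also have "\<dots> = (\<Sum>k\<in>UNIV. \<Sum>l\<in>UNIV. wd k (wdb l v) (F z) * wd i (\<lambda>z. F z $ k) z * cnj (wd j (\<lambda>z. F z $ l) z))"
    by (subst sum.swap) (simp add: sum_distrib_right)
  finally show ?thesis .
qed

text \<open>Writing the squared modulus as \<open>k * cnj k\<close> makes a branch of the complex
  logarithm unnecessary.\<close>

lemma wd_ln_cmod_sq:
  assumes k: "k differentiable (at z)" "k z \<noteq> 0" "wdb j k z = 0"
  shows "wd j (\<lambda>z. complex_of_real (ln ((cmod (k z))\<^sup>2))) z = wd j k z / k z"
    "wdb j (\<lambda>z. complex_of_real (ln ((cmod (k z))\<^sup>2))) z = cnj (wd j k z / k z)"
proof -
  have sq: "complex_of_real ((cmod (k z))\<^sup>2) = k z * cnj (k z)" for z by (rule complex_norm_square)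
  have ck: "(\<lambda>z. cnj (k z)) differentiable (at z)"
    using bounded_linear.has_derivative[OF bounded_linear_cnj differentiable_has_derivative[OF k(1)]]
    by (rule differentiableI)
  have "(\<lambda>z. Re (k z * cnj (k z))) differentiable (at z)"
    using bounded_linear.has_derivative[OF bounded_linear_Re differentiable_has_derivative[OF differentiable_mult[OF k(1) ck]]]
    by (rule differentiableI)
  then have d: "(\<lambda>z. (cmod (k z))\<^sup>2) differentiable (at z)" by (simp only: sq[symmetric] Re_complex_of_real)
  have l: "(ln has_real_derivative inverse ((cmod (k z))\<^sup>2)) (at ((cmod (k z))\<^sup>2))"
    using k(2) by (intro DERIV_ln) simp
  show "wd j (\<lambda>z. complex_of_real (ln ((cmod (k z))\<^sup>2))) z = wd j k z / k z"
    using k by (simp only: wd_real_compose(1)[OF d l] of_real_inverse sq wd_mult(1)[OF k(1) ck] wd_cnj(1)[OF k(1)])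
      (simp add: field_simps)
  show "wdb j (\<lambda>z. complex_of_real (ln ((cmod (k z))\<^sup>2))) z = cnj (wd j k z / k z)"
    using k by (simp only: wd_real_compose(2)[OF d l] of_real_inverse sq wd_mult(2)[OF k(1) ck] wd_cnj(2)[OF k(1)])
      (simp add: field_simps)
qed

text \<open>The inner derivative is the conjugate of the holomorphic function
  \<open>wd j k / k\<close>, which \<open>wd i\<close> annihilates.\<close>

lemma wd_wdb_ln_cmod_sq:
  assumes S: "open S" "z \<in> S" and k: "smooth_on k S" "\<And>x j. x \<in> S \<Longrightarrow> wdb j k x = 0" "\<And>x. x \<in> S \<Longrightarrow> k x \<noteq> 0"
  shows "wd i (wdb j (\<lambda>z. complex_of_real (ln ((cmod (k z))\<^sup>2)))) z = 0"
proof -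
  let ?q = "\<lambda>x. wd j k x * inverse (k x)"
  have dk: "smooth_on (wd j k) S" by (rule smooth_on_wd(1)[OF S(1) k(1)])
  have ik: "smooth_on (\<lambda>x. inverse (k x)) S" by (rule smooth_on_inverse[OF S(1) k(1) k(3)])
  have "wd i (wdb j (\<lambda>z. complex_of_real (ln ((cmod (k z))\<^sup>2)))) z = wd i (\<lambda>x. cnj (?q x)) z"
    by (rule wd_cong(1)[OF S], subst wd_ln_cmod_sq(2)[OF smooth_on_differentiable[OF k(1)] k(3) k(2)])
       (simp_all add: divide_inverse)
  also have "\<dots> = cnj (wdb i ?q z)"
    by (rule wd_cnj(1)[OF smooth_on_differentiable[OF smooth_on_mult[OF S(1) dk ik] S(2)]])
  also have "wdb i ?q z = wdb i (wd j k) z * inverse (k z) + wd j k z * wdb i (\<lambda>x. inverse (k x)) z"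
    by (rule wd_mult(2)[OF smooth_on_differentiable[OF dk S(2)] smooth_on_differentiable[OF ik S(2)]])
  also have "wdb i (wd j k) z = wd j (wdb i k) z" by (rule wd_wdb_commute[OF S k(1), symmetric])
  also have "\<dots> = wd j (\<lambda>x. 0) z" by (rule wd_cong(1)[OF S]) (rule k(2))
  finally show ?thesis
    by (simp add: wd_const wd_inverse(2)[OF smooth_on_differentiable[OF k(1) S(2)] k(3)[OF S(2)]] k(2)[OF S(2)])
qed

section \<open>Functions of a fibre logarithm and a base point\<close>

text \<open>Components of a covector pulled back from the base: there is none in the fibre direction
  \<open>None\<close>.\<close>

definition on_some :: "'m option \<Rightarrow> ('m \<Rightarrow> complex) \<Rightarrow> complex" where
  "on_some i f = (case i of None \<Rightarrow> 0 | Some a \<Rightarrow> f a)"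

lemma on_some_simps [simp]: "on_some None f = 0" "on_some (Some a) f = f a"
  by (simp_all add: on_some_def)

definition base_coord :: "complex ^ 'm::finite option \<Rightarrow> complex ^ 'm" where
  "base_coord y = (\<chi> a. y $ Some a)"

lemma base_coord_nth [simp]: "base_coord y $ a = y $ Some a"
  by (simp add: base_coord_def)

lemma bounded_linear_base_coord: "bounded_linear base_coord"
  by (auto intro!: linear_conv_bounded_linear[THEN iffD1] linearI simp: vec_eq_iff)

lemma base_coord_axis: "base_coord (axis i c) = (case i of None \<Rightarrow> 0 | Some a \<Rightarrow> axis a c)"
  by (auto simp: vec_eq_iff axis_def split: option.splits)

text \<open>These partial derivatives are read off from the joint derivative on the product, so that
  they inherit smoothness from \<open>K\<close>.\<close>

definition deriv_fst :: "(real \<times> (complex ^ 'm::finite) \<Rightarrow> complex) \<Rightarrow> real \<times> (complex ^ 'm) \<Rightarrow> complex" where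
  "deriv_fst K p = frechet_derivative K (at p) (1, 0)"

definition wd_snd :: "'m \<Rightarrow> (real \<times> (complex ^ 'm::finite) \<Rightarrow> complex) \<Rightarrow> real \<times> (complex ^ 'm) \<Rightarrow> complex" where
  "wd_snd a K p = (frechet_derivative K (at p) (0, axis a 1) - \<i> * frechet_derivative K (at p) (0, axis a \<i>)) / 2"

definition wdb_snd :: "'m \<Rightarrow> (real \<times> (complex ^ 'm::finite) \<Rightarrow> complex) \<Rightarrow> real \<times> (complex ^ 'm) \<Rightarrow> complex" where
  "wdb_snd a K p = (frechet_derivative K (at p) (0, axis a 1) + \<i> * frechet_derivative K (at p) (0, axis a \<i>)) / 2"

lemma smooth_on_partial:
  assumes "open V" "smooth_on K V"
  shows "smooth_on (deriv_fst K) V" "smooth_on (wd_snd a K) V" "smooth_on (wdb_snd a K) V"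
proof -
  note fd = smooth_on_frechet_derivative[OF assms(2)]
  show "smooth_on (deriv_fst K) V"
    by (rule smooth_on_cong[OF assms(1) _ fd[of "(1, 0)"]]) (simp add: deriv_fst_def)
  have "smooth_on (\<lambda>p. (1/2) * (frechet_derivative K (at p) (0, axis a 1) - \<i> * frechet_derivative K (at p) (0, axis a \<i>))) V"
    by (intro smooth_on_mult smooth_on_diff smooth_on_const fd assms(1))
  then show "smooth_on (wd_snd a K) V" by (rule smooth_on_cong[rotated 2]) (simp_all add: wd_snd_def assms)
  have "smooth_on (\<lambda>p. (1/2) * (frechet_derivative K (at p) (0, axis a 1) + \<i> * frechet_derivative K (at p) (0, axis a \<i>))) V"
    by (intro smooth_on_mult smooth_on_add smooth_on_const fd assms(1))
  then show "smooth_on (wdb_snd a K) V" by (rule smooth_on_cong[rotated 2]) (simp_all add: wdb_snd_def assms)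
qed

lemma partial_has_derivative:
  assumes "K differentiable (at (s, z))"
  shows "((\<lambda>s. K (s, z)) has_vector_derivative deriv_fst K (s, z)) (at s)"
    "wd a (\<lambda>z. K (s, z)) z = wd_snd a K (s, z)" "wdb a (\<lambda>z. K (s, z)) z = wdb_snd a K (s, z)"
proof -
  let ?D = "frechet_derivative K (at (s, z))"
  have K: "(K has_derivative ?D) (at (s, z))" by (rule differentiable_has_derivative[OF assms])
  interpret linear ?D using K by (rule has_derivative_linear)
  have "((\<lambda>s. (s, z)) has_derivative (\<lambda>h. (h, 0))) (at s)"
    by (intro has_derivative_Pair has_derivative_ident has_derivative_const)
  from has_derivative_compose[OF this K]
  have "((\<lambda>s. K (s, z)) has_derivative (\<lambda>h. ?D (h, 0))) (at s)" .
  also have "(\<lambda>h. ?D (h, 0)) = (\<lambda>h. h *\<^sub>R deriv_fst K (s, z))"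
  proof
    fix h show "?D (h, 0) = h *\<^sub>R deriv_fst K (s, z)"
      unfolding deriv_fst_def using scale[of h "(1, 0)"] by simp
  qed
  finally show "((\<lambda>s. K (s, z)) has_vector_derivative deriv_fst K (s, z)) (at s)"
    unfolding has_vector_derivative_def .
  have "((\<lambda>z. (s, z)) has_derivative (\<lambda>h. (0, h))) (at z)"
    by (intro has_derivative_Pair has_derivative_ident has_derivative_const)
  from has_derivative_compose[OF this K]
  have "((\<lambda>z. K (s, z)) has_derivative (\<lambda>h. ?D (0, h))) (at z)" .
  from wd_has_derivative[OF this]
  show "wd a (\<lambda>z. K (s, z)) z = wd_snd a K (s, z)" "wdb a (\<lambda>z. K (s, z)) z = wdb_snd a K (s, z)"
    by (simp_all add: wd_snd_def wdb_snd_def)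
qed

text \<open>Since \<open>base_coord\<close> just forgets a coordinate, the base part of the chain
  rule is a Wirtinger derivative with the same index, and it is absent for the index
  \<open>None\<close>.\<close>

lemma wd_fibre_compose:
  fixes K :: "real \<times> (complex ^ 'm::finite) \<Rightarrow> complex"
  assumes t: "t differentiable (at y)" and K: "K differentiable (at (t y, base_coord y))"
  shows "wd i (\<lambda>y. K (t y, base_coord y)) y =
      deriv_fst K (t y, base_coord y) * wd i (\<lambda>y. complex_of_real (t y)) y + on_some i (\<lambda>a. wd_snd a K (t y, base_coord y))"
    "wdb i (\<lambda>y. K (t y, base_coord y)) y =
      deriv_fst K (t y, base_coord y) * wdb i (\<lambda>y. complex_of_real (t y)) y + on_some i (\<lambda>a. wdb_snd a K (t y, base_coord y))"
proof -
  let ?D = "frechet_derivative K (at (t y, base_coord y))" and ?t = "frechet_derivative t (at y)"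
  have K: "(K has_derivative ?D) (at (t y, base_coord y))" by (rule differentiable_has_derivative[OF K])
  interpret linear ?D using K by (rule has_derivative_linear)
  note t = differentiable_has_derivative[OF t]
  have "((\<lambda>y. (t y, base_coord y)) has_derivative (\<lambda>v. (?t v, base_coord v))) (at y)"
    by (intro has_derivative_Pair t bounded_linear_imp_has_derivative bounded_linear_base_coord)
  from has_derivative_compose[OF this K]
  have "((\<lambda>y. K (t y, base_coord y)) has_derivative (\<lambda>v. ?D (?t v, base_coord v))) (at y)" .
  moreover have "?D (?t v, base_coord v) = ?t v *\<^sub>R ?D (1, 0) + ?D (0, base_coord v)" for v
    using scale[of "?t v" "(1, 0)"] add[of "(?t v, 0)" "(0, base_coord v)"] by simp
  ultimately have d: "((\<lambda>y. K (t y, base_coord y)) has_derivative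
      (\<lambda>v. ?t v *\<^sub>R ?D (1, 0) + ?D (0, base_coord v))) (at y)" by simp
  have dt: "((\<lambda>y. complex_of_real (t y)) has_derivative (\<lambda>v. complex_of_real (?t v))) (at y)"
    by (rule bounded_linear.has_derivative[OF bounded_linear_of_real t])
  have z: "?D (0, 0) = 0" using zero by (simp add: zero_prod_def)
  show "wd i (\<lambda>y. K (t y, base_coord y)) y =
      deriv_fst K (t y, base_coord y) * wd i (\<lambda>y. complex_of_real (t y)) y + on_some i (\<lambda>a. wd_snd a K (t y, base_coord y))"
    "wdb i (\<lambda>y. K (t y, base_coord y)) y =
      deriv_fst K (t y, base_coord y) * wdb i (\<lambda>y. complex_of_real (t y)) y + on_some i (\<lambda>a. wdb_snd a K (t y, base_coord y))"
    unfolding wd_has_derivative[OF d] wd_has_derivative[OF dt] base_coord_axis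
    by (cases i; simp add: z deriv_fst_def wd_snd_def wdb_snd_def scaleR_conv_of_real field_simps)+
qed

text \<open>The mixed terms keep the order in which they arise; they drop out of the trace below, so their
  symmetry is irrelevant.\<close>

lemma wd_wdb_fibre_compose:
  fixes K :: "real \<times> (complex ^ 'm::finite) \<Rightarrow> complex"
  assumes Y: "open Y" "y \<in> Y" and V: "open V" "\<And>x. x \<in> Y \<Longrightarrow> (t x, base_coord x) \<in> V"
    and t: "smooth_on t Y" and K: "smooth_on K V"
  defines "p \<equiv> (t y, base_coord y)"
  shows "wd i (wdb j (\<lambda>x. K (t x, base_coord x))) y =
    (deriv_fst (deriv_fst K) p * wd i (\<lambda>x. complex_of_real (t x)) y + on_some i (\<lambda>a. wd_snd a (deriv_fst K) p)) * wdb j (\<lambda>x. complex_of_real (t x)) y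
    + deriv_fst K p * wd i (wdb j (\<lambda>x. complex_of_real (t x))) y
    + on_some j (\<lambda>b. deriv_fst (wdb_snd b K) p * wd i (\<lambda>x. complex_of_real (t x)) y + on_some i (\<lambda>a. wd_snd a (wdb_snd b K) p))"
proof -
  let ?ct = "\<lambda>x. complex_of_real (t x)"
  have td: "t differentiable (at x)" if "x \<in> Y" for x by (rule smooth_on_differentiable[OF t that])
  have Kd: "K' differentiable (at (t x, base_coord x))" if "x \<in> Y" "smooth_on K' V"
    for x and K' :: "real \<times> (complex ^ 'm) \<Rightarrow> complex"
    by (rule smooth_on_differentiable[OF that(2) V(2)[OF that(1)]])
  have sct: "smooth_on ?ct Y" by (rule smooth_on_bounded_linear_compose[OF bounded_linear_of_real Y(1) t])
  have sct': "smooth_on (wdb j ?ct) Y" by (rule smooth_on_wd(2)[OF Y(1) sct])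
  note cd = smooth_on_differentiable[OF sct' Y(2)]
  note P = smooth_on_partial[OF V(1) K]
  have spair: "smooth_on (\<lambda>x. (t x, base_coord x)) Y"
    by (intro smooth_on_Pair Y t smooth_on_bounded_linear bounded_linear_base_coord)
  have comp: "smooth_on (\<lambda>x. K' (t x, base_coord x)) Y" if "smooth_on K' V" for K' :: "real \<times> (complex ^ 'm) \<Rightarrow> complex"
    by (rule smooth_on_compose[OF Y(1) V(1) _ spair that]) (use V(2) in auto)
  note D = comp[THEN smooth_on_differentiable, OF _ Y(2)]
  have "wd i (wdb j (\<lambda>x. K (t x, base_coord x))) y =
     wd i (\<lambda>x. deriv_fst K (t x, base_coord x) * wdb j ?ct x + on_some j (\<lambda>b. wdb_snd b K (t x, base_coord x))) y"
    by (rule wd_cong(1)[OF Y]) (rule wd_fibre_compose(2)[OF td Kd[OF _ K]])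
  also have "\<dots> = wd i (\<lambda>x. deriv_fst K (t x, base_coord x) * wdb j ?ct x) y + wd i (\<lambda>x. on_some j (\<lambda>b. wdb_snd b K (t x, base_coord x))) y"
    by (rule wd_add(1)[OF smooth_on_differentiable[OF smooth_on_mult[OF Y(1) comp[OF P(1)] sct'] Y(2)]])
       (cases j; simp add: D[OF P(3)])
  also have "wd i (\<lambda>x. deriv_fst K (t x, base_coord x) * wdb j ?ct x) y =
     wd i (\<lambda>x. deriv_fst K (t x, base_coord x)) y * wdb j ?ct y + deriv_fst K p * wd i (wdb j ?ct) y"
    unfolding p_def by (rule wd_mult(1)[OF D[OF P(1)] cd])
  also have "wd i (\<lambda>x. deriv_fst K (t x, base_coord x)) y = deriv_fst (deriv_fst K) p * wd i ?ct y + on_some i (\<lambda>a. wd_snd a (deriv_fst K) p)"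
    unfolding p_def by (rule wd_fibre_compose(1)[OF td[OF Y(2)] Kd[OF Y(2) P(1)]])
  also have "wd i (\<lambda>x. on_some j (\<lambda>b. wdb_snd b K (t x, base_coord x))) y =
     on_some j (\<lambda>b. wd i (\<lambda>x. wdb_snd b K (t x, base_coord x)) y)"
    by (cases j) (simp_all add: wd_const)
  also have "(\<lambda>b. wd i (\<lambda>x. wdb_snd b K (t x, base_coord x)) y) =
      (\<lambda>b. deriv_fst (wdb_snd b K) p * wd i ?ct y + on_some i (\<lambda>a. wd_snd a (wdb_snd b K) p))"
    unfolding p_def by (rule ext) (rule wd_fibre_compose(1)[OF td[OF Y(2)] Kd[OF Y(2) P(3)]])
  finally show ?thesis .
qed

text \<open>With \<open>\<theta> = 2 \<partial>t\<close> the rows of \<open>coframe\<close> are \<open>dw/w + \<partial> log h\<close> and the \<open>dz\<^sup>a\<close>; in this frame the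
  adapted metric is block diagonal.\<close>

definition coframe :: "('m option \<Rightarrow> complex) \<Rightarrow> complex ^ 'm::finite option ^ 'm option" where
  "coframe \<theta> = (\<chi> i j. case i of None \<Rightarrow> \<theta> j | Some a \<Rightarrow> if j = Some a then 1 else 0)"

definition block_matrix :: "complex \<Rightarrow> ('m \<Rightarrow> complex) \<Rightarrow> ('m \<Rightarrow> complex) \<Rightarrow> complex ^ 'm ^ 'm
    \<Rightarrow> complex ^ 'm::finite option ^ 'm option" where
  "block_matrix d u l M = (\<chi> i j. case i of None \<Rightarrow> (case j of None \<Rightarrow> d | Some b \<Rightarrow> u b)
     | Some a \<Rightarrow> (case j of None \<Rightarrow> l a | Some b \<Rightarrow> M $ a $ b))"

lemma block_matrix_nth [simp]:
  "block_matrix d u l M $ None $ None = d" "block_matrix d u l M $ None $ Some b = u b"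
  "block_matrix d u l M $ Some a $ None = l a" "block_matrix d u l M $ Some a $ Some b = M $ a $ b"
  by (simp_all add: block_matrix_def)

lemma some_block_matrix [simp]: "some_block (block_matrix d u l M) = M"
  by (simp add: some_block_def vec_eq_iff)

lemma det_coframe: "det (coframe \<theta>) = \<theta> None"
proof -
  have "some_block (coframe \<theta>) = mat 1"
    by (auto simp: some_block_def coframe_def vec_eq_iff mat_def)
  then show ?thesis by (subst det_block) (simp_all add: coframe_def)
qed

lemma det_block_diag: "det (block_matrix d (\<lambda>_. 0) (\<lambda>_. 0) M) = d * det M"
  by (subst det_block) simp_all

lemma form_pullback_coframe:
  "form_pullback (coframe \<theta>) (block_matrix d u l M) $ i $ j =
    d * \<theta> i * cnj (\<theta> j) + \<theta> i * on_some j u + on_some i l * cnj (\<theta> j) + on_some i (\<lambda>a. on_some j (\<lambda>b. M $ a $ b))"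
proof -
  \<comment> \<open>Kronecker deltas are written with \<open>on_some\<close>, so that the sums over
    base indices collapse uniformly in \<open>i\<close> and \<open>j\<close>.\<close>
  have 1: "(if i = Some a then 1 else 0) = on_some i (\<lambda>c. if c = a then 1 else 0)" for a i
    by (cases i) auto
  have 2: "(\<Sum>a\<in>UNIV. f a * on_some i (\<lambda>c. if c = a then 1 else 0)) = on_some i f" for f and i :: "'a option"
    by (cases i) (simp_all add: mult_delta_right)
  have 3: "cnj (on_some i (\<lambda>c. if c = a then 1 else 0)) = on_some i (\<lambda>c. if c = a then 1 else 0)" for a and i :: "'a option"
    by (cases i) simp_all
  have 4: "(\<Sum>a\<in>UNIV. l a * on_some i (\<lambda>c. if c = a then 1 else 0) * x) = on_some i l * x" for l x and i :: "'a option"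
    by (simp add: sum_distrib_right[symmetric] 2)
  have 5: "(\<Sum>a\<in>UNIV. \<Sum>b\<in>UNIV. M $ a $ b * on_some i (\<lambda>c. if c = a then 1 else 0) * on_some j (\<lambda>c. if c = b then 1 else 0))
      = on_some i (\<lambda>a. on_some j (\<lambda>b. M $ a $ b))"
    by (cases i; cases j) (simp_all add: mult_delta_left mult_delta_right)
  have 6: "(\<Sum>b\<in>UNIV. u b * y * on_some j (\<lambda>c. if c = b then 1 else 0)) = y * on_some j u" for u y and j :: "'a option"
    by (subst 2) (cases j; simp)
  have 7: "(\<Sum>a\<in>UNIV. on_some i (\<lambda>c. if c = a then 1 else 0) * f a) = on_some i f" for f and i :: "'a option"
    using 2[of f i] by (simp add: mult.commute)
  show ?thesis
    by (simp add: form_pullback_def coframe_def sum_option_UNIV 1 3 4 5 6 7 sum.distrib)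
qed

text \<open>Replacing \<open>\<partial>t\<close> by the coframe entry \<open>2 \<partial>t\<close>
  divides the fibre block by \<open>4\<close> and the mixed terms by \<open>2\<close>. The matrix
  \<open>T\<close> is the Hessian of \<open>t\<close>, which lives on the base. The mixed terms
  \<open>u\<close> and \<open>l\<close> remain existential because the trace ignores them.\<close>

lemma wd_wdb_fibre_form:
  fixes K :: "real \<times> (complex ^ 'm::finite) \<Rightarrow> complex"
  assumes Y: "open Y" "y \<in> Y" and V: "open V" "\<And>x. x \<in> Y \<Longrightarrow> (t x, base_coord x) \<in> V"
    and t: "smooth_on t Y" and K: "smooth_on K V"
    and T: "\<And>i j. wd i (wdb j (\<lambda>x. complex_of_real (t x))) y = on_some i (\<lambda>a. on_some j (\<lambda>b. T $ a $ b))"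
  defines "p \<equiv> (t y, base_coord y)"
  shows "\<exists>u l. (\<chi> i j. wd i (wdb j (\<lambda>x. K (t x, base_coord x))) y) =
    form_pullback (coframe (\<lambda>i. 2 * wd i (\<lambda>x. complex_of_real (t x)) y))
      (block_matrix (deriv_fst (deriv_fst K) p / 4) u l (\<chi> a b. wd a (wdb b (\<lambda>z. K (t y, z))) (base_coord y) + deriv_fst K p * T $ a $ b))"
proof (intro exI)
  let ?ct = "\<lambda>x. complex_of_real (t x)"
  have cj: "wdb j ?ct y = cnj (wd j ?ct y)" for j
    by (rule wd_of_real[OF smooth_on_differentiable[OF t Y(2)]])
  have K2: "wd a (wdb b (\<lambda>z. K (t y, z))) (base_coord y) = wd_snd a (wdb_snd b K) p" for a b
  proof -
    let ?Z = "{z. (t y, z) \<in> V}"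
    have "open ((\<lambda>z. (t y, z)) -` V)" by (intro open_vimage V continuous_intros)
    then have Z: "open ?Z" "base_coord y \<in> ?Z" using V Y by (auto simp: vimage_def)
    have "wd a (wdb b (\<lambda>z. K (t y, z))) (base_coord y) = wd a (\<lambda>z. wdb_snd b K (t y, z)) (base_coord y)"
      by (rule wd_cong(1)[OF Z]) (auto intro!: partial_has_derivative(3) smooth_on_differentiable[OF K])
    also have "\<dots> = wd_snd a (wdb_snd b K) p" unfolding p_def
      by (rule partial_has_derivative(2)[OF smooth_on_differentiable[OF smooth_on_partial(3)[OF V(1) K]]]) (use Z in auto)
    finally show ?thesis .
  qed
  show "(\<chi> i j. wd i (wdb j (\<lambda>x. K (t x, base_coord x))) y) =
    form_pullback (coframe (\<lambda>i. 2 * wd i ?ct y))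
      (block_matrix (deriv_fst (deriv_fst K) p / 4) (\<lambda>b. deriv_fst (wdb_snd b K) p / 2) (\<lambda>a. wd_snd a (deriv_fst K) p / 2)
        (\<chi> a b. wd a (wdb b (\<lambda>z. K (t y, z))) (base_coord y) + deriv_fst K p * T $ a $ b))"
    unfolding vec_eq_iff
  proof (intro allI)
    fix i j
    show "(\<chi> i j. wd i (wdb j (\<lambda>x. K (t x, base_coord x))) y) $ i $ j =
    form_pullback (coframe (\<lambda>i. 2 * wd i ?ct y))
      (block_matrix (deriv_fst (deriv_fst K) p / 4) (\<lambda>b. deriv_fst (wdb_snd b K) p / 2) (\<lambda>a. wd_snd a (deriv_fst K) p / 2)
        (\<chi> a b. wd a (wdb b (\<lambda>z. K (t y, z))) (base_coord y) + deriv_fst K p * T $ a $ b)) $ i $ j"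
    proof -
      have e: "wd i (wdb j (\<lambda>x. K (t x, base_coord x))) y =
        (deriv_fst (deriv_fst K) p * wd i ?ct y + on_some i (\<lambda>a. wd_snd a (deriv_fst K) p)) * wdb j ?ct y
        + deriv_fst K p * wd i (wdb j ?ct) y
        + on_some j (\<lambda>b. deriv_fst (wdb_snd b K) p * wd i ?ct y + on_some i (\<lambda>a. wd_snd a (wdb_snd b K) p))"
        unfolding p_def by (rule wd_wdb_fibre_compose[OF Y V t K])
      show ?thesis
        unfolding form_pullback_coframe vec_lambda_beta K2 e T cj
        by (cases i; cases j) (simp_all add: field_simps)
    qed
  qed
qed

lemma wd_vec_nth:
  "wd i (\<lambda>y. y $ k) y = (if i = k then 1 else 0)" "wdb i (\<lambda>y. y $ k) y = 0"
  using wd_has_derivative[OF bounded_linear_imp_has_derivative[OF bounded_linear_vec_nth], of i k y]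
  by (cases "i = k"; simp add: axis_def)+

lemma wd_base_compose:
  assumes H: "H differentiable (at (base_coord y))"
  shows "wd i (\<lambda>y. H (base_coord y)) y = on_some i (\<lambda>a. wd a H (base_coord y))"
proof -
  have "base_coord differentiable (at y)"
    by (rule differentiableI[OF bounded_linear_imp_has_derivative[OF bounded_linear_base_coord]])
  from wd_compose(1)[OF this H, of i] show ?thesis
    by (cases i) (simp_all add: wd_vec_nth mult_delta_right)
qed

lemma wd_wdb_base_compose:
  assumes Y: "open Y" "y \<in> Y" and Z: "open Z" "base_coord ` Y \<subseteq> Z" and H: "smooth_on H Z"
  shows "wd i (wdb j (\<lambda>y. H (base_coord y))) y = on_some i (\<lambda>a. on_some j (\<lambda>b. wd a (wdb b H) (base_coord y)))"
proof -
  have "smooth_on (\<lambda>z. base_coord z $ l) Y" for l :: 'a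
    using smooth_on_bounded_linear[OF bounded_linear_vec_nth Y(1), of "Some l"] by simp
  then have "wd i (wdb j (\<lambda>y. H (base_coord y))) y = (\<Sum>k\<in>UNIV. \<Sum>l\<in>UNIV. wd k (wdb l H) (base_coord y) *
      wd i (\<lambda>z. base_coord z $ k) y * cnj (wd j (\<lambda>z. base_coord z $ l) y))"
    by (intro wd_wdb_compose_holomorphic[OF Y Z _ _ H]) (simp_all add: wd_vec_nth)
  moreover have "cnj (if b then 1 else 0) = (if b then 1 else 0)" for b by simp
  ultimately show ?thesis
    by (cases i; cases j; simp add: wd_vec_nth mult_delta_left mult_delta_right)
qed

text \<open>Off the zero section, \<open>log |w|^2\<close> contributes to the first derivative but
  not to the mixed Hessian, which therefore comes from the base function \<open>H\<close> alone.
  Later \<open>H\<close> is the logarithm of the local norm function.\<close>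

lemma log_norm_derivatives:
  fixes H :: "complex ^ 'm::finite \<Rightarrow> real"
  assumes Z: "open Z" and H: "smooth_on H Z"
    and t_def: "t = (\<lambda>y. (ln ((cmod (y $ None))\<^sup>2) + H (base_coord y)) / 2)"
  defines "Y \<equiv> {y. y $ None \<noteq> 0 \<and> base_coord y \<in> Z}"
  shows "open Y" "smooth_on t Y"
    and "\<And>y. y \<in> Y \<Longrightarrow> wd None (\<lambda>y. complex_of_real (t y)) y = 1 / (2 * y $ None)"
    and "\<And>y i j. y \<in> Y \<Longrightarrow> wd i (wdb j (\<lambda>y. complex_of_real (t y))) y =
       on_some i (\<lambda>a. on_some j (\<lambda>b. wd a (wdb b (\<lambda>z. complex_of_real (H z))) (base_coord y) / 2))"
proof -
  let ?l = "\<lambda>y::complex ^ 'm option. ln ((cmod (y $ None))\<^sup>2)"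
  let ?cl = "\<lambda>y. complex_of_real (?l y)" and ?H = "\<lambda>y. complex_of_real (H (base_coord y))"
  have "open (base_coord -` Z \<inter> (\<lambda>y. y $ None) -` (- {0}))"
    by (intro open_Int open_vimage Z linear_continuous_on bounded_linear_base_coord bounded_linear_vec_nth) auto
  also have "base_coord -` Z \<inter> (\<lambda>y. y $ None) -` (- {0}) = Y" by (auto simp: Y_def)
  finally show Y: "open Y" .
  have nth: "smooth_on (\<lambda>y. y $ None) Y" by (rule smooth_on_bounded_linear[OF bounded_linear_vec_nth Y])
  have "smooth_on (\<lambda>y. Re (y $ None * cnj (y $ None))) Y"
    by (intro smooth_on_bounded_linear_compose[OF bounded_linear_Re Y] smooth_on_mult[OF Y nth]
        smooth_on_bounded_linear_compose[OF bounded_linear_cnj Y nth])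
  then have "smooth_on (\<lambda>y. (cmod (y $ None))\<^sup>2) Y"
    by (simp only: complex_norm_square[symmetric] Re_complex_of_real)
  then have l: "smooth_on ?l Y" by (rule smooth_on_ln[OF Y]) (auto simp: Y_def)
  have bc: "base_coord ` Y \<subseteq> Z" by (auto simp: Y_def)
  have HY: "smooth_on (\<lambda>y. H (base_coord y)) Y"
    by (rule smooth_on_compose[OF Y Z bc smooth_on_bounded_linear[OF bounded_linear_base_coord Y] H])
  show t: "smooth_on t Y" unfolding t_def
    using smooth_on_bounded_linear_compose[OF bounded_linear_divide Y smooth_on_add[OF Y l HY]] .
  have cl: "smooth_on ?cl Y" and cH: "smooth_on ?H Y"
    by (rule smooth_on_bounded_linear_compose[OF bounded_linear_of_real Y l],
        rule smooth_on_bounded_linear_compose[OF bounded_linear_of_real Y HY])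
  have Hc: "smooth_on (\<lambda>z. complex_of_real (H z)) Z"
    by (rule smooth_on_bounded_linear_compose[OF bounded_linear_of_real Z H])
  have ct: "(\<lambda>y. complex_of_real (t y)) = (\<lambda>y. (1/2) * (?cl y + ?H y))"
    by (simp add: t_def)
  note dl = smooth_on_differentiable[OF cl] and dH = smooth_on_differentiable[OF cH]
  have half: "wd i (\<lambda>y. complex_of_real (t y)) y = (wd i ?cl y + wd i ?H y) / 2"
    "wdb i (\<lambda>y. complex_of_real (t y)) y = (wdb i ?cl y + wdb i ?H y) / 2" if "y \<in> Y" for y i
    unfolding ct wd_cmult[OF smooth_on_differentiable[OF smooth_on_add[OF Y cl cH] that]]
      wd_add[OF dl[OF that] dH[OF that]] by simp_all
  show "wd None (\<lambda>y. complex_of_real (t y)) y = 1 / (2 * y $ None)" if y: "y \<in> Y" for y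
  proof -
    have "wd None ?cl y = 1 / y $ None"
      using y wd_ln_cmod_sq(1)[OF smooth_on_differentiable[OF nth y], of None]
      by (simp add: wd_vec_nth Y_def)
    moreover have "wd None ?H y = 0"
      using wd_base_compose[OF smooth_on_differentiable[OF Hc], of y None] y by (simp add: Y_def)
    ultimately show ?thesis by (simp only: half(1)[OF y]) simp
  qed
  show "wd i (wdb j (\<lambda>y. complex_of_real (t y))) y =
       on_some i (\<lambda>a. on_some j (\<lambda>b. wd a (wdb b (\<lambda>z. complex_of_real (H z))) (base_coord y) / 2))" if y: "y \<in> Y" for y i j
  proof -
    have s: "smooth_on (wdb j ?cl) Y" "smooth_on (wdb j ?H) Y"
      by (rule smooth_on_wd(2)[OF Y cl], rule smooth_on_wd(2)[OF Y cH])
    have "wd i (wdb j (\<lambda>y. complex_of_real (t y))) y = wd i (\<lambda>y. (1/2) * (wdb j ?cl y + wdb j ?H y)) y"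
      by (rule wd_cong(1)[OF Y y]) (simp add: half(2))
    also have "\<dots> = (1/2) * (wd i (wdb j ?cl) y + wd i (wdb j ?H) y)"
      unfolding wd_cmult[OF smooth_on_differentiable[OF smooth_on_add[OF Y s] y]]
        wd_add[OF s[THEN smooth_on_differentiable, OF y]] ..
    also have "wd i (wdb j ?cl) y = 0"
      by (rule wd_wdb_ln_cmod_sq[OF Y y nth]) (auto simp: wd_vec_nth Y_def)
    also have "wd i (wdb j ?H) y = on_some i (\<lambda>a. on_some j (\<lambda>b. wd a (wdb b (\<lambda>z. complex_of_real (H z))) (base_coord y)))"
      by (rule wd_wdb_base_compose[OF Y y Z bc Hc])
    finally show ?thesis by (cases i; cases j) simp_all
  qed
qed

section \<open>The momentum construction\<close>

lemma momentum_profile_smooth: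
  assumes "momentum_profile I \<phi>"
  shows "smooth_on \<phi> (interior I)"
proof -
  from assms obtain V \<psi> where V: "open V" "closure I \<subseteq> V" "smooth_on \<psi> V" "\<forall>x\<in>closure I. \<psi> x = \<phi> x"
    unfolding momentum_profile_def by blast
  have sub: "interior I \<subseteq> closure I" by (meson interior_subset closure_subset order_trans)
  show ?thesis
  proof (rule smooth_on_cong[OF open_interior])
    show "smooth_on \<psi> (interior I)" by (rule smooth_on_subset[OF V(3)]) (use sub V(2) in blast)
  qed (use V(4) sub in blast)
qed

locale momentum =
  fixes I :: "real set" and \<phi> :: "real \<Rightarrow> real" and \<tau>0 :: real
  assumes interval: "is_interval I" and profile: "momentum_profile I \<phi>" and base_point: "\<tau>0 \<in> interior I"
begin

abbreviation "J \<equiv> interior I"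
abbreviation "\<mu> \<equiv> moment I \<phi> \<tau>0"

text \<open>The function inverted by \<open>moment\<close>; strictly increasing on \<open>J\<close>
  because the profile is positive there.\<close>

definition time :: "real \<Rightarrow> real" where
  "time \<tau> = (LBINT x=ereal \<tau>0..ereal \<tau>. 1 / \<phi> x)"

definition times :: "real set" where
  "times = {t. lower_time I \<phi> \<tau>0 < ereal t \<and> ereal t < upper_time I \<phi> \<tau>0}"

lemma pos: "x \<in> J \<Longrightarrow> 0 < \<phi> x"
  using profile by (simp add: momentum_profile_def)

lemma smooth: "smooth_on \<phi> J"
  by (rule momentum_profile_smooth[OF profile])

lemma cont: "continuous_on J \<phi>"
  by (rule smooth_on_imp_continuous_on[OF smooth])

lemma segment: "x \<in> J \<Longrightarrow> y \<in> J \<Longrightarrow> {x..y} \<subseteq> J"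
proof -
  have "is_interval J"
    using convex_interior[OF is_interval_convex[OF interval]] by (simp add: is_interval_convex_1)
  then show "x \<in> J \<Longrightarrow> y \<in> J \<Longrightarrow> {x..y} \<subseteq> J"
    unfolding is_interval_1 by (meson atLeastAtMost_iff subsetI)
qed

text \<open>The fundamental theorem gives a derivative within a closed interval. Choosing that
  interval inside \<open>J\<close> with \<open>\<tau>\<close> in its interior removes the
  restriction.\<close>

lemma has_derivative_integral:
  assumes f: "continuous_on J f" and \<tau>: "\<tau> \<in> J"
  shows "((\<lambda>u. LBINT x=ereal \<tau>0..ereal u. f x) has_real_derivative f \<tau>) (at \<tau>)"
proof -
  have "\<exists>a b. a < x \<and> x < b \<and> {a..b} \<subseteq> J" if x: "x \<in> J" for x
  proof -
    obtain e where e: "0 < e" "cball x e \<subseteq> J"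
      using open_contains_cball[THEN iffD1, OF open_interior, rule_format, OF x] by blast
    have "{x - e..x + e} \<subseteq> J" using e by (simp add: cball_eq_atLeastAtMost)
    then show ?thesis using e(1) by (intro exI[of _ "x - e"] exI[of _ "x + e"]) simp
  qed
  from this[OF \<tau>] this[OF base_point] obtain a b a' b' where
    ab: "a < \<tau>" "\<tau> < b" "{a..b} \<subseteq> J" "a' < \<tau>0" "\<tau>0 < b'" "{a'..b'} \<subseteq> J" by blast
  let ?l = "min a a'" and ?u = "max b b'"
  have "?l \<in> J" "?u \<in> J" using ab by (auto simp: subset_iff min_def max_def)
  then have sub: "{?l..?u} \<subseteq> J" by (rule segment)
  have "((\<lambda>u. LBINT x=ereal \<tau>0..ereal u. f x) has_vector_derivative f \<tau>) (at \<tau> within {?l..?u})"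
    using ab by (intro interval_integral_FTC2 continuous_on_subset[OF f sub]) auto
  moreover have "at \<tau> within {?l..?u} = at \<tau>"
    using ab by (intro at_within_interior) auto
  ultimately show ?thesis by (simp add: has_real_derivative_iff_has_vector_derivative)
qed

lemma time_derivative: "\<tau> \<in> J \<Longrightarrow> (time has_real_derivative 1 / \<phi> \<tau>) (at \<tau>)"
  unfolding time_def
  by (rule has_derivative_integral) (auto intro!: continuous_intros cont dest: pos)

lemma time_less:
  assumes "x \<in> J" "y \<in> J" "x < y"
  shows "time x < time y"
proof (rule DERIV_pos_imp_increasing[OF assms(3)])
  fix z assume "x \<le> z" "z \<le> y"
  then have "z \<in> J" using segment[OF assms(1,2)] by auto
  then show "\<exists>l. (time has_real_derivative l) (at z) \<and> 0 < l"
    using time_derivative pos by (intro exI[of _ "1 / \<phi> z"]) auto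
qed

lemma time_inj: "x \<in> J \<Longrightarrow> y \<in> J \<Longrightarrow> time x = time y \<longleftrightarrow> x = y"
  using time_less by (metis less_irrefl linorder_less_linear)

lemma moment_time: "\<tau> \<in> J \<Longrightarrow> \<mu> (time \<tau>) = \<tau>"
  unfolding moment_def time_def[symmetric] by (rule the_equality) (auto simp: time_inj)

text \<open>The function \<open>time\<close> is increasing, so its limit at the left end of
  \<open>J\<close> is its infimum. Everything is done in the extended reals, which allows an
  infinite end and an infinite limit.\<close>

lemma lower_time_eq: "lower_time I \<phi> \<tau>0 = Inf ((\<lambda>x. ereal (time x)) ` J)"
proof -
  let ?a = "Inf (ereal ` J)" and ?l = "Inf ((\<lambda>x. ereal (time x)) ` J)"
  let ?F = "\<lambda>\<tau>. ereal (LBINT x=ereal \<tau>0..\<tau>. 1 / \<phi> x)"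
  have a_less: "?a < ereal x" if x: "x \<in> J" for x
  proof -
    obtain e where e: "0 < e" "cball x e \<subseteq> J" 
      using open_contains_cball[THEN iffD1, OF open_interior, rule_format, OF x] by blast
    then have "x - e \<in> J" by (auto simp: dist_real_def)
    then have "?a \<le> ereal (x - e)" by (intro Inf_lower) auto
    also have "\<dots> < ereal x" using e by simp
    finally show ?thesis .
  qed
  have mem: "\<exists>s\<in>J. \<tau> = ereal s \<and> s < x" if x: "x \<in> J" "?a < \<tau>" "\<tau> < ereal x" for x \<tau>
  proof -
    obtain y where y: "y \<in> J" "ereal y < \<tau>" using x(2) by (auto simp: Inf_less_iff)
    then obtain s where s: "\<tau> = ereal s" using x(3) by (cases \<tau>) auto
    then have "s \<in> J" using segment[OF y(1) x(1)] y x s by auto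
    then show ?thesis using s x by auto
  qed
  \<comment> \<open>Near the left end all arguments are real points of \<open>J\<close> below any
    given \<open>x\<close>, so it is enough to check those.\<close>
  have ev: "eventually P (at_right ?a)" if "x \<in> J" "\<And>s. s \<in> J \<Longrightarrow> s < x \<Longrightarrow> P (ereal s)" for P x
    unfolding eventually_at_right[OF a_less[OF that(1)]]
    using a_less[OF that(1)] mem[OF that(1)] that(2) by blast
  have "(?F \<longlongrightarrow> ?l) (at_right ?a)"
  proof (rule order_tendstoI)
    fix u assume "u < ?l"
    then have "u < ereal (time s)" if "s \<in> J" for s
      using that by (meson Inf_lower image_eqI less_le_trans)
    then show "eventually (\<lambda>\<tau>. u < ?F \<tau>) (at_right ?a)"
      by (intro ev[OF base_point]) (simp add: time_def)
  next
    fix u assume "?l < u"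
    then obtain x where x: "x \<in> J" "ereal (time x) < u" by (auto simp: Inf_less_iff)
    then have "ereal (time s) < u" if "s \<in> J" "s < x" for s
      using time_less[OF that(1) x(1) that(2)] by (metis less_ereal.simps(1) less_trans)
    then show "eventually (\<lambda>\<tau>. ?F \<tau> < u) (at_right ?a)"
      by (intro ev[OF x(1)]) (simp add: time_def)
  qed
  \<comment> \<open>Uniqueness of limits, and hence the value of \<open>Lim\<close>, requires a
    nontrivial filter; density of the order provides it.\<close>
  moreover have "at_right ?a \<noteq> bot"
  proof
    assume "at_right ?a = bot"
    then have "eventually (\<lambda>_. False) (at_right ?a)" by simp
    then obtain b where b: "?a < b" "\<And>y. ?a < y \<Longrightarrow> y < b \<Longrightarrow> False"
      unfolding eventually_at_right[OF a_less[OF base_point]] by blast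
    then show False using dense[OF b(1)] by blast
  qed
  ultimately show ?thesis unfolding lower_time_def by (intro tendsto_Lim) auto
qed

text \<open>Mirror image of \<open>lower_time_eq\<close>.\<close>

lemma upper_time_eq: "upper_time I \<phi> \<tau>0 = Sup ((\<lambda>x. ereal (time x)) ` J)"
proof -
  let ?b = "Sup (ereal ` J)" and ?l = "Sup ((\<lambda>x. ereal (time x)) ` J)"
  let ?F = "\<lambda>\<tau>. ereal (LBINT x=ereal \<tau>0..\<tau>. 1 / \<phi> x)"
  have b_greater: "ereal x < ?b" if x: "x \<in> J" for x
  proof -
    obtain e where e: "0 < e" "cball x e \<subseteq> J" 
      using open_contains_cball[THEN iffD1, OF open_interior, rule_format, OF x] by blast
    then have "x + e \<in> J" by (auto simp: dist_real_def)
    then have "ereal (x + e) \<le> ?b" by (intro Sup_upper) auto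
    moreover have "ereal x < ereal (x + e)" using e by simp
    ultimately show ?thesis by (rule less_le_trans[rotated])
  qed
  have mem: "\<exists>s\<in>J. \<tau> = ereal s \<and> x < s" if x: "x \<in> J" "ereal x < \<tau>" "\<tau> < ?b" for x \<tau>
  proof -
    obtain y where y: "y \<in> J" "\<tau> < ereal y" using x(3) by (auto simp: less_Sup_iff)
    then obtain s where s: "\<tau> = ereal s" using x(2) by (cases \<tau>) auto
    then have "s \<in> J" using segment[OF x(1) y(1)] y x s by auto
    then show ?thesis using s x by auto
  qed
  have ev: "eventually P (at_left ?b)" if "x \<in> J" "\<And>s. s \<in> J \<Longrightarrow> x < s \<Longrightarrow> P (ereal s)" for P x
    unfolding eventually_at_left[OF b_greater[OF that(1)]]
    using b_greater[OF that(1)] mem[OF that(1)] that(2) by blast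
  have "(?F \<longlongrightarrow> ?l) (at_left ?b)"
  proof (rule order_tendstoI)
    fix u assume "?l < u"
    then have "ereal (time s) < u" if "s \<in> J" for s
      using that by (meson Sup_upper image_eqI le_less_trans)
    then show "eventually (\<lambda>\<tau>. ?F \<tau> < u) (at_left ?b)"
      by (intro ev[OF base_point]) (simp add: time_def)
  next
    fix u assume "u < ?l"
    then obtain x where x: "x \<in> J" "u < ereal (time x)" by (auto simp: less_Sup_iff)
    then have "u < ereal (time s)" if "s \<in> J" "x < s" for s
      using time_less[OF x(1) that] by (metis less_ereal.simps(1) less_trans)
    then show "eventually (\<lambda>\<tau>. u < ?F \<tau>) (at_left ?b)"
      by (intro ev[OF x(1)]) (simp add: time_def)
  qed
  moreover have "at_left ?b \<noteq> bot"
  proof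
    assume "at_left ?b = bot"
    then have "eventually (\<lambda>_. False) (at_left ?b)" by simp
    then obtain c where c: "c < ?b" "\<And>y. c < y \<Longrightarrow> y < ?b \<Longrightarrow> False"
      unfolding eventually_at_left[OF b_greater[OF base_point]] by blast
    then show False using dense[OF c(1)] by blast
  qed
  ultimately show ?thesis unfolding upper_time_def by (intro tendsto_Lim) auto
qed

text \<open>A number strictly between the infimum and the supremum of \<open>time\<close> lies
  between two of its values and is attained by the intermediate value theorem. This makes the
  \<open>THE\<close> in \<open>moment\<close> meaningful.\<close>

lemma times_moment:
  assumes "t \<in> times"
  shows "\<mu> t \<in> J" "time (\<mu> t) = t"
proof -
  obtain x where x: "x \<in> J" "time x < t"
    using assms by (auto simp: times_def lower_time_eq Inf_less_iff)
  obtain y where y: "y \<in> J" "t < time y"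
    using assms by (auto simp: times_def upper_time_eq less_Sup_iff)
  have xy: "x \<le> y" using time_less[OF y(1) x(1)] x y by (meson less_trans not_le less_asym)
  have "continuous_on {x..y} time"
    using segment[OF x(1) y(1)] time_derivative
    by (intro continuous_at_imp_continuous_on ballI DERIV_isCont) blast
  then obtain \<tau> where \<tau>: "x \<le> \<tau>" "\<tau> \<le> y" "time \<tau> = t"
    using IVT'[of time x t y] x y xy by auto
  then have "\<tau> \<in> J" using segment[OF x(1) y(1)] by auto
  then show "\<mu> t \<in> J" "time (\<mu> t) = t" using moment_time[of \<tau>] \<tau>(3) by auto
qed

lemma open_times: "open times"
proof -
  have "open (ereal -` {lower_time I \<phi> \<tau>0<..<upper_time I \<phi> \<tau>0})"
    by (intro open_vimage open_greaterThanLessThan continuous_on_ereal continuous_on_id)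
  also have "\<dots> = times" by (auto simp: times_def)
  finally show ?thesis .
qed

lemma moment_derivative:
  assumes t: "t \<in> times"
  shows "(\<mu> has_real_derivative \<phi> (\<mu> t)) (at t)"
proof -
  note m = times_moment[OF t]
  obtain e where e: "0 < e" "cball t e \<subseteq> times" 
    using open_contains_cball[THEN iffD1, OF open_times, rule_format, OF t] by blast
  obtain d where d: "0 < d" "cball (\<mu> t) d \<subseteq> J" 
    using open_contains_cball[THEN iffD1, OF open_interior, rule_format, OF m(1)] by blast
  \<comment> \<open>The rule for derivatives of inverses presupposes continuity of the inverse,
    which follows from continuity of \<open>time\<close> and injectivity near the point.\<close>
  have "isCont \<mu> (time (\<mu> t))"
  proof (rule isCont_inverse_function[where f = time and x = "\<mu> t", OF d(1)])
    fix z assume "\<bar>z - \<mu> t\<bar> \<le> d"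
    then have z: "z \<in> J" using d(2) by (auto simp: dist_real_def subset_iff abs_minus_commute)
    show "\<mu> (time z) = z" by (rule moment_time[OF z])
    show "isCont time z" by (rule DERIV_isCont[OF time_derivative[OF z]])
  qed
  then have c: "isCont \<mu> t" by (simp only: m(2))
  have "(\<mu> has_real_derivative inverse (1 / \<phi> (\<mu> t))) (at t)"
  proof (rule DERIV_inverse_function[where a = "t - e" and b = "t + e", OF time_derivative[OF m(1)] _ _ _ _ c])
    show "1 / \<phi> (\<mu> t) \<noteq> 0" using pos[OF m(1)] by simp
    show "t - e < t" "t < t + e" using e(1) by auto
    fix y assume "t - e < y" "y < t + e"
    then have "y \<in> times" using e(2) by (auto simp: dist_real_def subset_iff)
    then show "time (\<mu> y) = y" by (rule times_moment(2))
  qed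
  then show ?thesis by simp
qed

text \<open>Bootstrapping from the differential equation \<open>\<mu>' = \<phi>(\<mu>)\<close>: a
  solution of class k has a right-hand side of class k, hence is of class k + 1.\<close>

lemma smooth_moment: "smooth_on \<mu> times"
  unfolding smooth_on_def
proof
  fix k
  show "Ck_on k \<mu> times"
  proof (induction k)
    case 0
    have "continuous_on times \<mu>"
      by (intro continuous_at_imp_continuous_on ballI DERIV_isCont[OF moment_derivative])
    then show ?case by simp
  next
    case (Suc k)
    have c: "Ck_on k (\<lambda>t. \<phi> (\<mu> t)) times"
      using smooth times_moment(1)
      by (intro Ck_on_compose[OF open_times open_interior _ Suc.IH]) (auto simp: smooth_on_def)
    show ?case
    proof (rule Ck_on_SucI[OF open_times])
      show "(\<mu> has_derivative (\<lambda>v. \<phi> (\<mu> t) * v)) (at t)" if "t \<in> times" for t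
        using moment_derivative[OF that] by (simp add: has_field_derivative_def)
      show "Ck_on k (\<lambda>t. \<phi> (\<mu> t) * v) times" for v
        by (rule Ck_on_bounded_linear_compose[OF bounded_linear_mult_left open_times c])
    qed
  qed
qed

text \<open>The integrand contributes \<open>\<mu> / \<phi>(\<mu>)\<close> and the moving endpoint
  contributes \<open>\<phi>(\<mu>)\<close>.\<close>

lemma potential_derivative:
  assumes t: "t \<in> times"
  shows "(potential I \<phi> \<tau>0 has_real_derivative \<mu> t) (at t)"
proof -
  note m = times_moment(1)[OF t]
  have "((\<lambda>u. LBINT x=ereal \<tau>0..ereal u. x / \<phi> x) has_real_derivative \<mu> t / \<phi> (\<mu> t)) (at (\<mu> t))"
    by (rule has_derivative_integral[OF _ m]) (auto intro!: continuous_intros cont dest: pos)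
  from DERIV_chain2[OF this moment_derivative[OF t]]
  show ?thesis using pos[OF m] by (simp add: potential_def[abs_def])
qed

end

section \<open>Charts and holomorphic functions\<close>

definition holo :: "(complex ^ 'n::finite \<Rightarrow> complex) \<Rightarrow> (complex ^ 'n) set \<Rightarrow> bool" where
  "holo f S \<longleftrightarrow> smooth_on f S \<and> (\<forall>z\<in>S. \<forall>j. wdb j f z = 0)"

lemma holo_const: "open S \<Longrightarrow> holo (\<lambda>z. c) S"
  by (simp add: holo_def smooth_on_const wd_const)

lemma holo_mult:
  assumes S: "open S" and f: "holo f S" and g: "holo g S"
  shows "holo (\<lambda>z. f z * g z) S"
proof -
  have fg: "smooth_on f S" "smooth_on g S" "\<And>z j. z \<in> S \<Longrightarrow> wdb j f z = 0" "\<And>z j. z \<in> S \<Longrightarrow> wdb j g z = 0"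
    using f g by (simp_all add: holo_def)
  have "wdb j (\<lambda>z. f z * g z) z = 0" if "z \<in> S" for j z
    using wd_mult(2)[OF fg(1,2)[THEN smooth_on_differentiable, OF that]] fg(3,4)[OF that] by simp
  then show ?thesis using smooth_on_mult[OF S fg(1,2)] by (simp add: holo_def)
qed

lemma holo_add:
  assumes S: "open S" and f: "holo f S" and g: "holo g S"
  shows "holo (\<lambda>z. f z + g z) S"
proof -
  have fg: "smooth_on f S" "smooth_on g S" "\<And>z j. z \<in> S \<Longrightarrow> wdb j f z = 0" "\<And>z j. z \<in> S \<Longrightarrow> wdb j g z = 0"
    using f g by (simp_all add: holo_def)
  have "wdb j (\<lambda>z. f z + g z) z = 0" if "z \<in> S" for j z
    using wd_add(2)[OF fg(1,2)[THEN smooth_on_differentiable, OF that]] fg(3,4)[OF that] by simp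
  then show ?thesis using smooth_on_add[OF S fg(1,2)] by (simp add: holo_def)
qed

lemma holo_wd:
  assumes S: "open S" and f: "holo f S"
  shows "holo (wd i f) S"
proof -
  have fs: "smooth_on f S" "\<And>z j. z \<in> S \<Longrightarrow> wdb j f z = 0" using f by (simp_all add: holo_def)
  have "wdb j (wd i f) z = 0" if "z \<in> S" for z j
  proof -
    have "wdb j (wd i f) z = wd i (wdb j f) z" by (rule wd_wdb_commute[OF S that fs(1), symmetric])
    also have "\<dots> = wd i (\<lambda>z. 0) z" by (rule wd_cong(1)[OF S that fs(2)])
    finally show ?thesis by (simp add: wd_const)
  qed
  then show ?thesis using smooth_on_wd(1)[OF S fs(1)] by (simp add: holo_def)
qed

lemma holo_prod: "open S \<Longrightarrow> (\<And>i. i \<in> A \<Longrightarrow> holo (f i) S) \<Longrightarrow> holo (\<lambda>z. \<Prod>i\<in>A. f i z) S"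
  by (induction A rule: infinite_finite_induct) (simp_all add: holo_const holo_mult)

lemma holo_sum: "open S \<Longrightarrow> (\<And>i. i \<in> A \<Longrightarrow> holo (f i) S) \<Longrightarrow> holo (\<lambda>z. \<Sum>i\<in>A. f i z) S"
  by (induction A rule: infinite_finite_induct) (simp_all add: holo_const holo_add)

lemma holo_inverse:
  assumes S: "open S" and f: "holo f S" and nz: "\<And>z. z \<in> S \<Longrightarrow> f z \<noteq> 0"
  shows "holo (\<lambda>z. inverse (f z)) S"
proof -
  have fs: "smooth_on f S" "\<And>z j. z \<in> S \<Longrightarrow> wdb j f z = 0" using f by (simp_all add: holo_def)
  have "wdb j (\<lambda>z. inverse (f z)) z = 0" if "z \<in> S" for j z
    by (subst wd_inverse(2)[OF smooth_on_differentiable[OF fs(1) that] nz[OF that]]) (simp add: fs(2)[OF that])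
  then show ?thesis using smooth_on_inverse[OF S fs(1) nz] by (simp add: holo_def)
qed

lemma holo_det:
  assumes "open S" "\<And>i j. holo (\<lambda>z. B z $ i $ j) S"
  shows "holo (\<lambda>z. det (B z)) S"
  unfolding det_def by (intro holo_sum holo_mult holo_prod holo_const assms)

lemma smooth_on_det:
  fixes B :: "'v::real_normed_vector \<Rightarrow> complex ^ 'n ^ 'n"
  assumes "open S" "\<And>i j. smooth_on (\<lambda>z. B z $ i $ j) S"
  shows "smooth_on (\<lambda>z. det (B z)) S"
  unfolding det_def by (intro smooth_on_sum smooth_on_mult smooth_on_prod smooth_on_const assms)

text \<open>What coordinate computations use of a chart, free of the topology of the manifold; it is
  verified for charts of the base and of the total space alike.\<close>

definition good_chart :: "('a, 'n::finite) chart \<Rightarrow> bool" where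
  "good_chart c \<longleftrightarrow> inj_on (snd c) (fst c) \<and> open (snd c ` fst c)"

lemma chart_inv_left: "good_chart c \<Longrightarrow> x \<in> fst c \<Longrightarrow> chart_inv c (snd c x) = x"
  by (simp add: chart_inv_def good_chart_def)

lemma chart_inv_right:
  assumes "z \<in> snd c ` fst c"
  shows "snd c (chart_inv c z) = z" "chart_inv c z \<in> fst c"
  using assms by (simp_all add: chart_inv_def f_inv_into_f inv_into_into)

lemma chart_inv_image:
  "good_chart c \<Longrightarrow> z \<in> snd c ` (fst c \<inter> W) \<Longrightarrow> chart_inv c z \<in> fst c \<inter> W"
  using chart_inv_left by fastforce

lemma dz_eq: "dz c j u x = wd j (\<lambda>z. u (chart_inv c z)) (snd c x)"
  and dzbar_eq: "dzbar c j u x = wdb j (\<lambda>z. u (chart_inv c z)) (snd c x)"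
  by (simp_all add: dz_def dzbar_def chart_deriv_def wd_def wdb_def o_def)

text \<open>The inner operator has to be rewritten on a whole neighbourhood, because the outer one
  differentiates the result; openness of the coordinate image enters here.\<close>

lemma ddbar_eq:
  assumes c: "good_chart c" and x: "x \<in> fst c"
  shows "ddbar u c x $ i $ j = wd i (wdb j (\<lambda>z. complex_of_real (u (chart_inv c z)))) (snd c x)"
proof -
  have "ddbar u c x $ i $ j = wd i (\<lambda>z. dzbar c j (\<lambda>y. complex_of_real (u y)) (chart_inv c z)) (snd c x)"
    by (simp add: ddbar_def dz_eq)
  also have "\<dots> = wd i (wdb j (\<lambda>z. complex_of_real (u (chart_inv c z)))) (snd c x)"
  proof (rule wd_cong(1))
    show "open (snd c ` fst c)" "snd c x \<in> snd c ` fst c" using c x by (simp_all add: good_chart_def)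
    show "dzbar c j (\<lambda>y. complex_of_real (u y)) (chart_inv c z) = wdb j (\<lambda>z. complex_of_real (u (chart_inv c z))) z"
      if "z \<in> snd c ` fst c" for z
      by (simp add: dzbar_eq chart_inv_right[OF that])
  qed
  finally show ?thesis .
qed

lemma wd_wdb_cong:
  assumes "open S" "z \<in> S" "\<And>x. x \<in> S \<Longrightarrow> f x = g x"
  shows "wd i (wdb j f) z = wd i (wdb j g) z"
  by (rule wd_cong(1)[OF assms(1,2)]) (rule wd_cong(2)[OF assms(1) _ assms(3)])

lemma wd_wdb_add:
  assumes S: "open S" "z \<in> S" and "smooth_on f S" "smooth_on g S"
  shows "wd i (wdb j (\<lambda>x. f x + g x)) z = wd i (wdb j f) z + wd i (wdb j g) z"
proof -
  have "wd i (wdb j (\<lambda>x. f x + g x)) z = wd i (\<lambda>x. wdb j f x + wdb j g x) z"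
    by (rule wd_cong(1)[OF S]) (rule wd_add(2)[OF assms(3,4)[THEN smooth_on_differentiable]])
  also have "\<dots> = wd i (wdb j f) z + wd i (wdb j g) z"
    by (rule wd_add(1)[OF smooth_on_wd(2)[OF S(1) assms(3), THEN smooth_on_differentiable, OF S(2)]
        smooth_on_wd(2)[OF S(1) assms(4), THEN smooth_on_differentiable, OF S(2)]])
  finally show ?thesis .
qed

text \<open>Adding the pluriharmonic \<open>log |k|^2\<close> does not affect the mixed Hessian.
  Constants are covered by constant \<open>k\<close>.\<close>

lemma wd_wdb_ln_cmod_sq_add:
  assumes S: "open S" "z \<in> S" and k: "holo k S" "\<And>x. x \<in> S \<Longrightarrow> k x \<noteq> 0"
    and f: "smooth_on (\<lambda>x. complex_of_real (f x)) S"
    and u: "\<And>x. x \<in> S \<Longrightarrow> u x = ln ((cmod (k x))\<^sup>2) + f x"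
  shows "wd i (wdb j (\<lambda>x. complex_of_real (u x))) z = wd i (wdb j (\<lambda>x. complex_of_real (f x))) z"
proof -
  have ks: "smooth_on k S" "\<And>x j. x \<in> S \<Longrightarrow> wdb j k x = 0" using k by (simp_all add: holo_def)
  have "smooth_on (\<lambda>x. Re (k x * cnj (k x))) S"
    by (intro smooth_on_bounded_linear_compose[OF bounded_linear_Re S(1)] smooth_on_mult[OF S(1) ks(1)]
        smooth_on_bounded_linear_compose[OF bounded_linear_cnj S(1) ks(1)])
  then have "smooth_on (\<lambda>x. (cmod (k x))\<^sup>2) S"
    by (simp only: complex_norm_square[symmetric] Re_complex_of_real)
  then have "smooth_on (\<lambda>x. ln ((cmod (k x))\<^sup>2)) S" by (rule smooth_on_ln[OF S(1)]) (simp add: k(2))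
  then have l: "smooth_on (\<lambda>x. complex_of_real (ln ((cmod (k x))\<^sup>2))) S"
    by (rule smooth_on_bounded_linear_compose[OF bounded_linear_of_real S(1)])
  have "wd i (wdb j (\<lambda>x. complex_of_real (u x))) z =
      wd i (wdb j (\<lambda>x. complex_of_real (ln ((cmod (k x))\<^sup>2)) + complex_of_real (f x))) z"
    by (rule wd_wdb_cong[OF S]) (simp add: u)
  also have "\<dots> = wd i (wdb j (\<lambda>x. complex_of_real (ln ((cmod (k x))\<^sup>2)))) z + wd i (wdb j (\<lambda>x. complex_of_real (f x))) z"
    by (rule wd_wdb_add[OF S l f])
  also have "wd i (wdb j (\<lambda>x. complex_of_real (ln ((cmod (k x))\<^sup>2)))) z = 0"
    by (rule wd_wdb_ln_cmod_sq[OF S ks k(2)])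
  finally show ?thesis by simp
qed

definition jacobian :: "('a, 'n::finite) chart \<Rightarrow> ('a, 'n) chart \<Rightarrow> 'a \<Rightarrow> complex ^ 'n ^ 'n" where
  "jacobian c c' q = (\<chi> k i. dz c i (\<lambda>y. snd c' y $ k) q)"

lemma pullback_via_id: "pullback_via c' id a c q = form_pullback (jacobian c c' q) (a c' q)"
  by (simp add: pullback_via_def form_pullback_def jacobian_def)

lemma holomorphic_in_holo:
  assumes "good_chart c" "holomorphic_in c W u"
  shows "holo (\<lambda>z. u (chart_inv c z)) (snd c ` (fst c \<inter> W))"
proof -
  have "wdb j (\<lambda>z. u (chart_inv c z)) z = 0" if z: "z \<in> snd c ` (fst c \<inter> W)" for z j
  proof -
    have "dzbar c j u (chart_inv c z) = 0"
      using assms(2) chart_inv_image[OF assms(1) z] by (simp add: holomorphic_in_def)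
    moreover have "snd c (chart_inv c z) = z" using z by (intro chart_inv_right) auto
    ultimately show ?thesis by (simp add: dzbar_eq)
  qed
  then show ?thesis using assms(2) by (simp add: holo_def holomorphic_in_def smooth_in_def o_def)
qed

lemma holo_subset: "holo f S \<Longrightarrow> U \<subseteq> S \<Longrightarrow> holo f U"
  by (meson holo_def smooth_on_subset subsetD)

text \<open>The function \<open>u\<close> stays and only the chart changes, so its coordinate
  expressions differ by a holomorphic transition map. The set \<open>W\<close> cuts down to a region
  where \<open>u\<close> is smooth, such as the domain of a trivialization.\<close>

lemma ddbar_change:
  fixes c c' :: "('a, 'n::finite) chart"
  assumes c: "good_chart c" "good_chart c'" and q: "q \<in> fst c \<inter> (fst c' \<inter> W)"
    and op: "open (snd c ` (fst c \<inter> (fst c' \<inter> W)))" "open (snd c' ` (fst c' \<inter> (fst c \<inter> W)))"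
    and F: "\<And>k. holo (\<lambda>z. snd c' (chart_inv c z) $ k) (snd c ` (fst c \<inter> (fst c' \<inter> W)))"
    and u: "smooth_on (\<lambda>z. complex_of_real (u (chart_inv c' z))) (snd c' ` (fst c' \<inter> (fst c \<inter> W)))"
  shows "ddbar u c q = form_pullback (jacobian c c' q) (ddbar u c' q)"
  unfolding vec_eq_iff
proof (intro allI)
  fix i j
  let ?F = "\<lambda>z. snd c' (chart_inv c z)" and ?v = "\<lambda>z. complex_of_real (u (chart_inv c' z))"
  let ?S = "snd c ` (fst c \<inter> (fst c' \<inter> W))" and ?U = "snd c' ` (fst c' \<inter> (fst c \<inter> W))"
  have z: "snd c q \<in> ?S" using q by auto
  have FU: "?F ` ?S \<subseteq> ?U"
  proof
    fix w assume "w \<in> ?F ` ?S"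
    then obtain z where "z \<in> ?S" "w = ?F z" by blast
    then show "w \<in> ?U" using chart_inv_image[OF c(1)] by blast
  qed
  have Fq: "?F (snd c q) = snd c' q" using q by (simp add: chart_inv_left[OF c(1)])
  have "ddbar u c q $ i $ j = wd i (wdb j (\<lambda>z. complex_of_real (u (chart_inv c z)))) (snd c q)"
    using q by (intro ddbar_eq[OF c(1)]) auto
  also have "\<dots> = wd i (wdb j (\<lambda>z. ?v (?F z))) (snd c q)"
  proof (rule wd_wdb_cong[OF op(1) z])
    fix x assume "x \<in> ?S"
    then have "chart_inv c x \<in> fst c'" using chart_inv_image[OF c(1)] by blast
    then show "complex_of_real (u (chart_inv c x)) = ?v (?F x)" by (simp add: chart_inv_left[OF c(2)])
  qed
  also have "\<dots> = (\<Sum>k\<in>UNIV. \<Sum>l\<in>UNIV. wd k (wdb l ?v) (?F (snd c q)) * wd i (\<lambda>z. ?F z $ k) (snd c q) * cnj (wd j (\<lambda>z. ?F z $ l) (snd c q)))"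
    by (rule wd_wdb_compose_holomorphic[OF op(1) z op(2) FU _ _ u]) (use F in \<open>unfold holo_def, blast+\<close>)
  also have "\<dots> = form_pullback (jacobian c c' q) (ddbar u c' q) $ i $ j"
    using q unfolding Fq by (simp add: form_pullback_def jacobian_def dz_eq ddbar_eq[OF c(2)])
  finally show "ddbar u c q $ i $ j = form_pullback (jacobian c c' q) (ddbar u c' q) $ i $ j" .
qed

section \<open>Horizontal data\<close>

lemma around_in: "(\<exists>c\<in>A. x \<in> fst c) \<Longrightarrow> around A x \<in> A \<and> x \<in> fst (around A x)"
  unfolding around_def by (rule someI_ex) blast

locale horizontal =
  fixes M :: "'a topology" and A :: "('a, 'm::finite) chart set" and g :: "('a, 'm) form11"
    and L :: "'b topology" and p :: "'b \<Rightarrow> 'a" and T :: "('a, 'b) triv set" and r :: "'b \<Rightarrow> real"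
    and I :: "real set"
  assumes data: "horizontal_data M A g L p T r I"
begin

abbreviation "\<omega> \<equiv> base_form g L p T r"
abbreviation "\<gamma> \<equiv> curvature_form L p T r"
abbreviation "h \<equiv> local_h L p r"

lemma manifold: "complex_manifold M A" and kahler: "kahler_metric A g" and line: "line_bundle M A L p T"
  and hermitian: "hermitian_structure A L p T r"
  and positive: "\<And>\<tau>. \<tau> \<in> I \<Longrightarrow> positive_form A (\<omega> \<tau>)"
  using data by (simp_all add: horizontal_data_def)

lemma chart_facts:
  assumes "c \<in> A"
  shows "good_chart c" "openin M (fst c)"
    and "openin M W \<Longrightarrow> open (snd c ` (fst c \<inter> W))"
proof -
  have c: "openin M (fst c)" "open (snd c ` fst c)"
    "homeomorphic_map (subtopology M (fst c)) (top_of_set (snd c ` fst c)) (snd c)"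
    using manifold assms unfolding complex_manifold_def by blast+
  have ts: "topspace (subtopology M (fst c)) = fst c"
    using openin_subset[OF c(1)] by auto
  have h: "open_map (subtopology M (fst c)) (top_of_set (snd c ` fst c)) (snd c)" "inj_on (snd c) (fst c)"
    using c(3) unfolding homeomorphic_eq_everything_map ts by blast+
  show "openin M (fst c)" by (rule c(1))
  show "good_chart c" using h(2) c(2) by (simp add: good_chart_def)
  assume W: "openin M W"
  have "openin (subtopology M (fst c)) (fst c \<inter> W)"
    using W by (auto simp: openin_subtopology)
  then have "openin (top_of_set (snd c ` fst c)) (snd c ` (fst c \<inter> W))"
    using h(1) by (simp add: open_map_def)
  then show "open (snd c ` (fst c \<inter> W))" using openin_open_trans[OF _ c(2)] by blast
qed

text \<open>A trivialization maps its part of \<open>L\<close> bijectively onto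
  \<open>fst t \<times> UNIV\<close>. The points singled out by \<open>THE\<close> in
  \<open>fibre_scale\<close> rest on this.\<close>

lemma triv_facts:
  assumes "t \<in> T"
  shows "openin M (fst t)" and "q \<in> fst t \<Longrightarrow> \<exists>!s. s \<in> topspace L \<and> p s = q \<and> snd t s = w"
proof -
  have t: "openin M (fst t)" "homeomorphic_map (subtopology L (over L p (fst t)))
          (prod_topology (subtopology M (fst t)) euclidean) (\<lambda>x. (p x, snd t x))"
    using line assms unfolding line_bundle_def by blast+
  show "openin M (fst t)" by (rule t(1))
  assume q: "q \<in> fst t"
  have o: "topspace (subtopology L (over L p (fst t))) = over L p (fst t)"
    by (auto simp: over_def)
  have b: "topspace (prod_topology (subtopology M (fst t)) euclidean) = fst t \<times> (UNIV :: complex set)"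
    using openin_subset[OF t(1)] by auto
  have h: "(\<lambda>x. (p x, snd t x)) ` over L p (fst t) = fst t \<times> UNIV" "inj_on (\<lambda>x. (p x, snd t x)) (over L p (fst t))"
    using t(2) unfolding homeomorphic_eq_everything_map o b by blast+
  have "(q, w) \<in> (\<lambda>x. (p x, snd t x)) ` over L p (fst t)" using h(1) q by simp
  then obtain s where s: "s \<in> over L p (fst t)" "p s = q" "snd t s = w" by auto
  show "\<exists>!s. s \<in> topspace L \<and> p s = q \<and> snd t s = w"
  proof (rule ex1I[of _ s])
    show "s \<in> topspace L \<and> p s = q \<and> snd t s = w" using s by (simp add: over_def)
    fix s' assume s': "s' \<in> topspace L \<and> p s' = q \<and> snd t s' = w"
    then have "s' \<in> over L p (fst t)" using q by (simp add: over_def)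
    then show "s' = s" using inj_onD[OF h(2), of s' s] s s' by simp
  qed
qed

lemma triv_unique:
  "t \<in> T \<Longrightarrow> p x \<in> fst t \<Longrightarrow> x \<in> topspace L \<Longrightarrow> y \<in> topspace L \<Longrightarrow> p x = p y \<Longrightarrow> snd t x = snd t y \<Longrightarrow> x = y"
  using triv_facts(2)[of t "p x" "snd t x"] by metis

lemma triv_change:
  assumes "t \<in> T" "t' \<in> T"
  shows "\<exists>k. (\<forall>c\<in>A. holomorphic_in c (fst t \<inter> fst t') k) \<and>
      (\<forall>q\<in>fst t \<inter> fst t'. k q \<noteq> 0) \<and>
      (\<forall>x\<in>over L p (fst t \<inter> fst t'). snd t' x = k (p x) * snd t x)"
proof -
  have "\<forall>t\<in>T. \<forall>t'\<in>T. \<exists>k. (\<forall>c\<in>A. holomorphic_in c (fst t \<inter> fst t') k) \<and>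
      (\<forall>q\<in>fst t \<inter> fst t'. k q \<noteq> 0) \<and>
      (\<forall>x\<in>over L p (fst t \<inter> fst t'). snd t' x = k (p x) * snd t x)"
    using line unfolding line_bundle_def by (elim conjE) assumption
  from bspec[OF bspec[OF this assms(1)] assms(2)] show ?thesis .
qed

lemma p_in: "x \<in> topspace L \<Longrightarrow> p x \<in> topspace M"
  using line unfolding line_bundle_def by (meson continuous_map_image_subset_topspace image_subset_iff)

lemma around_chart: "q \<in> topspace M \<Longrightarrow> around A q \<in> A \<and> q \<in> fst (around A q)"
  using manifold unfolding complex_manifold_def by (intro around_in) blast

lemma around_triv: "q \<in> topspace M \<Longrightarrow> around T q \<in> T \<and> q \<in> fst (around T q)"
  using line unfolding line_bundle_def by (intro around_in) blast

lemma norm_eq: "t \<in> T \<Longrightarrow> x \<in> topspace L \<Longrightarrow> p x \<in> fst t \<Longrightarrow> r x = (cmod (snd t x))\<^sup>2 * h t (p x)"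
  using hermitian unfolding hermitian_structure_def over_def by blast

lemma h_pos: "t \<in> T \<Longrightarrow> q \<in> fst t \<Longrightarrow> 0 < h t q"
  using hermitian unfolding hermitian_structure_def by blast

lemma smooth_ln_h:
  assumes t: "t \<in> T" and c: "c \<in> A"
  shows "smooth_on (\<lambda>z. ln (h t (chart_inv c z))) (snd c ` (fst c \<inter> fst t))"
proof -
  note op = chart_facts(3)[OF c triv_facts(1)[OF t]]
  have "smooth_on (\<lambda>z. complex_of_real (h t (chart_inv c z))) (snd c ` (fst c \<inter> fst t))"
    using hermitian t c unfolding hermitian_structure_def smooth_in_def o_def by blast
  from smooth_on_bounded_linear_compose[OF bounded_linear_Re op this]
  have "smooth_on (\<lambda>z. h t (chart_inv c z)) (snd c ` (fst c \<inter> fst t))" by simp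
  then show ?thesis
    by (rule smooth_on_ln[OF op]) (use chart_inv_image[OF chart_facts(1)[OF c]] h_pos[OF t] in blast)
qed

text \<open>The definition uses whichever trivialization is chosen at \<open>q\<close>. Another one
  changes the local norm function by the squared modulus of a holomorphic transition function,
  invisible to \<open>ddbar\<close> of the logarithm.\<close>

lemma curvature_eq:
  assumes t: "t \<in> T" and c: "c \<in> A" and q: "q \<in> fst c \<inter> fst t"
  shows "\<gamma> c q = - ddbar (\<lambda>y. ln (h t y)) c q"
proof -
  have qM: "q \<in> topspace M" using openin_subset[OF chart_facts(2)[OF c]] q by auto
  define t' where "t' = around T q"
  have t': "t' \<in> T" "q \<in> fst t'" using around_triv[OF qM] by (simp_all add: t'_def)
  let ?W = "fst t \<inter> fst t'"
  have op: "open (snd c ` (fst c \<inter> ?W))"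
    by (rule chart_facts(3)[OF c openin_Int[OF triv_facts(1)[OF t] triv_facts(1)[OF t'(1)]]])
  obtain k where k: "(\<forall>c\<in>A. holomorphic_in c ?W k) \<and> (\<forall>q\<in>?W. k q \<noteq> 0) \<and>
      (\<forall>x\<in>over L p ?W. snd t' x = k (p x) * snd t x)"
    using triv_change[OF t t'(1)] by (rule exE)
  then have k: "holomorphic_in c ?W k" "\<And>q. q \<in> ?W \<Longrightarrow> k q \<noteq> 0"
    "\<And>x. x \<in> over L p ?W \<Longrightarrow> snd t' x = k (p x) * snd t x"
    using c by blast+
  \<comment> \<open>Both sides express the norm of the point over \<open>y\<close> whose fibre
    coordinate in \<open>t\<close> is \<open>1\<close>.\<close>
  have hh: "h t y = (cmod (k y))\<^sup>2 * h t' y" if y: "y \<in> ?W" for y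
  proof -
    obtain s where s: "s \<in> topspace L" "p s = y" "snd t s = 1"
      using triv_facts(2)[OF t, of y 1] y by blast
    have "r s = h t y" using norm_eq[OF t s(1)] s y by simp
    moreover have "snd t' s = k y" using k(3)[of s] s y by (simp add: over_def)
    then have "r s = (cmod (k y))\<^sup>2 * h t' y" using norm_eq[OF t'(1) s(1)] s y by simp
    ultimately show ?thesis by simp
  qed
  note gc = chart_facts(1)[OF c]
  have z: "snd c q \<in> snd c ` (fst c \<inter> ?W)" using q t' by auto
  have "ddbar (\<lambda>y. ln (h t y)) c q = ddbar (\<lambda>y. ln (h t' y)) c q"
    unfolding vec_eq_iff
  proof (intro allI)
    fix i j
    have qc: "q \<in> fst c" using q by simp
    show "ddbar (\<lambda>y. ln (h t y)) c q $ i $ j = ddbar (\<lambda>y. ln (h t' y)) c q $ i $ j"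
      unfolding ddbar_eq[OF gc qc]
    proof (rule wd_wdb_ln_cmod_sq_add[OF op z holomorphic_in_holo[OF gc k(1)]])
      fix x assume "x \<in> snd c ` (fst c \<inter> ?W)"
      then have x: "chart_inv c x \<in> ?W" using chart_inv_image[OF gc] by blast
      show "k (chart_inv c x) \<noteq> 0" by (rule k(2)[OF x])
      show "ln (h t (chart_inv c x)) = ln ((cmod (k (chart_inv c x)))\<^sup>2) + ln (h t' (chart_inv c x))"
      proof -
        have "0 < h t' (chart_inv c x)" using x by (intro h_pos[OF t'(1)]) simp
        then show ?thesis using k(2)[OF x] by (simp add: hh[OF x] ln_mult)
      qed
    next
      have "smooth_on (\<lambda>z. ln (h t' (chart_inv c z))) (snd c ` (fst c \<inter> ?W))"
        by (rule smooth_on_subset[OF smooth_ln_h[OF t'(1) c]]) auto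
      then show "smooth_on (\<lambda>z. complex_of_real (ln (h t' (chart_inv c z)))) (snd c ` (fst c \<inter> ?W))"
        by (rule smooth_on_bounded_linear_compose[OF bounded_linear_of_real op])
    qed
  qed
  then show ?thesis by (simp add: curvature_form_def t'_def)
qed

text \<open>The chosen trivialization may jump from point to point; with \<open>t\<close> fixed by
  \<open>curvature_eq\<close> there is a single formula on the whole open set.\<close>

lemma smooth_curvature:
  assumes t: "t \<in> T" and c: "c \<in> A"
  shows "smooth_on (\<lambda>z. \<gamma> c (chart_inv c z) $ i $ j) (snd c ` (fst c \<inter> fst t))"
proof -
  let ?S = "snd c ` (fst c \<inter> fst t)" and ?H = "\<lambda>z. complex_of_real (ln (h t (chart_inv c z)))"
  note op = chart_facts(3)[OF c triv_facts(1)[OF t]] and gc = chart_facts(1)[OF c]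
  have "smooth_on ?H ?S" by (rule smooth_on_bounded_linear_compose[OF bounded_linear_of_real op smooth_ln_h[OF t c]])
  then have "smooth_on (\<lambda>z. - wd i (wdb j ?H) z) ?S"
    by (intro smooth_on_bounded_linear_compose[OF bounded_linear_minus[OF bounded_linear_ident] op] smooth_on_wd op)
  then show ?thesis
  proof (rule smooth_on_cong[OF op, rotated])
    fix z assume z: "z \<in> ?S"
    have q: "chart_inv c z \<in> fst c \<inter> fst t" by (rule chart_inv_image[OF gc z])
    have "snd c (chart_inv c z) = z" using z by (intro chart_inv_right) auto
    then show "- wd i (wdb j ?H) z = \<gamma> c (chart_inv c z) $ i $ j"
      using q by (simp add: curvature_eq[OF t c q] ddbar_eq[OF gc])
  qed
qed

lemma smooth_kahler:
  assumes c: "c \<in> A"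
  shows "smooth_on (\<lambda>z. kahler_form g c (chart_inv c z) $ i $ j) (snd c ` fst c)"
proof -
  have op: "open (snd c ` fst c)" using chart_facts(1)[OF c] by (simp add: good_chart_def)
  have "smooth_on (\<lambda>z. g c (chart_inv c z) $ i $ j) (snd c ` fst c)"
    using kahler c unfolding kahler_metric_def smooth_in_def o_def by simp
  from smooth_on_bounded_linear_compose[OF bounded_linear_divide op this]
  show ?thesis by (simp add: kahler_form_def)
qed

lemma base_form_nth: "\<omega> s c q $ i $ j = kahler_form g c q $ i $ j - of_real s * \<gamma> c q $ i $ j"
  by (simp add: base_form_def) (simp add: scaleR_conv_of_real)

lemma smooth_base_form:
  assumes t: "t \<in> T" and c: "c \<in> A"
  shows "smooth_on (\<lambda>z. \<omega> s c (chart_inv c z) $ i $ j) (snd c ` (fst c \<inter> fst t))"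
proof -
  note op = chart_facts(3)[OF c triv_facts(1)[OF t]]
  have "smooth_on (\<lambda>z. kahler_form g c (chart_inv c z) $ i $ j) (snd c ` (fst c \<inter> fst t))"
    by (rule smooth_on_subset[OF smooth_kahler[OF c]]) auto
  then show ?thesis unfolding base_form_nth
    by (intro smooth_on_diff smooth_on_mult smooth_on_const smooth_curvature t c op)
qed

lemma base_form_positive: "s \<in> I \<Longrightarrow> c \<in> A \<Longrightarrow> q \<in> fst c \<Longrightarrow> positive_hermitian (\<omega> s c q)"
  using positive[of s] unfolding positive_form_def positive_hermitian_def by blast

lemma kahler_form_positive:
  assumes "c \<in> A" "q \<in> fst c"
  shows "positive_hermitian (kahler_form g c q)"
proof -
  have g: "\<And>i j. g c q $ j $ i = cnj (g c q $ i $ j)"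
    "\<And>v. v \<noteq> 0 \<Longrightarrow> 0 < Re (\<Sum>i\<in>UNIV. \<Sum>j\<in>UNIV. g c q $ i $ j * v $ i * cnj (v $ j))"
    using kahler assms unfolding kahler_metric_def positive_form_def by blast+
  have e: "(\<Sum>i\<in>UNIV. \<Sum>j\<in>UNIV. kahler_form g c q $ i $ j * v $ i * cnj (v $ j)) =
     (\<Sum>i\<in>UNIV. \<Sum>j\<in>UNIV. g c q $ i $ j * v $ i * cnj (v $ j)) / 2" for v
    by (simp add: kahler_form_def sum_divide_distrib)
  show ?thesis unfolding positive_hermitian_def
  proof (intro conjI allI impI)
    show "kahler_form g c q $ j $ i = cnj (kahler_form g c q $ i $ j)" for i j
      using g(1)[of j i] by (simp add: kahler_form_def)
    show "0 < Re (\<Sum>i\<in>UNIV. \<Sum>j\<in>UNIV. kahler_form g c q $ i $ j * v $ i * cnj (v $ j))" if "v \<noteq> 0" for v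
      unfolding e using g(2)[OF that] by simp
  qed
qed

lemma transition_holo:
  assumes c: "c \<in> A" "c' \<in> A"
  shows "holo (\<lambda>z. snd c' (chart_inv c z) $ k) (snd c ` (fst c \<inter> fst c'))"
  using holomorphic_in_holo[OF chart_facts(1)[OF c(1)]] manifold c unfolding complex_manifold_def by blast

lemma kahler_form_change:
  assumes c: "c \<in> A" "c' \<in> A" and q: "q \<in> fst c \<inter> fst c'"
  shows "kahler_form g c q = form_pullback (jacobian c c' q) (kahler_form g c' q)"
proof -
  have "g c q = form_pullback (jacobian c c' q) (g c' q)"
    using kahler c q unfolding kahler_metric_def pullback_via_id[symmetric] by blast
  then show ?thesis
    by (simp add: kahler_form_def form_pullback_def sum_divide_distrib vec_eq_iff)
qed

text \<open>By the transformation law of the Kaehler form, a singular Jacobian would force the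
  determinant of a positive form to vanish.\<close>

lemma det_jacobian_nz:
  assumes c: "c \<in> A" "c' \<in> A" and q: "q \<in> fst c \<inter> fst c'"
  shows "det (jacobian c c' q) \<noteq> 0"
  using positive_hermitian_det_nz[OF kahler_form_positive[OF c(1), of q]] q
  by (auto simp: kahler_form_change[OF c q] det_form_pullback)

lemma curvature_change:
  assumes c: "c \<in> A" "c' \<in> A" and q: "q \<in> fst c \<inter> fst c'"
  shows "\<gamma> c q = form_pullback (jacobian c c' q) (\<gamma> c' q)"
proof -
  have qM: "q \<in> topspace M" using openin_subset[OF chart_facts(2)[OF c(1)]] q by auto
  obtain t where t: "t \<in> T" "q \<in> fst t" using around_triv[OF qM] by blast
  let ?W = "fst t"
  have op: "open (snd c ` (fst c \<inter> (fst c' \<inter> ?W)))" "open (snd c' ` (fst c' \<inter> (fst c \<inter> ?W)))"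
    by (intro chart_facts(3) c openin_Int chart_facts(2) triv_facts(1) t)+
  have "ddbar (\<lambda>y. ln (h t y)) c q = form_pullback (jacobian c c' q) (ddbar (\<lambda>y. ln (h t y)) c' q)"
  proof (rule ddbar_change[OF chart_facts(1)[OF c(1)] chart_facts(1)[OF c(2)] _ op])
    show "q \<in> fst c \<inter> (fst c' \<inter> ?W)" using q t by auto
    show "holo (\<lambda>z. snd c' (chart_inv c z) $ k) (snd c ` (fst c \<inter> (fst c' \<inter> ?W)))" for k
      by (rule holo_subset[OF transition_holo[OF c]]) auto
    have "smooth_on (\<lambda>z. ln (h t (chart_inv c' z))) (snd c' ` (fst c' \<inter> (fst c \<inter> ?W)))"
      by (rule smooth_on_subset[OF smooth_ln_h[OF t(1) c(2)]]) auto
    then show "smooth_on (\<lambda>z. complex_of_real (ln (h t (chart_inv c' z)))) (snd c' ` (fst c' \<inter> (fst c \<inter> ?W)))"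
      by (rule smooth_on_bounded_linear_compose[OF bounded_linear_of_real op(2)])
  qed
  then show ?thesis using q t
    by (simp add: curvature_eq[OF t(1) c(1)] curvature_eq[OF t(1) c(2)] form_pullback_def vec_eq_iff sum_negf)
qed

lemma base_form_change:
  assumes c: "c \<in> A" "c' \<in> A" and q: "q \<in> fst c \<inter> fst c'"
  shows "\<omega> s c q = form_pullback (jacobian c c' q) (\<omega> s c' q)"
  unfolding vec_eq_iff
proof (intro allI)
  fix i j
  show "\<omega> s c q $ i $ j = form_pullback (jacobian c c' q) (\<omega> s c' q) $ i $ j"
    unfolding base_form_nth kahler_form_change[OF c q] curvature_change[OF c q]
    by (simp add: form_pullback_def base_form_nth left_diff_distrib sum_subtractf sum_distrib_left mult.assoc)
qed

text \<open>Passing from form to metric multiplies the determinant by \<open>2 ^ CARD('m)\<close>,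
  the squared modulus of a constant.\<close>

lemma ricci_base_form:
  assumes s: "s \<in> I" and c: "c \<in> A" and t: "t \<in> T" and q: "q \<in> fst c \<inter> fst t"
  shows "ricci_form (metric_of_form (\<omega> s)) c q = - ddbar (\<lambda>y. ln (Re (det (\<omega> s c y)))) c q"
    and "smooth_on (\<lambda>z. ln (Re (det (\<omega> s c (chart_inv c z))))) (snd c ` (fst c \<inter> fst t))"
proof -
  note op = chart_facts(3)[OF c triv_facts(1)[OF t]] and gc = chart_facts(1)[OF c]
  let ?S = "snd c ` (fst c \<inter> fst t)"
  have pos: "0 < Re (det (\<omega> s c y))" if "y \<in> fst c" for y
    by (rule positive_hermitian_det(2)[OF base_form_positive[OF s c that]])
  have "smooth_on (\<lambda>z. Re (det (\<omega> s c (chart_inv c z)))) ?S"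
    by (intro smooth_on_bounded_linear_compose[OF bounded_linear_Re op] smooth_on_det op smooth_base_form t c)
  then show sm: "smooth_on (\<lambda>z. ln (Re (det (\<omega> s c (chart_inv c z))))) ?S"
    by (rule smooth_on_ln[OF op]) (use chart_inv_image[OF gc] pos in blast)
  then have sm: "smooth_on (\<lambda>z. complex_of_real (ln (Re (det (\<omega> s c (chart_inv c z)))))) ?S"
    by (rule smooth_on_bounded_linear_compose[OF bounded_linear_of_real op])
  let ?n = "2 ^ CARD('m) :: real"
  have d: "det (metric_of_form (\<omega> s) c y) = of_real ?n * det (\<omega> s c y)" for y
    by (simp add: metric_of_form_def det_cmult)
  have "ddbar (\<lambda>y. ln (Re (det (metric_of_form (\<omega> s) c y)))) c q = ddbar (\<lambda>y. ln (Re (det (\<omega> s c y)))) c q"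
    unfolding vec_eq_iff
  proof (intro allI)
    fix i j
    have qc: "q \<in> fst c" and z: "snd c q \<in> ?S" using q by auto
    show "ddbar (\<lambda>y. ln (Re (det (metric_of_form (\<omega> s) c y)))) c q $ i $ j = ddbar (\<lambda>y. ln (Re (det (\<omega> s c y)))) c q $ i $ j"
      unfolding ddbar_eq[OF gc qc]
    proof (rule wd_wdb_ln_cmod_sq_add[OF op z holo_const[OF op] _ sm])
      show "complex_of_real (sqrt ?n) \<noteq> 0" by simp
      fix x assume "x \<in> ?S"
      then have "0 < Re (det (\<omega> s c (chart_inv c x)))" using chart_inv_image[OF gc] pos by blast
      then show "ln (Re (det (metric_of_form (\<omega> s) c (chart_inv c x)))) =
        ln ((cmod (complex_of_real (sqrt ?n)))\<^sup>2) + ln (Re (det (\<omega> s c (chart_inv c x))))"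
        by (simp add: d ln_mult del: of_real_power)
    qed
  qed
  then show "ricci_form (metric_of_form (\<omega> s)) c q = - ddbar (\<lambda>y. ln (Re (det (\<omega> s c y)))) c q"
    by (simp add: ricci_form_def)
qed

lemma kahler_form_metric_of_form: "kahler_form (metric_of_form w) = w"
  by (simp add: kahler_form_def metric_of_form_def fun_eq_iff vec_eq_iff)

lemma ricci_change:
  assumes s: "s \<in> I" and c: "c \<in> A" "c' \<in> A" and q: "q \<in> fst c \<inter> fst c'"
  shows "ricci_form (metric_of_form (\<omega> s)) c q =
    form_pullback (jacobian c c' q) (ricci_form (metric_of_form (\<omega> s)) c' q)"
proof -
  have qM: "q \<in> topspace M" using openin_subset[OF chart_facts(2)[OF c(1)]] q by auto
  obtain t where t: "t \<in> T" "q \<in> fst t" using around_triv[OF qM] by blast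
  let ?W = "fst t"
  let ?S = "snd c ` (fst c \<inter> (fst c' \<inter> ?W))" and ?S' = "snd c' ` (fst c' \<inter> (fst c \<inter> ?W))"
  let ?u = "\<lambda>y. ln (Re (det (\<omega> s c y)))" and ?u' = "\<lambda>y. ln (Re (det (\<omega> s c' y)))"
  have op: "open ?S" "open ?S'"
    by (intro chart_facts(3) c openin_Int chart_facts(2) triv_facts(1) t)+
  note gc = chart_facts(1)[OF c(1)] and gc' = chart_facts(1)[OF c(2)]
  have q': "q \<in> fst c \<inter> (fst c' \<inter> ?W)" and qc: "q \<in> fst c" using q t by auto
  have hol: "holo (\<lambda>z. snd c' (chart_inv c z) $ k) ?S" for k
    by (rule holo_subset[OF transition_holo[OF c]]) auto
  let ?J = "\<lambda>z. det (\<chi> k i. wd i (\<lambda>z. snd c' (chart_inv c z) $ k) z)"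
  have J: "det (jacobian c c' (chart_inv c z)) = ?J z" if "z \<in> ?S" for z
  proof -
    have "snd c (chart_inv c z) = z" using that by (intro chart_inv_right) auto
    then show ?thesis by (simp add: jacobian_def dz_eq)
  qed
  \<comment> \<open>Both are taken in the chart \<open>c\<close>: the determinants of the two
    component matrices differ by the squared modulus of the holomorphic Jacobian
    determinant.\<close>
  have "ddbar ?u c q = ddbar ?u' c q"
    unfolding vec_eq_iff
  proof (intro allI)
    fix i j
    show "ddbar ?u c q $ i $ j = ddbar ?u' c q $ i $ j"
      unfolding ddbar_eq[OF gc qc]
    proof (rule wd_wdb_ln_cmod_sq_add[OF op(1)])
      show "snd c q \<in> ?S" using q' by auto
      show "holo ?J ?S" by (rule holo_det[OF op(1)]) (simp add: holo_wd[OF op(1) hol])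
      fix z assume z: "z \<in> ?S"
      have x: "chart_inv c z \<in> fst c \<inter> (fst c' \<inter> ?W)" by (rule chart_inv_image[OF gc z])
      then have x': "chart_inv c z \<in> fst c \<inter> fst c'" by auto
      show nz: "?J z \<noteq> 0" using det_jacobian_nz[OF c x'] unfolding J[OF z] .
      have pos: "0 < Re (det (\<omega> s c' (chart_inv c z)))"
        using x' by (intro positive_hermitian_det(2)[OF base_form_positive[OF s c(2)]]) auto
      have e: "Re (det (\<omega> s c (chart_inv c z))) = (cmod (?J z))\<^sup>2 * Re (det (\<omega> s c' (chart_inv c z)))"
        by (simp add: base_form_change[OF c x'] det_form_pullback J[OF z] del: of_real_power)
      have "0 < (cmod (?J z))\<^sup>2" 
        by (rule zero_less_power[OF zero_less_norm_iff[THEN iffD2, OF nz]])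
      from ln_mult_pos[OF this pos] show "?u (chart_inv c z) = ln ((cmod (?J z))\<^sup>2) + ?u' (chart_inv c z)"
        unfolding e .
    next
      have F: "snd c' (chart_inv c z) \<in> ?S'" if "z \<in> ?S" for z
        using chart_inv_image[OF gc that] by blast
      have sF: "smooth_on (\<lambda>z. snd c' (chart_inv c z)) ?S"
        by (rule smooth_on_vec[OF op(1)]) (use hol in \<open>simp add: holo_def\<close>)
      \<comment> \<open>Smoothness of \<open>?u'\<close> is known in the coordinates of
        \<open>c'\<close>; composing with the transition map carries it over to those of
        \<open>c\<close>.\<close>
      have "smooth_on (\<lambda>z. ?u' (chart_inv c' (snd c' (chart_inv c z)))) ?S"
      proof (rule smooth_on_compose[OF op _ sF])
        show "(\<lambda>z. snd c' (chart_inv c z)) ` ?S \<subseteq> ?S'" using F by blast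
        show "smooth_on (\<lambda>z. ?u' (chart_inv c' z)) ?S'"
          by (rule smooth_on_subset[OF ricci_base_form(2)[OF s c(2) t(1)]]) (use q t in auto)
      qed
      then have "smooth_on (\<lambda>z. ?u' (chart_inv c z)) ?S"
      proof (rule smooth_on_cong[OF op(1), rotated])
        fix z assume "z \<in> ?S"
        then have "chart_inv c z \<in> fst c'" using chart_inv_image[OF gc] by blast
        then show "?u' (chart_inv c' (snd c' (chart_inv c z))) = ?u' (chart_inv c z)"
          by (simp add: chart_inv_left[OF gc'])
      qed
      then show "smooth_on (\<lambda>z. complex_of_real (?u' (chart_inv c z))) ?S"
        by (rule smooth_on_bounded_linear_compose[OF bounded_linear_of_real op(1)])
    qed
  qed
  \<comment> \<open>Now the function is fixed and the chart changes.\<close>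
  also have "\<dots> = form_pullback (jacobian c c' q) (ddbar ?u' c' q)"
  proof (rule ddbar_change[OF gc gc' q' op hol])
    have "smooth_on (\<lambda>z. ?u' (chart_inv c' z)) ?S'"
      by (rule smooth_on_subset[OF ricci_base_form(2)[OF s c(2) t(1)]]) (use q t in auto)
    then show "smooth_on (\<lambda>z. complex_of_real (?u' (chart_inv c' z))) ?S'"
      by (rule smooth_on_bounded_linear_compose[OF bounded_linear_of_real op(2)])
  qed
  finally have "ddbar ?u c q = form_pullback (jacobian c c' q) (ddbar ?u' c' q)" .
  then show ?thesis
    using ricci_base_form(1)[OF s c(1) t(1)] ricci_base_form(1)[OF s c(2) t(1)] q t
    by (simp add: form_pullback_def vec_eq_iff sum_negf)
qed

text \<open>Form and Ricci form transform by the same Jacobian, which drops out of the trace; so the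
  chosen chart may be replaced by \<open>c\<close>.\<close>

lemma scalar_curvature_chart:
  assumes s: "s \<in> I" and c: "c \<in> A" and q: "q \<in> fst c"
  shows "scalar_curvature A (metric_of_form (\<omega> s)) q =
    Re (trace (matrix_inv (\<omega> s c q) ** ricci_form (metric_of_form (\<omega> s)) c q))"
proof -
  have "q \<in> topspace M" using openin_subset[OF chart_facts(2)[OF c]] q by auto
  then have a: "around A q \<in> A" "q \<in> fst (around A q)" using around_chart by blast+
  then have q': "q \<in> fst (around A q) \<inter> fst c" using q by simp
  show ?thesis
    unfolding scalar_curvature_def Let_def kahler_form_metric_of_form
      base_form_change[OF a(1) c q'] ricci_change[OF s a(1) c q']
      trace_form_pullback[OF det_jacobian_nz[OF a(1) c q'] positive_hermitian_det_nz[OF base_form_positive[OF s c q]]] ..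
qed

text \<open>The squared modulus of the Jacobian determinant and the factorial from
  \<open>top_power_eq\<close> occur in numerator and denominator and cancel.\<close>

lemma volume_ratio_chart:
  assumes c: "c \<in> A" and q: "q \<in> fst c"
  shows "volume_ratio A (\<omega> s) (kahler_form g) q = Re (det (\<omega> s c q)) / Re (det (kahler_form g c q))"
proof -
  have "q \<in> topspace M" using openin_subset[OF chart_facts(2)[OF c]] q by auto
  then have a: "around A q \<in> A" "q \<in> fst (around A q)" using around_chart by blast+
  then have q': "q \<in> fst (around A q) \<inter> fst c" using q by simp
  \<comment> \<open>A real denominator lets \<open>Re\<close> pass to the numerator.\<close>
  have im: "det (kahler_form g c q) = of_real (Re (det (kahler_form g c q)))"
    using positive_hermitian_det(1)[OF kahler_form_positive[OF c q]] by (simp add: complex_eq_iff)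
  have "volume_ratio A (\<omega> s) (kahler_form g) q = Re (det (\<omega> s c q) / det (kahler_form g c q))"
    using det_jacobian_nz[OF a(1) c q']
    by (simp add: volume_ratio_def Let_def top_power_eq base_form_change[OF a(1) c q']
        kahler_form_change[OF a(1) c q'] det_form_pullback)
  also have "\<dots> = Re (det (\<omega> s c q)) / Re (det (kahler_form g c q))"
    by (subst im) (rule Re_divide_of_real)
  finally show ?thesis .
qed

end

section \<open>The total space of the bundle\<close>

text \<open>Transition functions act on the fibre coordinate by multiplication, so scaling in one
  trivialization is scaling in all of them; this gives the existence that \<open>THE\<close> asks
  for.\<close>

lemma (in horizontal) fibre_scale_props:
  assumes x: "x \<in> topspace L"
  shows "fibre_scale L p T z x \<in> topspace L" "p (fibre_scale L p T z x) = p x"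
    "\<And>t. t \<in> T \<Longrightarrow> p x \<in> fst t \<Longrightarrow> snd t (fibre_scale L p T z x) = z * snd t x"
proof -
  obtain t where t: "t \<in> T" "p x \<in> fst t" using around_triv[OF p_in[OF x]] by blast
  obtain s where s: "s \<in> topspace L" "p s = p x" "snd t s = z * snd t x"
    using triv_facts(2)[OF t(1), of "p x" "z * snd t x"] t(2) by blast
  let ?P = "\<lambda>y. y \<in> topspace L \<and> p y = p x \<and> (\<forall>t\<in>T. p x \<in> fst t \<longrightarrow> snd t y = z * snd t x)"
  have "?P s"
  proof (intro conjI ballI impI s(1,2))
    fix t' assume t': "t' \<in> T" "p x \<in> fst t'"
    obtain k where "\<forall>x\<in>over L p (fst t \<inter> fst t'). snd t' x = k (p x) * snd t x"
      using triv_change[OF t(1) t'(1)] by (elim exE conjE)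
    then show "snd t' s = z * snd t' x" using t t' s x by (simp add: over_def)
  qed
  moreover have "y = s" if "?P y" for y
    using that t s triv_unique[OF t(1), of y s] by auto
  ultimately have "?P (THE y. ?P y)" by (rule theI)
  then show "fibre_scale L p T z x \<in> topspace L" "p (fibre_scale L p T z x) = p x"
    "\<And>t. t \<in> T \<Longrightarrow> p x \<in> fst t \<Longrightarrow> snd t (fibre_scale L p T z x) = z * snd t x"
    unfolding fibre_scale_def by blast+
qed

definition total_chart :: "'b topology \<Rightarrow> ('b \<Rightarrow> 'a) \<Rightarrow> ('a, 'm::finite) chart \<Rightarrow> ('a, 'b) triv \<Rightarrow> ('b, 'm option) chart" where
  "total_chart L p c t = (over L p (fst c \<inter> fst t),
       \<lambda>x. \<chi> i. case i of None \<Rightarrow> snd t x | Some k \<Rightarrow> snd c (p x) $ k)"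

lemma total_atlas_eq: "total_atlas A L p T = {total_chart L p c t | c t. c \<in> A \<and> t \<in> T}"
  by (simp add: total_atlas_def total_chart_def)

lemma total_chart_coords:
  "fst (total_chart L p c t) = over L p (fst c \<inter> fst t)"
  "snd (total_chart L p c t) x $ None = snd t x" "base_coord (snd (total_chart L p c t) x) = snd c (p x)"
  by (simp_all add: total_chart_def vec_eq_iff)

lemma option_vec_eqI: "y $ None = y' $ None \<Longrightarrow> base_coord y = base_coord y' \<Longrightarrow> y = y'"
  unfolding vec_eq_iff by (metis base_coord_nth not_None_eq)

locale adapted = horizontal M A g L p T r I + momentum I \<phi> \<tau>0
  for M :: "'a topology" and A :: "('a, 'm::finite) chart set" and g L and p :: "'b \<Rightarrow> 'a" and T r I \<phi> \<tau>0

locale adapted_chart = adapted M A g L p T r I \<phi> \<tau>0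
  for M :: "'a topology" and A :: "('a, 'm::finite) chart set" and g L and p :: "'b \<Rightarrow> 'a" and T r I \<phi> \<tau>0 +
  fixes c :: "('a, 'm) chart" and t :: "('a, 'b) triv"
  assumes c: "c \<in> A" and t: "t \<in> T"
begin

abbreviation "C \<equiv> total_chart L p c t"
abbreviation "Z \<equiv> snd c ` (fst c \<inter> fst t)"
abbreviation "H \<equiv> \<lambda>z. ln (h t (chart_inv c z))"
definition fibre_log :: "complex ^ 'm option \<Rightarrow> real" where
  "fibre_log = (\<lambda>y. (ln ((cmod (y $ None))\<^sup>2) + H (base_coord y)) / 2)"
text \<open>Coordinate image of the part of the adapted domain above the chart: off the zero
  section, with the fibre logarithm in the open interval of times.\<close>

definition Y :: "(complex ^ 'm option) set" where
  "Y = {y. y $ None \<noteq> 0 \<and> base_coord y \<in> Z} \<inter> fibre_log -` times"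
abbreviation "fibre_log_c \<equiv> \<lambda>y. complex_of_real (fibre_log y)"
abbreviation "\<theta> y \<equiv> (\<lambda>i. 2 * wd i fibre_log_c y)"
abbreviation "g_\<phi> \<equiv> adapted_metric A g p r I \<phi> \<tau>0"
abbreviation "W \<equiv> kahler_form g_\<phi>"

lemmas gc = chart_facts(1)[OF c]
lemmas openZ = chart_facts(3)[OF c triv_facts(1)[OF t]]
lemmas smoothH = smooth_ln_h[OF t c]
lemmas fibre_log_facts = log_norm_derivatives[OF openZ smoothH fibre_log_def]

lemma openY: "open Y"
  unfolding Y_def
  by (rule continuous_open_preimage[OF smooth_on_imp_continuous_on[OF fibre_log_facts(2)] fibre_log_facts(1) open_times])

lemma Y_D: "y \<in> Y \<Longrightarrow> y $ None \<noteq> 0" "y \<in> Y \<Longrightarrow> base_coord y \<in> Z" "y \<in> Y \<Longrightarrow> fibre_log y \<in> times"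
  by (simp_all add: Y_def)

lemma smooth_fibre_log: "smooth_on fibre_log Y"
  by (rule smooth_on_subset[OF fibre_log_facts(2)]) (auto simp: Y_def)

lemma total_image: "snd C ` fst C = base_coord -` Z"
proof
  show "snd C ` fst C \<subseteq> base_coord -` Z"
    by (auto simp: total_chart_coords over_def)
  show "base_coord -` Z \<subseteq> snd C ` fst C"
  proof
    fix y assume "y \<in> base_coord -` Z"
    then obtain q where q: "q \<in> fst c \<inter> fst t" "base_coord y = snd c q" by auto
    obtain s where s: "s \<in> topspace L" "p s = q" "snd t s = y $ None"
      using triv_facts(2)[OF t, of q "y $ None"] q by blast
    have "snd C s = y" by (rule option_vec_eqI) (simp_all add: total_chart_coords s q)
    moreover have "s \<in> fst C" using s q by (simp add: total_chart_coords over_def)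
    ultimately show "y \<in> snd C ` fst C" by blast
  qed
qed

lemma good_total: "good_chart C"
proof -
  have "inj_on (snd C) (fst C)"
  proof (rule inj_onI)
    fix x y assume x: "x \<in> fst C" and y: "y \<in> fst C" and e: "snd C x = snd C y"
    have "snd c (p x) = snd c (p y)" using arg_cong[OF e, of base_coord] by (simp add: total_chart_coords)
    then have "p x = p y"
      using gc x y by (auto simp: good_chart_def total_chart_coords over_def dest: inj_onD)
    moreover have "snd t x = snd t y" using arg_cong[OF e, of "\<lambda>v. v $ None"] by (simp add: total_chart_coords)
    ultimately show "x = y" using triv_unique[OF t, of x y] x y by (simp add: total_chart_coords over_def)
  qed
  moreover have "open (base_coord -` Z)"
    by (intro open_vimage openZ linear_continuous_on bounded_linear_base_coord)
  ultimately show ?thesis by (simp add: good_chart_def total_image)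
qed

lemma total_inv:
  assumes "base_coord y \<in> Z"
  shows "chart_inv C y \<in> fst C" "chart_inv C y \<in> topspace L" "p (chart_inv C y) = chart_inv c (base_coord y)"
    "snd t (chart_inv C y) = y $ None" "snd C (chart_inv C y) = y"
proof -
  have y: "y \<in> snd C ` fst C" unfolding total_image using assms by simp
  note i = chart_inv_right[OF y]
  show "chart_inv C y \<in> fst C" "snd C (chart_inv C y) = y" by (rule i)+
  show L: "chart_inv C y \<in> topspace L" using i(2) by (simp add: total_chart_coords over_def)
  show "snd t (chart_inv C y) = y $ None" using total_chart_coords(2)[of L p c t "chart_inv C y"] i(1) by simp
  have "snd c (p (chart_inv C y)) = base_coord y" using total_chart_coords(3)[of L p c t "chart_inv C y"] i(1) by simp
  moreover have "p (chart_inv C y) \<in> fst c" using i(2) by (simp add: total_chart_coords over_def)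
  ultimately show "p (chart_inv C y) = chart_inv c (base_coord y)" using chart_inv_left[OF gc] by metis
qed

lemma log_norm_total:
  assumes "base_coord y \<in> Z" "y $ None \<noteq> 0"
  shows "log_norm r (chart_inv C y) = fibre_log y"
proof -
  have q: "chart_inv c (base_coord y) \<in> fst t" using chart_inv_image[OF gc assms(1)] by blast
  have "r (chart_inv C y) = (cmod (y $ None))\<^sup>2 * h t (chart_inv c (base_coord y))"
    using norm_eq[OF t total_inv(2)[OF assms(1)]] q by (simp add: total_inv[OF assms(1)])
  then show ?thesis using assms(2) h_pos[OF t q] by (simp add: log_norm_def fibre_log_def ln_mult)
qed

text \<open>\<open>pullback\<close> computes with the chart chosen at \<open>p x\<close>; the
  transformation law of the Kaehler form brings the result back to \<open>c\<close>.\<close>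

lemma adapted_pullback:
  assumes x: "x \<in> fst C"
  shows "pullback A p (kahler_form g) C x $ i $ j = on_some i (\<lambda>a. on_some j (\<lambda>b. kahler_form g c (p x) $ a $ b))"
proof -
  have px: "p x \<in> fst c" "p x \<in> fst t" "x \<in> topspace L" using x by (simp_all add: total_chart_coords over_def)
  define c' where "c' = around A (p x)"
  have c': "c' \<in> A" "p x \<in> fst c'" using around_chart[OF p_in[OF px(3)]] by (simp_all add: c'_def)
  have pp: "p x \<in> fst c \<inter> fst c'" using px c' by simp
  have D: "dz C i (\<lambda>y. snd c' (p y) $ k) x = on_some i (\<lambda>a. jacobian c c' (p x) $ k $ a)" for i k
  proof -
    let ?F = "\<lambda>z. snd c' (chart_inv c z) $ k"
    have O: "open (base_coord -` Z)" "snd C x \<in> base_coord -` Z"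
      using good_total x unfolding total_image[symmetric] good_chart_def by auto
    have "dz C i (\<lambda>y. snd c' (p y) $ k) x = wd i (\<lambda>y. ?F (base_coord y)) (snd C x)"
      unfolding dz_eq by (rule wd_cong(1)[OF O]) (simp add: total_inv)
    also have "\<dots> = on_some i (\<lambda>a. wd a ?F (base_coord (snd C x)))"
    proof (rule wd_base_compose)
      have "holo ?F (snd c ` (fst c \<inter> fst c'))" by (rule transition_holo[OF c c'(1)])
      then have "smooth_on ?F (snd c ` (fst c \<inter> fst c'))" by (simp add: holo_def)
      then show "?F differentiable (at (base_coord (snd C x)))"
        by (rule smooth_on_differentiable) (use pp in \<open>simp add: total_chart_coords\<close>)
    qed
    finally show ?thesis by (simp add: total_chart_coords jacobian_def dz_eq)
  qed
  have "pullback A p (kahler_form g) C x $ i $ j = (\<Sum>k\<in>UNIV. \<Sum>l\<in>UNIV. kahler_form g c' (p x) $ k $ l *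
      on_some i (\<lambda>a. jacobian c c' (p x) $ k $ a) * cnj (on_some j (\<lambda>b. jacobian c c' (p x) $ l $ b)))"
    by (simp add: pullback_def pullback_via_def D c'_def[symmetric])
  also have "\<dots> = on_some i (\<lambda>a. on_some j (\<lambda>b. kahler_form g c (p x) $ a $ b))"
    unfolding kahler_form_change[OF c c'(1) pp]
    by (cases i; cases j; simp add: form_pullback_def)
  finally show ?thesis .
qed

lemma hessian_H:
  assumes "q \<in> fst c \<inter> fst t"
  shows "wd a (wdb b (\<lambda>z. complex_of_real (H z))) (snd c q) = - \<gamma> c q $ a $ b"
proof -
  have "q \<in> fst c" using assms by simp
  then show ?thesis by (simp add: curvature_eq[OF t c assms] ddbar_eq[OF gc])
qed

lemma hessian_fibre_log:
  assumes "x \<in> fst C" "snd C x \<in> Y"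
  shows "wd i (wdb j fibre_log_c) (snd C x) = on_some i (\<lambda>a. on_some j (\<lambda>b. - \<gamma> c (p x) $ a $ b / 2))"
proof -
  have q: "p x \<in> fst c \<inter> fst t" using assms(1) by (simp add: total_chart_coords over_def)
  have y: "snd C x \<in> {y. y $ None \<noteq> 0 \<and> base_coord y \<in> Z}" using assms(2) by (simp add: Y_def)
  show ?thesis
    using fibre_log_facts(4)[OF y, of i j] by (simp add: total_chart_coords hessian_H[OF q])
qed

text \<open>In \<open>2 ddbar f\<close>, the term
  \<open>2 \<phi> \<partial>t \<partial>bar t\<close> becomes \<open>\<phi>/2\<close> in the frame
  of the doubled \<open>\<partial>t\<close>, and \<open>2 \<mu> ddbar t = - \<mu> \<gamma>\<close>
  completes the pulled-back Kaehler form to the base form at \<open>\<mu>\<close>.\<close>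

lemma adapted_form:
  assumes x: "x \<in> fst C" "snd C x \<in> Y"
  defines "s \<equiv> fibre_log (snd C x)"
  shows "W C x = form_pullback (coframe (\<theta> (snd C x)))
     (block_matrix (of_real (\<phi> (\<mu> s) / 2)) (\<lambda>_. 0) (\<lambda>_. 0) (\<omega> (\<mu> s) c (p x)))"
  unfolding vec_eq_iff
proof (intro allI)
  fix i j
  let ?y = "snd C x" and ?f = "potential I \<phi> \<tau>0"
  have s: "s \<in> times" using Y_D(3)[OF x(2)] by (simp add: s_def)
  have "ddbar (\<lambda>y. ?f (log_norm r y)) C x $ i $ j = wd i (wdb j (\<lambda>y. complex_of_real (?f (log_norm r (chart_inv C y))))) ?y"
    by (rule ddbar_eq[OF good_total x(1)])
  also have "\<dots> = wd i (wdb j (\<lambda>y. complex_of_real (?f (fibre_log y)))) ?y"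
    by (rule wd_wdb_cong[OF openY x(2)]) (simp add: log_norm_total Y_D)
  also have "\<dots> = of_real (\<phi> (\<mu> s)) * wd i fibre_log_c ?y * cnj (wd j fibre_log_c ?y) + of_real (\<mu> s) * wd i (wdb j fibre_log_c) ?y"
    unfolding s_def
    by (rule wd_wdb_real_compose[OF openY x(2) open_times _ smooth_fibre_log potential_derivative smooth_moment
        moment_derivative[OF s, unfolded s_def]]) (auto dest: Y_D(3))
  finally have dd: "ddbar (\<lambda>y. ?f (log_norm r y)) C x $ i $ j = \<dots>" .
  have "W C x $ i $ j = pullback A p (kahler_form g) C x $ i $ j + 2 * ddbar (\<lambda>y. ?f (log_norm r y)) C x $ i $ j"
    by (simp add: adapted_metric_def kahler_form_metric_of_form scaleR_2)
  also have "\<dots> = form_pullback (coframe (\<theta> ?y)) (block_matrix (of_real (\<phi> (\<mu> s) / 2)) (\<lambda>_. 0) (\<lambda>_. 0) (\<omega> (\<mu> s) c (p x))) $ i $ j"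
    unfolding form_pullback_coframe adapted_pullback[OF x(1)] dd hessian_fibre_log[OF x]
    by (cases i; cases j) (simp_all add: base_form_nth field_simps)
  finally show "W C x $ i $ j = form_pullback (coframe (\<theta> ?y)) (block_matrix (of_real (\<phi> (\<mu> s) / 2)) (\<lambda>_. 0) (\<lambda>_. 0) (\<omega> (\<mu> s) c (p x))) $ i $ j" .
qed

text \<open>The doubling of the form in dimension \<open>m + 1\<close> gives
  \<open>2 ^ (m + 1)\<close>, one factor of which is absorbed by \<open>\<phi>/2\<close>; the
  determinant of the coframe is \<open>1/w\<close>.\<close>

lemma det_adapted:
  assumes x: "x \<in> fst C" "snd C x \<in> Y"
  defines "s \<equiv> fibre_log (snd C x)"
  shows "Re (det (g_\<phi> C x)) =
    2 ^ CARD('m) * (cmod (inverse (snd C x $ None)))\<^sup>2 * (\<phi> (\<mu> s) * Re (det (\<omega> (\<mu> s) c (p x))))"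
proof -
  let ?y = "snd C x"
  have n: "CARD('m option) = Suc CARD('m)" by (simp add: card_option)
  have "g_\<phi> C x = (\<chi> i j. 2 * W C x $ i $ j)"
    by (simp add: kahler_form_def vec_eq_iff)
  then have "det (g_\<phi> C x) = 2 ^ CARD('m option) * det (W C x)"
    by (simp add: det_cmult)
  moreover have "wd None fibre_log_c ?y = 1 / (2 * ?y $ None)"
    by (rule fibre_log_facts(3)) (use x(2) in \<open>simp add: Y_def\<close>)
  then have "\<theta> ?y None = inverse (?y $ None)" by (simp add: inverse_eq_divide)
  then have "det (W C x) = of_real ((cmod (inverse (?y $ None)))\<^sup>2) * (of_real (\<phi> (\<mu> s) / 2) * det (\<omega> (\<mu> s) c (p x)))"
    unfolding adapted_form[OF x] det_form_pullback det_coframe det_block_diag s_def by simp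
  ultimately have "det (g_\<phi> C x) =
     of_real (2 ^ CARD('m) * (cmod (inverse (?y $ None)))\<^sup>2 * \<phi> (\<mu> s)) * det (\<omega> (\<mu> s) c (p x))"
    by (simp add: n)
  moreover have "Re (of_real a * z) = a * Re z" for a z by simp
  ultimately show ?thesis by (simp only: mult.assoc)
qed

text \<open>Up to \<open>log |w|\<^sup>2\<close> and a constant, the logarithm of the volume density of the adapted metric.\<close>

definition log_density :: "real \<times> (complex ^ 'm) \<Rightarrow> complex" where
  "log_density = (\<lambda>(s, z). complex_of_real (ln (\<phi> (\<mu> s) * Re (det (\<omega> (\<mu> s) c (chart_inv c z))))))"

lemma moment_in: "s \<in> times \<Longrightarrow> \<mu> s \<in> I"
  using times_moment(1) interior_subset by blast

lemma det_pos: "s \<in> times \<Longrightarrow> z \<in> Z \<Longrightarrow> 0 < Re (det (\<omega> (\<mu> s) c (chart_inv c z)))"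
  using chart_inv_image[OF gc, of z "fst t"]
  by (intro positive_hermitian_det(2) base_form_positive moment_in c) auto

lemma smooth_log_density: "smooth_on log_density (times \<times> Z)"
proof -
  let ?V = "times \<times> Z"
  have V: "open ?V" by (rule open_Times[OF open_times openZ])
  have f: "smooth_on fst ?V" and s: "smooth_on snd ?V"
    by (rule smooth_on_bounded_linear[OF bounded_linear_fst V], rule smooth_on_bounded_linear[OF bounded_linear_snd V])
  have m: "smooth_on (\<lambda>p. \<mu> (fst p)) ?V"
    by (rule smooth_on_compose[OF V open_times _ f smooth_moment]) auto
  have ph: "smooth_on (\<lambda>p. \<phi> (\<mu> (fst p))) ?V"
    by (rule smooth_on_compose[OF V open_interior _ m smooth]) (auto dest: times_moment(1))
  have ka: "smooth_on (\<lambda>p. kahler_form g c (chart_inv c (snd p)) $ i $ j) ?V" for i j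
    by (rule smooth_on_compose[OF V openZ _ s smooth_on_subset[OF smooth_kahler[OF c]]]) auto
  have ga: "smooth_on (\<lambda>p. \<gamma> c (chart_inv c (snd p)) $ i $ j) ?V" for i j
    by (rule smooth_on_compose[OF V openZ _ s smooth_curvature[OF t c]]) auto
  have "smooth_on (\<lambda>p. \<omega> (\<mu> (fst p)) c (chart_inv c (snd p)) $ i $ j) ?V" for i j
    unfolding base_form_nth
    by (intro smooth_on_diff[OF V] smooth_on_mult[OF V] ka ga smooth_on_bounded_linear_compose[OF bounded_linear_of_real V m])
  then have "smooth_on (\<lambda>p. det (\<omega> (\<mu> (fst p)) c (chart_inv c (snd p)))) ?V"
    by (rule smooth_on_det[OF V])
  then have d: "smooth_on (\<lambda>p. Re (det (\<omega> (\<mu> (fst p)) c (chart_inv c (snd p))))) ?V"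
    by (rule smooth_on_bounded_linear_compose[OF bounded_linear_Re V])
  have "smooth_on (\<lambda>p. complex_of_real (ln (\<phi> (\<mu> (fst p)) * Re (det (\<omega> (\<mu> (fst p)) c (chart_inv c (snd p))))))) ?V"
  proof (rule smooth_on_bounded_linear_compose[OF bounded_linear_of_real V smooth_on_ln[OF V smooth_on_mult[OF V ph d]]])
    fix p assume "p \<in> ?V"
    then show "0 < \<phi> (\<mu> (fst p)) * Re (det (\<omega> (\<mu> (fst p)) c (chart_inv c (snd p))))"
      using pos times_moment(1) det_pos by (intro mult_pos_pos) auto
  qed
  then show ?thesis by (simp add: log_density_def case_prod_unfold)
qed

text \<open>At fixed \<open>s\<close> the profile value is a positive constant and disappears,
  leaving the logarithm of the base determinant.\<close>

lemma hessian_log_density: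
  assumes s: "s \<in> times" and q: "q \<in> fst c \<inter> fst t"
  shows "wd a (wdb b (\<lambda>z. log_density (s, z))) (snd c q) = - ricci_form (metric_of_form (\<omega> (\<mu> s))) c q $ a $ b"
proof -
  let ?u = "\<lambda>y. ln (Re (det (\<omega> (\<mu> s) c y)))"
  have qc: "q \<in> fst c" and z: "snd c q \<in> Z" using q by auto
  have ph: "0 < \<phi> (\<mu> s)" by (rule pos[OF times_moment(1)[OF s]])
  note ric = ricci_base_form[OF moment_in[OF s] c t]
  have "wd a (wdb b (\<lambda>z. complex_of_real (ln (\<phi> (\<mu> s) * Re (det (\<omega> (\<mu> s) c (chart_inv c z))))))) (snd c q)
     = wd a (wdb b (\<lambda>z. complex_of_real (?u (chart_inv c z)))) (snd c q)"
  proof (rule wd_wdb_ln_cmod_sq_add[OF openZ z holo_const[OF openZ]])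
    show "complex_of_real (sqrt (\<phi> (\<mu> s))) \<noteq> 0" using ph by simp
    show "smooth_on (\<lambda>z. complex_of_real (?u (chart_inv c z))) Z"
      by (rule smooth_on_bounded_linear_compose[OF bounded_linear_of_real openZ ric(2)[OF q]])
    fix z assume "z \<in> Z"
    from ln_mult_pos[OF ph det_pos[OF s this]] ph
    show "ln (\<phi> (\<mu> s) * Re (det (\<omega> (\<mu> s) c (chart_inv c z)))) =
        ln ((cmod (complex_of_real (sqrt (\<phi> (\<mu> s)))))\<^sup>2) + ?u (chart_inv c z)"
      by (simp del: of_real_power)
  qed
  also have "\<dots> = - ricci_form (metric_of_form (\<omega> (\<mu> s))) c q $ a $ b"
    by (simp add: ric(1)[OF q] ddbar_eq[OF gc qc])
  finally show ?thesis by (simp add: log_density_def)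
qed

end

section \<open>Scalar curvature\<close>

text \<open>Jacobi's formula restricted from a complex to a real parameter. As the determinant is
  real, the real part of its product with the trace is the product of the real parts.\<close>

lemma (in horizontal) base_det_derivative:
  assumes c: "c \<in> A" and q: "q \<in> fst c" and s: "s \<in> I"
  shows "((\<lambda>s. Re (det (\<omega> s c q))) has_real_derivative
     - (Re (det (\<omega> s c q)) * Re (trace (matrix_inv (\<omega> s c q) ** \<gamma> c q)))) (at s)"
proof -
  have e: "(\<chi> i j. kahler_form g c q $ i $ j - of_real s * \<gamma> c q $ i $ j) = \<omega> s c q" for s
    by (simp add: vec_eq_iff base_form_nth)
  have pos: "positive_hermitian (\<omega> s c q)" by (rule base_form_positive[OF s c q])
  have "((\<lambda>v. det (\<chi> i j. kahler_form g c q $ i $ j - v * \<gamma> c q $ i $ j)) has_field_derivative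
     - (det (\<omega> s c q) * trace (matrix_inv (\<omega> s c q) ** \<gamma> c q))) (at (of_real s))"
    using has_field_derivative_det_pencil[of "kahler_form g c q" "of_real s" "\<gamma> c q"]
      positive_hermitian_det_nz[OF pos] by (simp add: e)
  from has_vector_derivative_real_field[OF this]
  have "((\<lambda>s. det (\<omega> s c q)) has_vector_derivative
     - (det (\<omega> s c q) * trace (matrix_inv (\<omega> s c q) ** \<gamma> c q))) (at s)"
    by (simp add: e)
  from bounded_linear.has_vector_derivative[OF bounded_linear_Re this]
  show ?thesis
    using positive_hermitian_det(1)[OF pos] by (simp add: has_real_derivative_iff_has_vector_derivative)
qed

lemma (in horizontal) smooth_base_det:
  "smooth_on (\<lambda>s. Re (det (\<omega> s c q))) (UNIV :: real set)"
proof -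
  have "smooth_on (\<lambda>s. \<omega> s c q $ i $ j) (UNIV :: real set)" for i j
    unfolding base_form_nth
    by (intro smooth_on_diff smooth_on_mult smooth_on_const smooth_on_bounded_linear bounded_linear_of_real open_UNIV)
  then show ?thesis
    by (intro smooth_on_bounded_linear_compose[OF bounded_linear_Re] smooth_on_det open_UNIV)
qed

context adapted_chart
begin

text \<open>At a fixed base point this is \<open>Q \<phi>\<close> up to the determinant of the
  Kaehler form, which is constant in \<open>v\<close>.\<close>

definition weighted_det :: "'a \<Rightarrow> real \<Rightarrow> real" where
  "weighted_det q = (\<lambda>v. \<phi> v * Re (det (\<omega> v c q)))"

lemma smooth_weighted_det: "smooth_on (weighted_det q) J"
  unfolding weighted_det_def
  by (intro smooth_on_mult open_interior smooth smooth_on_subset[OF smooth_base_det]) simp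

text \<open>With \<open>e = \<phi> E\<close>, the chain rule and
  \<open>\<mu>' = \<phi>(\<mu>)\<close> give \<open>e' \<phi> / (\<phi> E)\<close>, where the
  profile cancels. The second differentiation brings one factor \<open>\<phi>\<close> back, by the
  same rule.\<close>

lemma partial_log_density:
  assumes s: "s \<in> times" and q: "q \<in> fst c \<inter> fst t"
  defines "E \<equiv> \<lambda>v. Re (det (\<omega> v c q))"
  defines "E' \<equiv> - (E (\<mu> s) * Re (trace (matrix_inv (\<omega> (\<mu> s) c q) ** \<gamma> c q)))"
  shows "deriv_fst log_density (s, snd c q) = of_real (deriv (weighted_det q) (\<mu> s) / E (\<mu> s))"
    and "deriv_fst (deriv_fst log_density) (s, snd c q) = of_real
       ((deriv (deriv (weighted_det q)) (\<mu> s) * E (\<mu> s) - deriv (weighted_det q) (\<mu> s) * E') / (E (\<mu> s))\<^sup>2 * \<phi> (\<mu> s))"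
proof -
  have qc: "q \<in> fst c" and z: "snd c q \<in> Z" using q by auto
  have V: "open (times \<times> Z)" by (rule open_Times[OF open_times openZ])
  have cq: "chart_inv c (snd c q) = q" by (rule chart_inv_left[OF gc qc])
  note de = smooth_on_deriv(1)[OF open_interior smooth_weighted_det[of q]]
  note de2 = smooth_on_deriv(1)[OF open_interior smooth_on_deriv(2)[OF open_interior smooth_weighted_det[of q]]]
  have Epos: "0 < E (\<mu> s)" if "s \<in> times" for s
    using det_pos[OF that z] by (simp add: E_def cq)
  have Kq: "log_density (s, snd c q) = of_real (ln (weighted_det q (\<mu> s)))" for s
    by (simp add: log_density_def weighted_det_def cq)
  \<comment> \<open>Established at every time, because the resulting function is differentiated once
    more.\<close>
  have 1: "deriv_fst log_density (s, snd c q) = of_real (deriv (weighted_det q) (\<mu> s) / E (\<mu> s))" if s: "s \<in> times" for s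
  proof -
    note m = times_moment(1)[OF s]
    have ph: "0 < \<phi> (\<mu> s)" by (rule pos[OF m])
    have ep: "weighted_det q (\<mu> s) = \<phi> (\<mu> s) * E (\<mu> s)" by (simp add: weighted_det_def E_def)
    have "0 < weighted_det q (\<mu> s)" using ph Epos[OF s] by (simp add: ep)
    from DERIV_chain2[OF DERIV_ln[OF this] DERIV_chain2[OF de[OF m] moment_derivative[OF s]]]
    have "((\<lambda>s. ln (weighted_det q (\<mu> s))) has_real_derivative inverse (weighted_det q (\<mu> s)) * (deriv (weighted_det q) (\<mu> s) * \<phi> (\<mu> s))) (at s)" .
    also have "inverse (weighted_det q (\<mu> s)) * (deriv (weighted_det q) (\<mu> s) * \<phi> (\<mu> s)) = deriv (weighted_det q) (\<mu> s) / E (\<mu> s)"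
      using ph Epos[OF s] by (simp add: ep field_simps)
    finally have "((\<lambda>s. ln (weighted_det q (\<mu> s))) has_vector_derivative deriv (weighted_det q) (\<mu> s) / E (\<mu> s)) (at s)"
      by (simp only: has_real_derivative_iff_has_vector_derivative)
    from bounded_linear.has_vector_derivative[OF bounded_linear_of_real this]
    have "((\<lambda>s. log_density (s, snd c q)) has_vector_derivative of_real (deriv (weighted_det q) (\<mu> s) / E (\<mu> s))) (at s)"
      unfolding Kq .
    moreover have "((\<lambda>s. log_density (s, snd c q)) has_vector_derivative deriv_fst log_density (s, snd c q)) (at s)"
      by (rule partial_has_derivative(1)[OF smooth_on_differentiable[OF smooth_log_density]]) (use s z in auto)
    ultimately show ?thesis by (rule vector_derivative_unique_at[symmetric])
  qed
  show "deriv_fst log_density (s, snd c q) = of_real (deriv (weighted_det q) (\<mu> s) / E (\<mu> s))" by (rule 1[OF s])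
  let ?G = "(deriv (deriv (weighted_det q)) (\<mu> s) * E (\<mu> s) - deriv (weighted_det q) (\<mu> s) * E') / (E (\<mu> s))\<^sup>2 * \<phi> (\<mu> s)"
  note m = times_moment(1)[OF s]
  have dE: "(E has_real_derivative E') (at (\<mu> s))"
    unfolding E_def E'_def by (rule base_det_derivative[OF c qc moment_in[OF s]])
  have "((\<lambda>v. deriv (weighted_det q) v / E v) has_real_derivative
      (deriv (deriv (weighted_det q)) (\<mu> s) * E (\<mu> s) - deriv (weighted_det q) (\<mu> s) * E') / (E (\<mu> s) * E (\<mu> s))) (at (\<mu> s))"
    using Epos[OF s] by (intro DERIV_divide de2[OF m] dE) simp
  from DERIV_chain2[OF this moment_derivative[OF s]]
  have "((\<lambda>s. deriv (weighted_det q) (\<mu> s) / E (\<mu> s)) has_vector_derivative ?G) (at s)"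
    by (simp only: has_real_derivative_iff_has_vector_derivative power2_eq_square)
  from bounded_linear.has_vector_derivative[OF bounded_linear_of_real this]
  have "((\<lambda>s. complex_of_real (deriv (weighted_det q) (\<mu> s) / E (\<mu> s))) has_vector_derivative of_real ?G) (at s)" .
  then have "((\<lambda>s. deriv_fst log_density (s, snd c q)) has_vector_derivative of_real ?G) (at s)"
    by (rule has_vector_derivative_transform_within_open[OF _ open_times s]) (simp only: 1)
  moreover have "((\<lambda>s. deriv_fst log_density (s, snd c q)) has_vector_derivative deriv_fst (deriv_fst log_density) (s, snd c q)) (at s)"
    by (rule partial_has_derivative(1)[OF smooth_on_differentiable[OF smooth_on_partial(1)[OF V smooth_log_density]]])
       (use s z in auto)
  ultimately show "deriv_fst (deriv_fst log_density) (s, snd c q) = of_real ?G" by (rule vector_derivative_unique_at[symmetric])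
qed

text \<open>The volume density is \<open>log_density\<close> up to a pluriharmonic term, and
  \<open>log_density\<close> depends only on fibre logarithm and base point, so
  \<open>wd_wdb_fibre_form\<close> applies with the Hessian \<open>- \<gamma> / 2\<close> of the
  fibre logarithm.\<close>

lemma ricci_adapted:
  assumes x: "x \<in> fst C" "snd C x \<in> Y"
  defines "s \<equiv> fibre_log (snd C x)" and "q \<equiv> p x"
  shows "\<exists>u l. ricci_form g_\<phi> C x = form_pullback (coframe (\<theta> (snd C x)))
     (block_matrix (- deriv_fst (deriv_fst log_density) (s, snd c q) / 4) u l
       (\<chi> a b. ricci_form (metric_of_form (\<omega> (\<mu> s))) c q $ a $ b + deriv_fst log_density (s, snd c q) / 2 * \<gamma> c q $ a $ b))"
proof -
  let ?y = "snd C x"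
  have q: "q \<in> fst c \<inter> fst t" using x(1) by (simp add: total_chart_coords over_def q_def)
  have s: "s \<in> times" using Y_D(3)[OF x(2)] by (simp add: s_def)
  have V: "open (times \<times> Z)" by (rule open_Times[OF open_times openZ])
  have maps: "(fibre_log y, base_coord y) \<in> times \<times> Z" if "y \<in> Y" for y using Y_D[OF that] by simp
  have bq: "base_coord ?y = snd c q" by (simp add: total_chart_coords q_def)
  have pair: "smooth_on (\<lambda>y. (fibre_log y, base_coord y)) Y"
    by (intro smooth_on_Pair openY smooth_fibre_log smooth_on_bounded_linear bounded_linear_base_coord)
  have sKY: "smooth_on (\<lambda>y. log_density (fibre_log y, base_coord y)) Y"
    by (rule smooth_on_compose[OF openY V _ pair smooth_log_density]) (use maps in auto)
  \<comment> \<open>Its squared modulus is the prefactor of the determinant in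
    \<open>det_adapted\<close>.\<close>
  let ?k = "\<lambda>y::complex ^ 'm option. complex_of_real (sqrt (2 ^ CARD('m))) * inverse (y $ None)"
  have "holo (\<lambda>y::complex ^ 'm option. y $ None) Y"
    by (simp add: holo_def smooth_on_bounded_linear[OF bounded_linear_vec_nth openY] wd_vec_nth)
  then have hk: "holo ?k Y"
    by (intro holo_mult openY holo_const holo_inverse) (auto dest: Y_D(1))
  have hess: "wd i (wdb j (\<lambda>y. complex_of_real (ln (Re (det (g_\<phi> C (chart_inv C y))))))) ?y =
     wd i (wdb j (\<lambda>y. log_density (fibre_log y, base_coord y))) ?y" for i j
  proof -
    let ?R = "\<lambda>y. ln (\<phi> (\<mu> (fibre_log y)) * Re (det (\<omega> (\<mu> (fibre_log y)) c (chart_inv c (base_coord y)))))"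
    have KR: "log_density (fibre_log y, base_coord y) = complex_of_real (?R y)" for y by (simp add: log_density_def)
    show ?thesis
      unfolding KR
    proof (rule wd_wdb_ln_cmod_sq_add[OF openY x(2) hk])
      show "smooth_on (\<lambda>y. complex_of_real (?R y)) Y" using sKY unfolding KR .
      fix y assume y: "y \<in> Y"
      note yD = Y_D[OF y] and inv = total_inv[OF Y_D(2)[OF y]]
      show "?k y \<noteq> 0" using yD by simp
      have a: "0 < (cmod (?k y))\<^sup>2" using yD by simp
      have b: "0 < \<phi> (\<mu> (fibre_log y)) * Re (det (\<omega> (\<mu> (fibre_log y)) c (chart_inv c (base_coord y))))"
        by (intro mult_pos_pos pos times_moment(1) det_pos yD)
      have "Re (det (g_\<phi> C (chart_inv C y))) = (cmod (?k y))\<^sup>2 * (\<phi> (\<mu> (fibre_log y)) * Re (det (\<omega> (\<mu> (fibre_log y)) c (chart_inv c (base_coord y)))))"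
        using det_adapted[OF inv(1)] y by (simp add: inv norm_mult power_mult_distrib norm_inverse)
      then show "ln (Re (det (g_\<phi> C (chart_inv C y)))) = ln ((cmod (?k y))\<^sup>2) + ?R y"
        by (simp only: ln_mult_pos[OF a b])
    qed
  qed
  obtain u l where ul: "(\<chi> i j. wd i (wdb j (\<lambda>x. log_density (fibre_log x, base_coord x))) ?y) =
    form_pullback (coframe (\<theta> ?y))
      (block_matrix (deriv_fst (deriv_fst log_density) (fibre_log ?y, base_coord ?y) / 4) u l
        (\<chi> a b. wd a (wdb b (\<lambda>z. log_density (fibre_log ?y, z))) (base_coord ?y) + deriv_fst log_density (fibre_log ?y, base_coord ?y) * (\<chi> a b. - \<gamma> c q $ a $ b / 2) $ a $ b))"
    using wd_wdb_fibre_form[OF openY x(2) V maps smooth_fibre_log smooth_log_density, of "\<chi> a b. - \<gamma> c q $ a $ b / 2"]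
    by (auto simp: hessian_fibre_log[OF x] q_def)
  have "ricci_form g_\<phi> C x = - (\<chi> i j. wd i (wdb j (\<lambda>x. log_density (fibre_log x, base_coord x))) ?y)"
    by (simp add: ricci_form_def vec_eq_iff ddbar_eq[OF good_total x(1)] hess)
  also have "\<dots> = form_pullback (coframe (\<theta> ?y)) (- (block_matrix (deriv_fst (deriv_fst log_density) (fibre_log ?y, base_coord ?y) / 4) u l
        (\<chi> a b. wd a (wdb b (\<lambda>z. log_density (fibre_log ?y, z))) (base_coord ?y) + deriv_fst log_density (fibre_log ?y, base_coord ?y) * (\<chi> a b. - \<gamma> c q $ a $ b / 2) $ a $ b)))"
    unfolding ul form_pullback_uminus ..
  \<comment> \<open>The sign turns the base Hessian of \<open>log_density\<close> into the Ricci
    form and the coefficient \<open>- \<gamma> / 2\<close> into \<open>\<gamma> / 2\<close>.\<close>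
  also have "- (block_matrix (deriv_fst (deriv_fst log_density) (fibre_log ?y, base_coord ?y) / 4) u l
        (\<chi> a b. wd a (wdb b (\<lambda>z. log_density (fibre_log ?y, z))) (base_coord ?y) + deriv_fst log_density (fibre_log ?y, base_coord ?y) * (\<chi> a b. - \<gamma> c q $ a $ b / 2) $ a $ b))
     = block_matrix (- deriv_fst (deriv_fst log_density) (s, snd c q) / 4) (\<lambda>b. - u b) (\<lambda>a. - l a)
       (\<chi> a b. ricci_form (metric_of_form (\<omega> (\<mu> s))) c q $ a $ b + deriv_fst log_density (s, snd c q) / 2 * \<gamma> c q $ a $ b)"
    unfolding bq s_def[symmetric]
    by (simp add: block_matrix_def vec_eq_iff hessian_log_density[OF s q] split: option.splits)
  finally show ?thesis by blast
qed

text \<open>Writing \<open>G\<close> for \<open>log_density\<close>, the fibre block contributes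
  \<open>- G_tt / (2 \<phi>)\<close> and the base block the scalar curvature of the base plus
  \<open>G_t tr / 2\<close>.\<close>

lemma scalar_curvature_adapted:
  assumes x: "x \<in> fst C" "snd C x \<in> Y"
  defines "s \<equiv> \<mu> (fibre_log (snd C x))" and "q \<equiv> p x"
  shows "Re (trace (matrix_inv (W C x) ** ricci_form g_\<phi> C x)) =
    scalar_curvature A (metric_of_form (\<omega> s)) q - deriv (deriv (weighted_det q)) s / (2 * Re (det (\<omega> s c q)))"
proof -
  let ?t = "fibre_log (snd C x)" and ?w = "\<omega> s c q"
  have t: "?t \<in> times" by (rule Y_D(3)[OF x(2)])
  have q: "q \<in> fst c \<inter> fst t" and qc: "q \<in> fst c" using x(1) by (simp_all add: total_chart_coords over_def q_def)
  have sI: "s \<in> I" unfolding s_def by (rule moment_in[OF t])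
  have ph: "0 < \<phi> s" unfolding s_def by (rule pos[OF times_moment(1)[OF t]])
  have wpos: "positive_hermitian ?w" by (rule base_form_positive[OF sI c qc])
  have E: "0 < Re (det ?w)" by (rule positive_hermitian_det(2)[OF wpos])
  define tr where "tr = trace (matrix_inv ?w ** \<gamma> c q)"
  define B where "B = block_matrix (of_real (\<phi> s / 2)) (\<lambda>_. 0) (\<lambda>_. 0) ?w"
  have det_c: "det (coframe (\<theta> (snd C x))) \<noteq> 0"
    using fibre_log_facts(3)[of "snd C x"] x(2) Y_D(1)[OF x(2)] by (simp add: det_coframe Y_def)
  have det_B: "det B \<noteq> 0" using ph positive_hermitian_det_nz[OF wpos] by (simp add: B_def det_block_diag)
  obtain u l where R: "ricci_form g_\<phi> C x = form_pullback (coframe (\<theta> (snd C x)))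
     (block_matrix (- deriv_fst (deriv_fst log_density) (?t, snd c q) / 4) u l
       (\<chi> a b. ricci_form (metric_of_form (\<omega> s)) c q $ a $ b + deriv_fst log_density (?t, snd c q) / 2 * \<gamma> c q $ a $ b))"
    (is "_ = form_pullback _ ?R")
    using ricci_adapted[OF x] unfolding s_def q_def by (elim exE)
  have "W C x = form_pullback (coframe (\<theta> (snd C x))) B"
    unfolding B_def s_def q_def by (rule adapted_form[OF x])
  then have "trace (matrix_inv (W C x) ** ricci_form g_\<phi> C x) = trace (matrix_inv B ** ?R)"
    using trace_form_pullback[OF det_c det_B] by (simp only: R)
  also have "\<dots> = ?R $ None $ None / B $ None $ None + trace (matrix_inv (some_block B) ** some_block ?R)"
    using ph positive_hermitian_det_nz[OF wpos] by (intro trace_block) (simp_all add: B_def)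
  also have "trace (matrix_inv (some_block B) ** some_block ?R) =
     trace (matrix_inv ?w ** ricci_form (metric_of_form (\<omega> s)) c q) + deriv_fst log_density (?t, snd c q) / 2 * tr"
    by (simp add: B_def tr_def trace_def matrix_matrix_mult_def distrib_left sum.distrib sum_distrib_left mult_ac)
  finally have eq: "Re (trace (matrix_inv (W C x) ** ricci_form g_\<phi> C x)) =
     Re (?R $ None $ None / B $ None $ None) + Re (deriv_fst log_density (?t, snd c q) / 2 * tr)
     + scalar_curvature A (metric_of_form (\<omega> s)) q"
    by (simp add: scalar_curvature_chart[OF sI c qc])
  let ?E = "Re (det ?w)" and ?e1 = "deriv (weighted_det q) s" and ?e2 = "deriv (deriv (weighted_det q)) s"
  have "?R $ None $ None / B $ None $ None =
     of_real (- ((?e2 * ?E - ?e1 * (- (?E * Re tr))) / ?E\<^sup>2 * \<phi> s) / 4 / (\<phi> s / 2))"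
    unfolding B_def block_matrix_nth partial_log_density(2)[OF t q, folded s_def] tr_def by simp
  then have 1: "Re (?R $ None $ None / B $ None $ None) =
     - ((?e2 * ?E - ?e1 * (- (?E * Re tr))) / ?E\<^sup>2 * \<phi> s) / 4 / (\<phi> s / 2)"
    by (simp only: Re_complex_of_real)
  have 2: "Re (deriv_fst log_density (?t, snd c q) / 2 * tr) = ?e1 / ?E / 2 * Re tr"
    unfolding partial_log_density(1)[OF t q, folded s_def] by simp
  \<comment> \<open>The terms \<open>e1 T / (2 x)\<close> arising from the fibre block and from the
    base block have opposite signs and cancel.\<close>
  have "- ((e2 * x - e1 * (- (x * T))) / x\<^sup>2 * f) / 4 / (f / 2) + e1 / x / 2 * T = - e2 / (2 * x)"
    if "0 < x" "0 < f" for e1 e2 x T f :: real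
    using that by (simp add: field_simps power2_eq_square)
  from this[OF E ph] show ?thesis unfolding eq 1 2 by simp
qed

end

section \<open>Orbits and the curvature formula on the adapted domain\<close>

context adapted
begin

abbreviation "D \<equiv> adapted_domain L r I \<phi> \<tau>0"
abbreviation "\<tau> \<equiv> \<lambda>x. \<mu> (log_norm r x)"

lemma domain_iff: "x \<in> D \<longleftrightarrow> x \<in> topspace L \<and> 0 < r x \<and> log_norm r x \<in> times"
  by (auto simp: adapted_domain_def times_def)

text \<open>Since \<open>time\<close> inverts \<open>\<mu>\<close>, equal moment values mean equal
  norms. Within one fibre this fixes the modulus of the fibre coordinate and leaves a phase.\<close>

lemma orbit:
  assumes x: "x \<in> D"
  shows "{y \<in> D. \<tau> y = \<tau> x \<and> p y = p x} = range (\<lambda>\<alpha>. fibre_scale L p T (cis \<alpha>) x)"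
proof -
  have xL: "x \<in> topspace L" and rx: "0 < r x" and lx: "log_norm r x \<in> times"
    using x by (simp_all add: domain_iff)
  obtain t where t: "t \<in> T" "p x \<in> fst t" using around_triv[OF p_in[OF xL]] by blast
  note fs = fibre_scale_props[OF xL]
  note nx = norm_eq[OF t(1) xL t(2)]
  show ?thesis
  proof (intro equalityI subsetI)
    fix y assume "y \<in> {y \<in> D. \<tau> y = \<tau> x \<and> p y = p x}"
    then have y: "y \<in> topspace L" "0 < r y" "log_norm r y \<in> times" "\<tau> y = \<tau> x" "p y = p x"
      by (simp_all add: domain_iff)
    have "log_norm r y = log_norm r x"
      using arg_cong[OF y(4), of time] by (simp only: times_moment(2)[OF y(3)] times_moment(2)[OF lx])
    then have "r y = r x" using y(2) rx by (simp add: log_norm_def)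
    moreover have "r y = (cmod (snd t y))\<^sup>2 * h t (p x)" using norm_eq[OF t(1) y(1)] t(2) y(5) by simp
    ultimately have "(cmod (snd t y))\<^sup>2 = (cmod (snd t x))\<^sup>2"
      using nx h_pos[OF t] by simp
    then have n: "cmod (snd t y) = cmod (snd t x)" by simp
    have x0: "snd t x \<noteq> 0" using nx rx by auto
    \<comment> \<open>The phase that carries \<open>x\<close> to \<open>y\<close>; positive norm
      keeps \<open>x\<close> off the zero section, so the quotient makes sense.\<close>
    define z where "z = snd t y / snd t x"
    have "cmod z = 1" using n x0 by (simp add: z_def norm_divide)
    then have z: "cis (Arg z) = z" using rcis_cmod_Arg[of z] by (simp add: rcis_def)
    have "y = fibre_scale L p T (cis (Arg z)) x"
    proof (rule triv_unique[OF t(1)])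
      show "snd t y = snd t (fibre_scale L p T (cis (Arg z)) x)"
        unfolding fs(3)[OF t] z using x0 by (simp add: z_def)
    qed (use y t fs in simp_all)
    then show "y \<in> range (\<lambda>\<alpha>. fibre_scale L p T (cis \<alpha>) x)" by blast
  next
    fix y assume "y \<in> range (\<lambda>\<alpha>. fibre_scale L p T (cis \<alpha>) x)"
    then obtain a where a: "y = fibre_scale L p T (cis a) x" by blast
    have y: "y \<in> topspace L" "p y = p x" "snd t y = cis a * snd t x" using fs t by (simp_all add: a)
    have "r y = r x" using norm_eq[OF t(1) y(1)] t(2) nx y by (simp add: norm_mult)
    then show "y \<in> {y \<in> D. \<tau> y = \<tau> x \<and> p y = p x}"
      using x y by (simp add: domain_iff log_norm_def)
  qed
qed

text \<open>Only the passage from determinants to \<open>Q\<close> remains: the determinant of the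
  Kaehler form at \<open>p x\<close> is constant in \<open>s\<close> and cancels between
  \<open>1 / Q\<close> and the second derivative.\<close>

lemma scalar_curvature_formula:
  assumes x: "x \<in> D"
  defines "Q \<equiv> \<lambda>s. volume_ratio A (\<omega> s) (kahler_form g)"
  shows "scalar_curvature (total_atlas A L p T) (adapted_metric A g p r I \<phi> \<tau>0) x =
    scalar_curvature A (metric_of_form (\<omega> (\<tau> x))) (p x) -
      1 / (2 * Q (\<tau> x) (p x)) * (deriv ^^ 2) (\<lambda>s. Q s (p x) * \<phi> s) (\<tau> x)"
proof -
  have xL: "x \<in> topspace L" and rx: "0 < r x" and lx: "log_norm r x \<in> times"
    using x by (simp_all add: domain_iff)
  have "\<exists>C\<in>total_atlas A L p T. x \<in> fst C"
  proof
    let ?C = "total_chart L p (around A (p x)) (around T (p x))"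
    show "?C \<in> total_atlas A L p T" "x \<in> fst ?C"
      using around_chart[OF p_in[OF xL]] around_triv[OF p_in[OF xL]] xL
      unfolding total_atlas_eq by (blast, simp add: total_chart_coords over_def)
  qed
  from around_in[OF this] obtain c t where ct: "c \<in> A" "t \<in> T"
    and C: "around (total_atlas A L p T) x = total_chart L p c t" "x \<in> fst (total_chart L p c t)"
    unfolding total_atlas_eq by auto
  interpret adapted_chart M A g L p T r I \<phi> \<tau>0 c t by unfold_locales (rule ct)+
  define q where "q = p x"
  have q: "q \<in> fst c" "q \<in> fst t" using C(2) by (simp_all add: total_chart_coords over_def q_def)
  have nz: "snd C x $ None \<noteq> 0"
    using norm_eq[OF ct(2) xL] q rx by (auto simp: total_chart_coords q_def)
  have bc: "base_coord (snd C x) \<in> Z" using q by (simp add: total_chart_coords q_def)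
  have "chart_inv C (snd C x) = x" by (rule chart_inv_left[OF good_total C(2)])
  then have tx: "fibre_log (snd C x) = log_norm r x" using log_norm_total[OF bc nz] by simp
  have Y: "snd C x \<in> Y" using nz bc lx by (simp add: Y_def tx)
  let ?s = "\<tau> x" and ?\<kappa> = "Re (det (kahler_form g c q))"
  have sJ: "?s \<in> J" by (rule times_moment(1)[OF lx])
  have \<kappa>: "0 < ?\<kappa>" by (rule positive_hermitian_det(2)[OF kahler_form_positive[OF ct(1) q(1)]])
  have Q: "Q s q = Re (det (\<omega> s c q)) / ?\<kappa>" for s
    unfolding Q_def by (rule volume_ratio_chart[OF ct(1) q(1)])
  have Q\<phi>: "(\<lambda>s. Q s q * \<phi> s) = (\<lambda>s. weighted_det q s / ?\<kappa>)"
    by (simp add: Q weighted_det_def mult.commute)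
  note e1 = smooth_on_deriv[OF open_interior smooth_weighted_det[of q]]
  \<comment> \<open>Valid on all of the open set \<open>J\<close>, hence near \<open>?s\<close>,
    which is what the second differentiation requires.\<close>
  have d1: "deriv (\<lambda>s. weighted_det q s / ?\<kappa>) v = deriv (weighted_det q) v / ?\<kappa>" if "v \<in> J" for v
    by (rule DERIV_imp_deriv[OF DERIV_cdivide[OF e1(1)[OF that]]])
  have "((\<lambda>v. deriv (weighted_det q) v / ?\<kappa>) has_real_derivative deriv (deriv (weighted_det q)) ?s / ?\<kappa>) (at ?s)"
    by (rule DERIV_cdivide[OF smooth_on_deriv(1)[OF open_interior e1(2) sJ]])
  then have "(deriv (\<lambda>s. weighted_det q s / ?\<kappa>) has_real_derivative deriv (deriv (weighted_det q)) ?s / ?\<kappa>) (at ?s)"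
    by (rule has_field_derivative_transform_within_open[OF _ open_interior sJ]) (simp add: d1)
  then have d2: "(deriv ^^ 2) (\<lambda>s. Q s q * \<phi> s) ?s = deriv (deriv (weighted_det q)) ?s / ?\<kappa>"
    unfolding Q\<phi> by (simp add: numeral_2_eq_2 DERIV_imp_deriv)
  have "scalar_curvature (total_atlas A L p T) (adapted_metric A g p r I \<phi> \<tau>0) x =
      scalar_curvature A (metric_of_form (\<omega> ?s)) q - deriv (deriv (weighted_det q)) ?s / (2 * Re (det (\<omega> ?s c q)))"
    using scalar_curvature_adapted[OF C(2) Y] by (simp only: scalar_curvature_def[of "total_atlas A L p T"] Let_def C(1) tx q_def)
  then show ?thesis
    unfolding q_def[symmetric] d2 using \<kappa> by (simp add: Q)
qed

end

theorem theorem1: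
  fixes M :: "'a topology" and A :: "('a, 'm::finite) chart set" and g :: "('a, 'm) form11"
    and L :: "'b topology" and p :: "'b \<Rightarrow> 'a" and T :: "('a, 'b) triv set" and r :: "'b \<Rightarrow> real"
    and I :: "real set" and \<phi> :: "real \<Rightarrow> real" and \<tau>0 :: real
    and \<tau> :: "'b \<Rightarrow> real" and Q :: "real \<Rightarrow> 'a \<Rightarrow> real" and \<sigma>_M :: "real \<Rightarrow> 'a \<Rightarrow> real"
    and \<sigma>_\<phi> :: "'b \<Rightarrow> real" and D :: "'b set"
  assumes "horizontal_data M A g L p T r I"
    and "momentum_profile I \<phi>"
    and "\<tau>0 \<in> interior I"
  defines "D \<equiv> adapted_domain L r I \<phi> \<tau>0"
    and "\<tau> \<equiv> \<lambda>x. moment I \<phi> \<tau>0 (log_norm r x)"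
    and "Q \<equiv> \<lambda>s. volume_ratio A (base_form g L p T r s) (kahler_form g)"
    and "\<sigma>_M \<equiv> \<lambda>s. scalar_curvature A (metric_of_form (base_form g L p T r s))"
    and "\<sigma>_\<phi> \<equiv> scalar_curvature (total_atlas A L p T) (adapted_metric A g p r I \<phi> \<tau>0)"
  shows "(\<forall>x\<in>D. \<tau> x \<in> I \<and> p x \<in> topspace M \<and>
            {y \<in> D. \<tau> y = \<tau> x \<and> p y = p x} = range (\<lambda>\<theta>. fibre_scale L p T (cis \<theta>) x)) \<and>
         (\<forall>x\<in>D. \<sigma>_\<phi> x = \<sigma>_M (\<tau> x) (p x) -
            1 / (2 * Q (\<tau> x) (p x)) * (deriv ^^ 2) (\<lambda>s. Q s (p x) * \<phi> s) (\<tau> x))"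
proof -
  interpret ad: adapted M A g L p T r I \<phi> \<tau>0
    by unfold_locales (use assms(1-3) in \<open>auto simp: horizontal_data_def\<close>)
  show ?thesis
    unfolding D_def \<tau>_def Q_def \<sigma>_M_def \<sigma>_\<phi>_def
  proof (intro conjI ballI)
    fix x assume x: "x \<in> adapted_domain L r I \<phi> \<tau>0"
    then have xd: "x \<in> topspace L" "log_norm r x \<in> ad.times" by (simp_all add: ad.domain_iff)
    show "moment I \<phi> \<tau>0 (log_norm r x) \<in> I"
      using ad.times_moment(1)[OF xd(2)] interior_subset by blast
    show "p x \<in> topspace M" by (rule ad.p_in[OF xd(1)])
    show "{y \<in> adapted_domain L r I \<phi> \<tau>0. moment I \<phi> \<tau>0 (log_norm r y) = moment I \<phi> \<tau>0 (log_norm r x) \<and> p y = p x}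
      = range (\<lambda>\<theta>. fibre_scale L p T (cis \<theta>) x)"
      by (rule ad.orbit[OF x])
  next
    fix x assume x: "x \<in> adapted_domain L r I \<phi> \<tau>0"
    show "scalar_curvature (total_atlas A L p T) (adapted_metric A g p r I \<phi> \<tau>0) x =
      scalar_curvature A (metric_of_form (base_form g L p T r (moment I \<phi> \<tau>0 (log_norm r x)))) (p x) -
      1 / (2 * volume_ratio A (base_form g L p T r (moment I \<phi> \<tau>0 (log_norm r x))) (kahler_form g) (p x)) *
      (deriv ^^ 2) (\<lambda>s. volume_ratio A (base_form g L p T r s) (kahler_form g) (p x) * \<phi> s) (moment I \<phi> \<tau>0 (log_norm r x))"
      by (rule ad.scalar_curvature_formula[OF x])
  qed
qed

end
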